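(* Let $K$ be a field, $S=K[x_1,\ldots,x_n]$, let $M$ be a finitely generated graded $S$-module and let $\operatorname{Sym}(M)=T/J$ be a minimal presentation of the symmetric algebra of $M$; that is, $f_1,\ldots,f_m$ is a minimal system of homogeneous generators of $M$, $T=K[x_1,\ldots,x_n,y_1,\ldots,y_m]$, and $J$ is the kernel of the surjection $T\to\operatorname{Sym}(M)$, $x_i\mapsto x_i$, $y_j\mapsto f_j$. Let $<'$ be a monomial order on $K[y_1,\ldots,y_m]$, $<_x$ a monomial order on $K[x_1,\ldots,x_n]$, and let $<$ be the monomial order on $T$ given by: $uw<u'w'$ (with $u,u'$ monomials in the $x_i$ and $w,w'$ monomials in the $y_j$) if $w<'w'$, or $w=w'$ and $u<_xu'$. If $J$ satisfies the $x$-condition with respect to $<$, then all symmetric powers $\operatorname{Sym}_k(M)$ of $M$ are componentwise linear.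
   Context: $S$ has the standard grading; $\operatorname{Sym}_k(M)$ is the $k$-th symmetric power of $M$ over $S$, with the grading induced from $M$. $J$ satisfies the $x$-condition with respect to a monomial order $<$ on $T$ if every minimal monomial generator of $\operatorname{in}_<(J)$ has the form $vw$ with $v$ a monomial of degree $\le1$ in $x_1,\ldots,x_n$ and $w$ a monomial in $y_1,\ldots,y_m$. For a graded $S$-module $N$, $N_{\langle d\rangle}$ is the submodule generated by all elements of degree $d$; $N$ is componentwise linear if $N_{\langle d\rangle}$ has a linear resolution for every $d$ (the zero module is regarded as having a linear resolution). *)

theory Defs
  imports "HOL-Library.Poly_Mapping" "HOL-Algebra.Module" "HOL-Algebra.QuotRing"
begin

section \<open>Polynomials\<close>

type_synonym 'v monomial = "'v \<Rightarrow>\<^sub>0 nat"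
type_synonym ('v, 'k) mpoly = "('v \<Rightarrow>\<^sub>0 nat) \<Rightarrow>\<^sub>0 'k"

text \<open>The polynomial ring over the field \<open>'k\<close> in the variables belonging to the set \<open>V\<close>.\<close>

definition poly_ring :: "'v set \<Rightarrow> ('v, 'k::field) mpoly ring" where
  "poly_ring V =
     \<lparr>carrier = {p. \<forall>t \<in> Poly_Mapping.keys p. Poly_Mapping.keys t \<subseteq> V},
      mult = (*), one = 1, zero = 0, add = (+)\<rparr>"

text \<open>The variables \<open>x\<^sub>1, \<dots>, x\<^sub>n\<close> and \<open>y\<^sub>1, \<dots>, y\<^sub>m\<close> are numbered from 0; in
  \<open>T\<close> the former carry the tag \<open>Inl\<close> and the latter the tag \<open>Inr\<close>.\<close>

abbreviation S_ring :: "nat \<Rightarrow> (nat, 'k::field) mpoly ring" where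
  "S_ring n \<equiv> poly_ring {..<n}"

abbreviation T_ring :: "nat \<Rightarrow> nat \<Rightarrow> (nat + nat, 'k::field) mpoly ring" where
  "T_ring n m \<equiv> poly_ring ({..<n} <+> {..<m})"

definition mon :: "'v monomial \<Rightarrow> ('v, 'k::field) mpoly" where
  "mon t = Poly_Mapping.single t 1"

definition var :: "'v \<Rightarrow> ('v, 'k::field) mpoly" where
  "var v = mon (Poly_Mapping.single v 1)"

definition mdeg :: "'v monomial \<Rightarrow> nat" where
  "mdeg t = (\<Sum>v \<in> Poly_Mapping.keys t. Poly_Mapping.lookup t v)"

definition x_part :: "('x + 'y) monomial \<Rightarrow> 'x monomial" where
  "x_part t = Poly_Mapping.map_key Inl t"

definition y_part :: "('x + 'y) monomial \<Rightarrow> 'y monomial" where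
  "y_part t = Poly_Mapping.map_key Inr t"

text \<open>The \<open>K\<close>-algebra homomorphism sending each variable \<open>v\<close> to the variable \<open>g v\<close>
  (\<open>g\<close> need not be injective).\<close>

definition rename_monomial :: "('v \<Rightarrow> 'w) \<Rightarrow> 'v monomial \<Rightarrow> 'w monomial" where
  "rename_monomial g t =
     (\<Sum>v \<in> Poly_Mapping.keys t. Poly_Mapping.single (g v) (Poly_Mapping.lookup t v))"

definition rename_vars :: "('v \<Rightarrow> 'w) \<Rightarrow> ('v, 'k::field) mpoly \<Rightarrow> ('w, 'k) mpoly" where
  "rename_vars g p =
     (\<Sum>t \<in> Poly_Mapping.keys p.
        Poly_Mapping.single (rename_monomial g t) (Poly_Mapping.lookup p t))"

definition S_homogeneous :: "nat \<Rightarrow> int \<Rightarrow> (nat, 'k::field) mpoly set" where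
  "S_homogeneous n d =
     {p \<in> carrier (S_ring n). \<forall>t \<in> Poly_Mapping.keys p. int (mdeg t) = d}"


section \<open>Graded modules\<close>

text \<open>A grading of a module is given by its components \<open>G d\<close>, \<open>d \<in> \<int>\<close>.\<close>

definition graded_module ::
  "nat \<Rightarrow> ((nat, 'k::field) mpoly, 'b) module \<Rightarrow> (int \<Rightarrow> 'b set) \<Rightarrow> bool" where
  "graded_module n M G \<longleftrightarrow>
     module (S_ring n) M \<and>
     (\<forall>d. subgroup (G d) (add_monoid M)) \<and>
     (\<forall>i d. \<forall>s \<in> S_homogeneous n i. \<forall>z \<in> G d. s \<odot>\<^bsub>M\<^esub> z \<in> G (i + d)) \<and>
     (\<forall>z \<in> carrier M. \<exists>!c. (\<forall>d. c d \<in> G d) \<and> finite {d. c d \<noteq> \<zero>\<^bsub>M\<^esub>} \<and>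
        z = finsum M c {d. c d \<noteq> \<zero>\<^bsub>M\<^esub>})"

definition generated_submodule ::
  "nat \<Rightarrow> ((nat, 'k::field) mpoly, 'b) module \<Rightarrow> 'b set \<Rightarrow> 'b set" where
  "generated_submodule n M A = \<Inter>{H. submodule H (S_ring n) M \<and> A \<subseteq> H}"

definition minimal_homogeneous_generators ::
  "nat \<Rightarrow> ((nat, 'k::field) mpoly, 'b) module \<Rightarrow> (int \<Rightarrow> 'b set) \<Rightarrow> nat \<Rightarrow> (nat \<Rightarrow> 'b) \<Rightarrow> bool"
where
  "minimal_homogeneous_generators n M G m f \<longleftrightarrow>
     (\<forall>j<m. f j \<in> carrier M \<and> (\<exists>d. f j \<in> G d)) \<and>
     generated_submodule n M (f ` {..<m}) = carrier M \<and>
     (\<forall>A. A \<subset> {..<m} \<longrightarrow> generated_submodule n M (f ` A) \<noteq> carrier M)"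

definition graded_hom ::
  "nat \<Rightarrow> ((nat, 'k::field) mpoly, 'b) module \<Rightarrow> (int \<Rightarrow> 'b set) \<Rightarrow>
   ((nat, 'k) mpoly, 'c) module \<Rightarrow> (int \<Rightarrow> 'c set) \<Rightarrow> ('b \<Rightarrow> 'c) \<Rightarrow> bool" where
  "graded_hom n M G N H h \<longleftrightarrow>
     h \<in> carrier M \<rightarrow> carrier N \<and>
     (\<forall>u \<in> carrier M. \<forall>v \<in> carrier M. h (u \<oplus>\<^bsub>M\<^esub> v) = h u \<oplus>\<^bsub>N\<^esub> h v) \<and>
     (\<forall>s \<in> carrier (S_ring n). \<forall>u \<in> carrier M. h (s \<odot>\<^bsub>M\<^esub> u) = s \<odot>\<^bsub>N\<^esub> h u) \<and>
     (\<forall>d. h ` G d \<subseteq> H d)"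


section \<open>Graded free resolutions and componentwise linearity\<close>

definition free_module :: "nat \<Rightarrow> nat \<Rightarrow> ((nat, 'k::field) mpoly, nat \<Rightarrow> (nat, 'k) mpoly) module"
where
  "free_module n b =
     \<lparr>carrier = {u. (\<forall>j<b. u j \<in> carrier (S_ring n)) \<and> (\<forall>j\<ge>b. u j = 0)},
      mult = (\<lambda>u v j. u j * v j), one = (\<lambda>j. if j < b then 1 else 0),
      zero = (\<lambda>_. 0), add = (\<lambda>u v j. u j + v j), smult = (\<lambda>s u j. s * u j)\<rparr>"

text \<open>The grading of \<open>S(-a\<^sub>0) \<oplus> \<dots> \<oplus> S(-a\<^sub>b\<^sub>-\<^sub>1)\<close>.\<close>

definition shifted_grading ::
  "nat \<Rightarrow> nat \<Rightarrow> (nat \<Rightarrow> int) \<Rightarrow> int \<Rightarrow> (nat \<Rightarrow> (nat, 'k::field) mpoly) set" where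
  "shifted_grading n b a d =
     {u \<in> carrier (free_module n b). \<forall>j<b. u j \<in> S_homogeneous n (d - a j)}"

text \<open>A complex \<open>\<dots> \<rightarrow> F\<^sub>1 \<rightarrow> F\<^sub>0 \<rightarrow> N \<rightarrow> 0\<close>, exact everywhere, where \<open>F\<^sub>i\<close> is the direct sum of the
  \<open>S(-a i j)\<close> for \<open>j < b i\<close>; \<open>\<epsilon>\<close> is the augmentation and \<open>\<phi> i\<close> the map from \<open>F\<^sub>i\<^sub>+\<^sub>1\<close> to \<open>F\<^sub>i\<close>.\<close>

definition graded_free_resolution ::
  "nat \<Rightarrow> ((nat, 'k::field) mpoly, 'b) module \<Rightarrow> (int \<Rightarrow> 'b set) \<Rightarrow>
   (nat \<Rightarrow> nat) \<Rightarrow> (nat \<Rightarrow> nat \<Rightarrow> int) \<Rightarrow> ((nat \<Rightarrow> (nat, 'k) mpoly) \<Rightarrow> 'b) \<Rightarrow>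
   (nat \<Rightarrow> (nat \<Rightarrow> (nat, 'k) mpoly) \<Rightarrow> (nat \<Rightarrow> (nat, 'k) mpoly)) \<Rightarrow> bool" where
  "graded_free_resolution n N G b a \<epsilon> \<phi> \<longleftrightarrow>
     (let F = (\<lambda>i. free_module n (b i)); H = (\<lambda>i. shifted_grading n (b i) (a i)) in
       graded_hom n (F 0) (H 0) N G \<epsilon> \<and>
       (\<forall>i. graded_hom n (F (Suc i)) (H (Suc i)) (F i) (H i) (\<phi> i)) \<and>
       \<epsilon> ` carrier (F 0) = carrier N \<and>
       \<phi> 0 ` carrier (F 1) = a_kernel (F 0) N \<epsilon> \<and>
       (\<forall>i. \<phi> (Suc i) ` carrier (F (Suc (Suc i))) = a_kernel (F (Suc i)) (F i) (\<phi> i)))"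

text \<open>Minimality: the image of \<open>\<phi> i\<close> lies in \<open>(x\<^sub>1, \<dots>, x\<^sub>n) F\<^sub>i\<close>, that is, all
  coordinates of its elements have constant coefficient 0.\<close>

definition minimal_graded_free_resolution ::
  "nat \<Rightarrow> ((nat, 'k::field) mpoly, 'b) module \<Rightarrow> (int \<Rightarrow> 'b set) \<Rightarrow>
   (nat \<Rightarrow> nat) \<Rightarrow> (nat \<Rightarrow> nat \<Rightarrow> int) \<Rightarrow> ((nat \<Rightarrow> (nat, 'k) mpoly) \<Rightarrow> 'b) \<Rightarrow>
   (nat \<Rightarrow> (nat \<Rightarrow> (nat, 'k) mpoly) \<Rightarrow> (nat \<Rightarrow> (nat, 'k) mpoly)) \<Rightarrow> bool" where
  "minimal_graded_free_resolution n N G b a \<epsilon> \<phi> \<longleftrightarrow>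
     graded_free_resolution n N G b a \<epsilon> \<phi> \<and>
     (\<forall>i. \<forall>u \<in> carrier (free_module n (b (Suc i))). \<forall>j < b i.
        Poly_Mapping.lookup (\<phi> i u j) 0 = 0)"

text \<open>For the zero module all ranks \<open>b i\<close> can be taken to be 0, so it has a linear resolution.\<close>

definition has_linear_resolution ::
  "nat \<Rightarrow> ((nat, 'k::field) mpoly, 'b) module \<Rightarrow> (int \<Rightarrow> 'b set) \<Rightarrow> bool" where
  "has_linear_resolution n N G \<longleftrightarrow>
     (\<exists>d b a \<epsilon> \<phi>. minimal_graded_free_resolution n N G b a \<epsilon> \<phi> \<and>
        (\<forall>i. \<forall>j < b i. a i j = d + int i))"

definition componentwise_linear ::
  "nat \<Rightarrow> ((nat, 'k::field) mpoly, 'b) module \<Rightarrow> (int \<Rightarrow> 'b set) \<Rightarrow> bool" where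
  "componentwise_linear n N G \<longleftrightarrow>
     (\<forall>d. let H = generated_submodule n N (G d)
          in has_linear_resolution n (N\<lparr>carrier := H\<rparr>) (\<lambda>e. H \<inter> G e))"


section \<open>The symmetric algebra\<close>

text \<open>\<open>Sym(M)\<close> is the quotient of the polynomial ring \<open>S[Y\<^sub>z | z \<in> M]\<close>
  by the ideal of the linear relations \<open>Y\<^sub>z\<^sub>+\<^sub>w = Y\<^sub>z + Y\<^sub>w\<close> and \<open>Y\<^sub>s\<^sub>z = s Y\<^sub>z\<close>;
  \<open>Sym\<^sub>k(M)\<close> is the image of the forms of degree \<open>k\<close> in the variables \<open>Y\<^sub>z\<close>.\<close>

definition sym_cover ::
  "nat \<Rightarrow> ((nat, 'k::field) mpoly, 'b) module \<Rightarrow> (nat + 'b, 'k) mpoly ring" where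
  "sym_cover n M = poly_ring ({..<n} <+> carrier M)"

definition sym_relations ::
  "nat \<Rightarrow> ((nat, 'k::field) mpoly, 'b) module \<Rightarrow> (nat + 'b, 'k) mpoly set" where
  "sym_relations n M = Idl\<^bsub>sym_cover n M\<^esub>
     ({var (Inr (z \<oplus>\<^bsub>M\<^esub> w)) - var (Inr z) - var (Inr w) | z w. z \<in> carrier M \<and> w \<in> carrier M} \<union>
      {var (Inr (s \<odot>\<^bsub>M\<^esub> z)) - rename_vars Inl s * var (Inr z) | s z.
         s \<in> carrier (S_ring n) \<and> z \<in> carrier M})"

definition sym_class ::
  "nat \<Rightarrow> ((nat, 'k::field) mpoly, 'b) module \<Rightarrow> (nat + 'b, 'k) mpoly \<Rightarrow> (nat + 'b, 'k) mpoly set"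
where
  "sym_class n M p = sym_relations n M +>\<^bsub>sym_cover n M\<^esub> p"

definition sym_algebra ::
  "nat \<Rightarrow> ((nat, 'k::field) mpoly, 'b) module \<Rightarrow>
   ((nat, 'k) mpoly, (nat + 'b, 'k) mpoly set) module" where
  "sym_algebra n M =
     (let Q = sym_cover n M Quot sym_relations n M in
        ring.extend Q (module.fields (\<lambda>s c. sym_class n M (rename_vars Inl s) \<otimes>\<^bsub>Q\<^esub> c)))"

definition sym_power ::
  "nat \<Rightarrow> ((nat, 'k::field) mpoly, 'b) module \<Rightarrow> nat \<Rightarrow>
   ((nat, 'k) mpoly, (nat + 'b, 'k) mpoly set) module" where
  "sym_power n M k =
     (sym_algebra n M)\<lparr>carrier :=
        {sym_class n M p | p. p \<in> carrier (sym_cover n M) \<and>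
           (\<forall>t \<in> Poly_Mapping.keys p. mdeg (y_part t) = k)}\<rparr>"

text \<open>The component of degree \<open>e\<close> is spanned over \<open>K\<close> by the products
  \<open>u z\<^sub>1 \<dots> z\<^sub>k\<close> with \<open>u\<close> a monomial of \<open>S\<close>, all \<open>z\<^sub>i\<close> homogeneous elements of \<open>M\<close>
  and \<open>deg u + deg z\<^sub>1 + \<dots> + deg z\<^sub>k = e\<close>. The function \<open>\<delta>\<close> picks the degrees of the \<open>z\<^sub>i\<close>;
  it matters only for \<open>z\<^sub>i = 0\<close>, which is homogeneous of every degree.\<close>

definition sym_power_grading ::
  "nat \<Rightarrow> ((nat, 'k::field) mpoly, 'b) module \<Rightarrow> (int \<Rightarrow> 'b set) \<Rightarrow> nat \<Rightarrow> int \<Rightarrow>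
   (nat + 'b, 'k) mpoly set set" where
  "sym_power_grading n M G k e =
     {sym_class n M p | p. p \<in> carrier (sym_cover n M) \<and>
        (\<forall>t \<in> Poly_Mapping.keys p. mdeg (y_part t) = k \<and>
           (\<exists>\<delta>. (\<forall>z \<in> Poly_Mapping.keys (y_part t). z \<in> G (\<delta> z)) \<and>
              int (mdeg (x_part t)) +
              (\<Sum>z \<in> Poly_Mapping.keys (y_part t).
                 int (Poly_Mapping.lookup (y_part t) z) * \<delta> z) = e))}"

text \<open>The homomorphism \<open>T \<rightarrow> Sym(M)\<close> with \<open>x\<^sub>i \<mapsto> x\<^sub>i\<close> and \<open>y\<^sub>j \<mapsto> f\<^sub>j\<close>, and its kernel \<open>J\<close>.\<close>

definition sym_presentation ::
  "nat \<Rightarrow> ((nat, 'k::field) mpoly, 'b) module \<Rightarrow> (nat \<Rightarrow> 'b) \<Rightarrow>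
   (nat + nat, 'k) mpoly \<Rightarrow> (nat + 'b, 'k) mpoly set" where
  "sym_presentation n M f p = sym_class n M (rename_vars (map_sum id f) p)"

definition presentation_ideal ::
  "nat \<Rightarrow> ((nat, 'k::field) mpoly, 'b) module \<Rightarrow> nat \<Rightarrow> (nat \<Rightarrow> 'b) \<Rightarrow> (nat + nat, 'k) mpoly set"
where
  "presentation_ideal n M m f =
     a_kernel (T_ring n m) (sym_algebra n M) (sym_presentation n M f)"


section \<open>Monomial orders and the x-condition\<close>

text \<open>Monomials are written additively, so \<open>0\<close> is the monomial 1.\<close>

definition monomial_order :: "'v set \<Rightarrow> ('v monomial \<Rightarrow> 'v monomial \<Rightarrow> bool) \<Rightarrow> bool" where
  "monomial_order V lt \<longleftrightarrow>
     (let Mon = {t. Poly_Mapping.keys t \<subseteq> V} in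
       (\<forall>s \<in> Mon. \<not> lt s s) \<and>
       (\<forall>s \<in> Mon. \<forall>t \<in> Mon. \<forall>u \<in> Mon. lt s t \<longrightarrow> lt t u \<longrightarrow> lt s u) \<and>
       (\<forall>s \<in> Mon. \<forall>t \<in> Mon. s \<noteq> t \<longrightarrow> lt s t \<or> lt t s) \<and>
       (\<forall>t \<in> Mon. t \<noteq> 0 \<longrightarrow> lt 0 t) \<and>
       (\<forall>s \<in> Mon. \<forall>t \<in> Mon. \<forall>u \<in> Mon. lt s t \<longrightarrow> lt (s + u) (t + u)))"

definition block_order ::
  "('y monomial \<Rightarrow> 'y monomial \<Rightarrow> bool) \<Rightarrow> ('x monomial \<Rightarrow> 'x monomial \<Rightarrow> bool) \<Rightarrow>
   ('x + 'y) monomial \<Rightarrow> ('x + 'y) monomial \<Rightarrow> bool" where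
  "block_order less_y less_x s t \<longleftrightarrow>
     less_y (y_part s) (y_part t) \<or> (y_part s = y_part t \<and> less_x (x_part s) (x_part t))"

definition is_leading_monomial ::
  "('v monomial \<Rightarrow> 'v monomial \<Rightarrow> bool) \<Rightarrow> ('v, 'k::field) mpoly \<Rightarrow> 'v monomial \<Rightarrow> bool" where
  "is_leading_monomial lt p t \<longleftrightarrow>
     t \<in> Poly_Mapping.keys p \<and> (\<forall>s \<in> Poly_Mapping.keys p. s \<noteq> t \<longrightarrow> lt s t)"

definition initial_ideal ::
  "'v set \<Rightarrow> ('v monomial \<Rightarrow> 'v monomial \<Rightarrow> bool) \<Rightarrow> ('v, 'k::field) mpoly set \<Rightarrow>
   ('v, 'k) mpoly set" where
  "initial_ideal V lt J =
     Idl\<^bsub>poly_ring V\<^esub> {mon t | t p. p \<in> J \<and> p \<noteq> 0 \<and> is_leading_monomial lt p t}"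

definition minimal_monomial_generators ::
  "'v set \<Rightarrow> ('v, 'k::field) mpoly set \<Rightarrow> 'v monomial set \<Rightarrow> bool" where
  "minimal_monomial_generators V I B \<longleftrightarrow>
     (\<forall>t \<in> B. Poly_Mapping.keys t \<subseteq> V) \<and>
     Idl\<^bsub>poly_ring V\<^esub> (mon ` B) = I \<and>
     (\<forall>C. C \<subset> B \<longrightarrow> Idl\<^bsub>poly_ring V\<^esub> (mon ` C) \<noteq> I)"

text \<open>A monomial ideal has exactly one minimal set of monomial generators, so it is immaterial
  whether the quantifier over all such sets is universal or existential.\<close>

definition x_condition ::
  "nat \<Rightarrow> nat \<Rightarrow> ((nat + nat) monomial \<Rightarrow> (nat + nat) monomial \<Rightarrow> bool) \<Rightarrow>
   (nat + nat, 'k::field) mpoly set \<Rightarrow> bool" where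
  "x_condition n m lt J \<longleftrightarrow>
     (\<forall>B. minimal_monomial_generators ({..<n} <+> {..<m})
            (initial_ideal ({..<n} <+> {..<m}) lt J) B
        \<longrightarrow> (\<forall>t \<in> B. mdeg (x_part t) \<le> 1))"

end

theory Submission
  imports Defs "HOL-Library.Function_Algebras"
begin

text \<open>
  Order the monomials \<open>w\<close> of degree \<open>k\<close> in the \<open>y\<^sub>j\<close> by \<open><'\<close>. Their classes generate \<open>Sym\<^sub>k(M)\<close>, and the
  relations among them are governed by the colon ideals \<open>colon w\<close>, consisting of the \<open>q \<in> S\<close> for which \<open>q w\<close>
  plus a combination of smaller \<open>y\<close>-monomials lies in \<open>J\<close>. As \<open><\<close> looks at the \<open>y\<close>-part first, the initial ideal of
  \<open>colon w\<close> consists of the \<open>u\<close> with \<open>u w \<in> in(J)\<close>, so by the \<open>x\<close>-condition it is generated by variables (it does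
  not contain 1, see below), and \<open>colon w\<close> is generated by linear forms (\<open>colon_linear\<close>): \<open>Sym\<^sub>k(M)\<close> has linear quotients.

  The generators \<open>w\<close> have different degrees, and they need not increase along \<open><'\<close>. To pass to the elements of
  degree \<open>d\<close>, two properties of \<open>J\<close> are needed. It is generated by the linear relations \<open>\<Sum> s\<^sub>j y\<^sub>j\<close> with
  \<open>\<Sum> s\<^sub>j f\<^sub>j = 0\<close> (\<open>J_eq_relation_span\<close>), hence homogeneous for the grading induced from \<open>M\<close> and for the degree in
  the \<open>y\<^sub>j\<close>; and since the \<open>f\<^sub>j\<close> are a minimal system of generators, every term of an element of \<open>J\<close> involves
  some \<open>x\<^sub>i\<close> (\<open>J_x_part\<close>). So if \<open>l \<in> colon w\<close> is a linear form, homogeneity and the factor \<open>x\<^sub>i\<close> force the smaller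
  \<open>y\<close>-monomials in the relation for \<open>l w\<close> to have degree at most \<open>deg w\<close>; only the \<open>w\<close> of degree at most \<open>d\<close>
  matter. Replacing each of these by its multiples \<open>u w\<close>, where \<open>u\<close> runs through suitable generators of the
  part of \<open>S/colon w\<close> in degrees \<open>\<ge> d - deg w\<close> (\<open>truncation_generators\<close>), gives a list of elements of degree \<open>d\<close> that
  generates the submodule in question and still has linear quotients (\<open>linear_quotients_initial_segment\<close>).

  A module with linear quotients whose generators all have degree \<open>d\<close> has a \<open>d\<close>-linear resolution, because linear
  quotients pass to the module of relations (\<open>linear_relation_module_generators\<close>). Filter the relations by
  their last nonzero coordinate: the \<open>i\<close>-th step of the filtration is the \<open>i\<close>-th colon ideal, generated
  by linear forms. As ideals generated by linear forms are prime (\<open>linear_ideal_prime\<close>), independent linear forms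
  \<open>l\<^sub>1, \<dots>, l\<^sub>p\<close> satisfy \<open>(l\<^sub>1, \<dots>, l\<^sub>q\<^sub>-\<^sub>1) : l\<^sub>q = (l\<^sub>1, \<dots>, l\<^sub>q\<^sub>-\<^sub>1)\<close>, and lifting them to relations with linear
  entries gives generators with linear quotients again. Iterating produces the resolution; minimality is automatic
  since all matrix entries are linear forms.
\<close>

section \<open>Polynomials\<close>

abbreviation keys where "keys \<equiv> Poly_Mapping.keys"
abbreviation lookup where "lookup \<equiv> Poly_Mapping.lookup"
abbreviation single where "single \<equiv> Poly_Mapping.single"

abbreviation polys :: "'v set \<Rightarrow> ('v, 'k::field) mpoly set" where
  "polys V \<equiv> carrier (poly_ring V)"

lemma polys_iff: "p \<in> polys V \<longleftrightarrow> (\<forall>t \<in> keys p. keys t \<subseteq> V)"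
  by (simp add: poly_ring_def)

lemma poly_ring_ops [simp]:
  "x \<otimes>\<^bsub>poly_ring V\<^esub> y = x * y" "\<one>\<^bsub>poly_ring V\<^esub> = 1" "\<zero>\<^bsub>poly_ring V\<^esub> = 0" "x \<oplus>\<^bsub>poly_ring V\<^esub> y = x + y"
  by (simp_all add: poly_ring_def)

lemma keys_plus_monomial: "keys (s + t) = keys s \<union> keys (t :: 'v monomial)"
  by (auto simp: in_keys_iff lookup_add)

lemma polys_0 [simp]: "0 \<in> polys V"
  by (simp add: polys_iff)

lemma polys_1 [simp]: "1 \<in> polys V"
  by (simp add: polys_iff)

lemma polys_add: "p \<in> polys V \<Longrightarrow> q \<in> polys V \<Longrightarrow> p + q \<in> polys V"
  using keys_add[of p q] by (fastforce simp: polys_iff)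

lemma polys_uminus: "p \<in> polys V \<Longrightarrow> - p \<in> polys V"
  by (simp add: polys_iff)

lemma polys_diff: "p \<in> polys V \<Longrightarrow> q \<in> polys V \<Longrightarrow> p - q \<in> polys V"
  using polys_add[of p V "- q"] polys_uminus[of q V] by simp

lemma polys_mult: "p \<in> polys V \<Longrightarrow> q \<in> polys V \<Longrightarrow> p * q \<in> polys V"
  using keys_mult[of p q] by (fastforce simp: polys_iff keys_plus_monomial)

lemma polys_single: "keys t \<subseteq> V \<Longrightarrow> single t a \<in> polys V"
  by (simp add: polys_iff)

lemma polys_mon: "keys t \<subseteq> V \<Longrightarrow> mon t \<in> polys V"
  by (simp add: mon_def polys_single)

lemma polys_var: "v \<in> V \<Longrightarrow> var v \<in> polys V"
  by (simp add: var_def polys_mon)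

lemma polys_sum: "(\<And>i. i \<in> I \<Longrightarrow> p i \<in> polys V) \<Longrightarrow> sum p I \<in> polys V"
  by (induction I rule: infinite_finite_induct) (auto intro: polys_add)

lemma polys_power: "p \<in> polys V \<Longrightarrow> p ^ i \<in> polys V"
  by (induction i) (auto intro: polys_mult)

lemma polys_prod: "(\<And>i. i \<in> I \<Longrightarrow> p i \<in> polys V) \<Longrightarrow> prod p I \<in> polys V"
  by (induction I rule: infinite_finite_induct) (auto intro: polys_mult)

lemma cring_poly_ring: "cring (poly_ring V)"
proof (rule cringI)
  show "abelian_group (poly_ring V)"
    by (rule abelian_groupI) (auto simp: algebra_simps intro: polys_add dest: polys_uminus intro!: bexI[of _ "- x" for x])
  show "comm_monoid (poly_ring V)"
    by unfold_locales (auto simp: algebra_simps intro: polys_mult)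
qed (auto simp: algebra_simps)

lemma a_inv_poly_ring: "p \<in> polys V \<Longrightarrow> \<ominus>\<^bsub>poly_ring V\<^esub> p = - p"
proof -
  interpret cring "poly_ring V" by (rule cring_poly_ring)
  show "p \<in> polys V \<Longrightarrow> \<ominus>\<^bsub>poly_ring V\<^esub> p = - p"
    using minus_equality[of "- p" p] by (simp add: polys_uminus)
qed

lemma a_minus_poly_ring: "p \<in> polys V \<Longrightarrow> q \<in> polys V \<Longrightarrow> p \<ominus>\<^bsub>poly_ring V\<^esub> q = p - q"
  by (simp add: a_minus_def a_inv_poly_ring)

text \<open>Additive statements about a polynomial need only be checked on its terms.\<close>

lemma mpoly_keys_induct [case_names zero single add]:
  assumes "P 0" "\<And>t a. t \<in> keys p \<Longrightarrow> P (single t a)"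
    and "\<And>q r. P q \<Longrightarrow> P r \<Longrightarrow> P (q + r)"
  shows "P (p :: ('v, 'k::field) mpoly)"
proof -
  have "p = (\<Sum>t\<in>keys p. single t (lookup p t))"
    by (rule poly_mapping_eqI)
       (auto simp: lookup_sum lookup_single when_def in_keys_iff)
  moreover have "P (\<Sum>t\<in>T. single t (lookup p t))" 
    if "finite T" "T \<subseteq> keys p" for T
    using that by (induction T) (auto simp: assms)
  ultimately show ?thesis by (metis finite_keys order_refl)
qed

section \<open>Substitution\<close>

definition monomial_eval :: "('v \<Rightarrow> ('w, 'k::field) mpoly) \<Rightarrow> 'v monomial \<Rightarrow> ('w, 'k) mpoly" where
  "monomial_eval g t = (\<Prod>v \<in> keys t. g v ^ lookup t v)"

definition subst :: "('v \<Rightarrow> ('w, 'k::field) mpoly) \<Rightarrow> ('v, 'k) mpoly \<Rightarrow> ('w, 'k) mpoly" where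
  "subst g p =
     (\<Sum>t \<in> keys p. single 0 (lookup p t) * monomial_eval g t)"

lemma monomial_eval_superset:
  "finite X \<Longrightarrow> keys t \<subseteq> X \<Longrightarrow> monomial_eval g t = (\<Prod>v \<in> X. g v ^ lookup t v)"
  unfolding monomial_eval_def by (rule prod.mono_neutral_left) (auto simp: in_keys_iff)

lemma monomial_eval_0 [simp]: "monomial_eval g 0 = 1"
  by (simp add: monomial_eval_def)

lemma monomial_eval_add: "monomial_eval g (s + t) = monomial_eval g s * monomial_eval g t"
  using monomial_eval_superset[of "keys s \<union> keys t" _ g]
  by (simp add: keys_plus_monomial lookup_add power_add prod.distrib)

lemma subst_0 [simp]: "subst g 0 = 0"
  by (simp add: subst_def)

lemma subst_single: "subst g (single t a) = single 0 a * monomial_eval g t"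
  by (simp add: subst_def)

lemma subst_add: "subst g (p + q) = subst g p + subst g q"
  unfolding subst_def
  by (rule setsum_keys_plus_distrib) (auto simp: single_add algebra_simps)

lemma subst_uminus: "subst g (- p) = - subst g p"
  using subst_add[of g p "- p"] by (simp add: eq_neg_iff_add_eq_0 add.commute)

lemma subst_diff: "subst g (p - q) = subst g p - subst g q"
  using subst_add[of g p "- q"] by (simp add: subst_uminus)

lemma subst_mult:
  fixes g :: "'v \<Rightarrow> ('b, 'c::field) mpoly"
  shows "subst g (p * q) = subst g p * subst g q"
proof (induction p rule: mpoly_keys_induct)
  case (single s a)
  show ?case
  proof (induction q rule: mpoly_keys_induct)
    case (single t b)
    have "subst g (single s a * single t b) =
        single 0 (a * b) * (monomial_eval g s * monomial_eval g t)"
      by (simp add: mult_single subst_single monomial_eval_add)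
    also have "single 0 (a * b) = (single 0 a * single 0 b :: ('b, 'c) mpoly)"
      by (simp add: mult_single)
    also have "\<dots> * (monomial_eval g s * monomial_eval g t) =
        subst g (single s a) * subst g (single t b)"
      unfolding subst_single by (simp only: ac_simps)
    finally show ?case .
  qed (auto simp: subst_add algebra_simps)
qed (auto simp: subst_add algebra_simps)

lemma subst_sum: "subst g (sum p I) = (\<Sum>i\<in>I. subst g (p i))"
  by (induction I rule: infinite_finite_induct) (auto simp: subst_add)

lemma subst_const [simp]: "subst g (single 0 a) = single 0 a"
  by (simp add: subst_single)

lemma subst_1 [simp]: "subst g 1 = 1"
  using subst_const[of g 1] by (simp del: subst_const)

lemma subst_mon: "subst g (mon t) = monomial_eval g t"
  by (simp add: mon_def subst_single)

lemma subst_var [simp]: "subst g (var v) = g v"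
  by (simp add: var_def subst_mon monomial_eval_def)

lemma polys_subst:
  assumes "p \<in> polys V" "\<And>v. v \<in> V \<Longrightarrow> g v \<in> polys W"
  shows "subst g p \<in> polys W"
  unfolding subst_def monomial_eval_def
  using assms by (auto intro!: polys_sum polys_mult polys_prod polys_power polys_single simp: polys_iff[of p])

lemma var_power: "var v ^ i = mon (single v i)"
  by (induction i) (auto simp: var_def mon_def mult_single single_add[symmetric])

lemma prod_mon: "(\<Prod>i\<in>I. mon (h i)) = mon (\<Sum>i\<in>I. h i)"
  by (induction I rule: infinite_finite_induct) (auto simp: mon_def mult_single)

lemma monomial_eval_var: "monomial_eval var t = (mon t :: ('a, 'b::field) mpoly)"
proof -
  have "monomial_eval var t = (mon (\<Sum>v\<in>keys t. single v (lookup t v)) :: ('a, 'b::field) mpoly)"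
    by (simp add: monomial_eval_def var_power prod_mon)
  also have "(\<Sum>v\<in>keys t. single v (lookup t v)) = t"
    by (rule poly_mapping_eqI)
       (auto simp: lookup_sum lookup_single when_def in_keys_iff)
  finally show ?thesis .
qed

lemma subst_var_id: "subst var p = p"
proof (induction p rule: mpoly_keys_induct)
  case (single t a)
  then show ?case by (simp add: subst_single monomial_eval_var mon_def mult_single)
qed (auto simp: subst_add)

lemma subst_power: "subst g (p ^ i) = subst g p ^ i"
  by (induction i) (auto simp: subst_mult)

lemma subst_prod: "subst g (prod p I) = (\<Prod>i\<in>I. subst g (p i))"
  by (induction I rule: infinite_finite_induct) (auto simp: subst_mult)

lemma subst_subst: "subst g (subst h p) = subst (\<lambda>v. subst g (h v)) p"
proof (induction p rule: mpoly_keys_induct)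
  case (single t a)
  then show ?case by (simp add: subst_single subst_mult monomial_eval_def subst_prod subst_power)
qed (auto simp: subst_add)

lemma mon_add: "mon (s + t) = mon s * mon t"
  by (simp add: mon_def mult_single)

lemma rename_vars_eq_subst:
  fixes p :: "('a, 'c::field) mpoly" and g :: "'a \<Rightarrow> 'b"
  shows "rename_vars g p = subst (\<lambda>v. var (g v)) p"
proof -
  have "monomial_eval (\<lambda>v. var (g v)) t = (mon (rename_monomial g t) :: ('b, 'c) mpoly)" for t
    by (simp add: monomial_eval_def var_power prod_mon rename_monomial_def)
  then show ?thesis
    by (simp add: rename_vars_def subst_def mon_def mult_single)
qed

section \<open>Weighted degrees\<close>

definition wdeg :: "('v \<Rightarrow> int) \<Rightarrow> 'v monomial \<Rightarrow> int" where
  "wdeg \<omega> t = (\<Sum>v \<in> keys t. int (lookup t v) * \<omega> v)"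

lemma wdeg_add: "wdeg \<omega> (s + t) = wdeg \<omega> s + wdeg \<omega> t"
  unfolding wdeg_def
  by (rule setsum_keys_plus_distrib) (auto simp: algebra_simps)

lemma wdeg_0 [simp]: "wdeg \<omega> 0 = 0"
  by (simp add: wdeg_def)

lemma wdeg_single [simp]: "wdeg \<omega> (single v i) = int i * \<omega> v"
  by (simp add: wdeg_def)

lemma int_mdeg: "int (mdeg t) = wdeg (\<lambda>_. 1) t"
  by (simp add: mdeg_def wdeg_def)

lemma mdeg_add: "mdeg (s + t) = mdeg s + mdeg t"
  using wdeg_add[of "\<lambda>_. 1" s t] unfolding int_mdeg[symmetric] by linarith

lemma mdeg_0 [simp]: "mdeg 0 = 0"
  by (simp add: mdeg_def)

lemma mdeg_single [simp]: "mdeg (single v i) = i"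
  by (simp add: mdeg_def)

lemma mdeg_eq_0_iff: "mdeg t = 0 \<longleftrightarrow> t = 0"
  by (auto simp: mdeg_def in_keys_iff intro!: poly_mapping_eqI)

definition homog :: "('v \<Rightarrow> int) \<Rightarrow> int \<Rightarrow> ('v, 'k::field) mpoly set" where
  "homog \<omega> e = {p. \<forall>t \<in> keys p. wdeg \<omega> t = e}"

text \<open>Taken with \<open>E = {d}\<close> for homogeneous components and with \<open>E = {d..}\<close> for truncations.\<close>
definition restr :: "('v \<Rightarrow> int) \<Rightarrow> int set \<Rightarrow> ('v, 'k::field) mpoly \<Rightarrow> ('v, 'k) mpoly" where
  "restr \<omega> E p = Poly_Mapping.mapp (\<lambda>t a. if wdeg \<omega> t \<in> E then a else 0) p"

lemma lookup_restr: "lookup (restr \<omega> E p) t = (if wdeg \<omega> t \<in> E then lookup p t else 0)"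
  by (auto simp: restr_def lookup_mapp when_def in_keys_iff)

lemma keys_restr: "keys (restr \<omega> E p) = {t \<in> keys p. wdeg \<omega> t \<in> E}"
  by (auto simp: in_keys_iff lookup_restr split: if_splits)

lemma restr_0 [simp]: "restr \<omega> E 0 = 0"
  by (rule poly_mapping_eqI) (simp add: lookup_restr)

lemma restr_add: "restr \<omega> E (p + q) = restr \<omega> E p + restr \<omega> E q"
  by (rule poly_mapping_eqI) (simp add: lookup_restr lookup_add)

lemma restr_sum: "restr \<omega> E (sum p I) = (\<Sum>i\<in>I. restr \<omega> E (p i))"
  by (induction I rule: infinite_finite_induct) (auto simp: restr_add)

lemma restr_ident: "(\<And>t. t \<in> keys p \<Longrightarrow> wdeg \<omega> t \<in> E) \<Longrightarrow> restr \<omega> E p = p"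
  by (rule poly_mapping_eqI) (auto simp: lookup_restr in_keys_iff)

lemma restr_eq_0: "(\<And>t. t \<in> keys p \<Longrightarrow> wdeg \<omega> t \<notin> E) \<Longrightarrow> restr \<omega> E p = 0"
  by (rule poly_mapping_eqI) (auto simp: lookup_restr in_keys_iff)

lemma restr_single: "restr \<omega> E (single t a) = (if wdeg \<omega> t \<in> E then single t a else 0)"
  by (rule poly_mapping_eqI) (simp add: lookup_restr lookup_single when_def)

lemma polys_restr: "p \<in> polys V \<Longrightarrow> restr \<omega> E p \<in> polys V"
  by (auto simp: polys_iff keys_restr)

lemma restr_homog: "restr \<omega> {e} p \<in> homog \<omega> e"
  by (auto simp: homog_def keys_restr)

lemma restr_of_homog: "p \<in> homog \<omega> e \<Longrightarrow> restr \<omega> E p = (if e \<in> E then p else 0)"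
  by (auto simp: homog_def intro!: restr_ident restr_eq_0)

lemma restr_mult_homog:
  assumes "q \<in> homog \<omega> d" "\<And>e. e + d \<in> E \<longleftrightarrow> e \<in> E'"
  shows "restr \<omega> E (p * q) = restr \<omega> E' p * q"
proof (induction p rule: mpoly_keys_induct)
  case (single s a)
  have *: "\<forall>t\<in>keys q. wdeg \<omega> t = d" using assms by (simp add: homog_def)
  have "wdeg \<omega> t = wdeg \<omega> s + d" if "t \<in> keys (single s a * q)" for t
    using that * keys_mult[of "single s a" q] by (auto simp: wdeg_add split: if_splits)
  then have "single s a * q \<in> homog \<omega> (wdeg \<omega> s + d)" by (simp add: homog_def)
  then show ?case using assms(2) by (simp add: restr_of_homog restr_single)
qed (auto simp: restr_add algebra_simps)

lemma homog_0 [simp]: "0 \<in> homog \<omega> e"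
  by (simp add: homog_def)

lemma homog_add: "p \<in> homog \<omega> e \<Longrightarrow> q \<in> homog \<omega> e \<Longrightarrow> p + q \<in> homog \<omega> e"
  using keys_add[of p q] by (fastforce simp: homog_def)

lemma homog_uminus: "p \<in> homog \<omega> e \<Longrightarrow> - p \<in> homog \<omega> e"
  by (simp add: homog_def)

lemma homog_diff: "p \<in> homog \<omega> e \<Longrightarrow> q \<in> homog \<omega> e \<Longrightarrow> p - q \<in> homog \<omega> e"
  using homog_add[of p \<omega> e "- q"] homog_uminus[of q] by simp

lemma homog_mult: "p \<in> homog \<omega> d \<Longrightarrow> q \<in> homog \<omega> e \<Longrightarrow> p * q \<in> homog \<omega> (d + e)"
  using keys_mult[of p q] by (fastforce simp: homog_def wdeg_add)

lemma homog_sum: "(\<And>i. i \<in> I \<Longrightarrow> p i \<in> homog \<omega> e) \<Longrightarrow> sum p I \<in> homog \<omega> e"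
  by (induction I rule: infinite_finite_induct) (auto intro: homog_add)

lemma homog_single: "wdeg \<omega> t = e \<Longrightarrow> single t a \<in> homog \<omega> e"
  by (simp add: homog_def)

lemma homog_1: "1 \<in> homog \<omega> 0"
  by (simp add: homog_def)

lemma homog_const: "single 0 a \<in> homog \<omega> 0"
  by (simp add: homog_single)

lemma homog_mult': "p \<in> homog \<omega> d \<Longrightarrow> q \<in> homog \<omega> e \<Longrightarrow> f = d + e \<Longrightarrow> p * q \<in> homog \<omega> f"
  using homog_mult by blast

lemma homog_power: "p \<in> homog \<omega> d \<Longrightarrow> p ^ i \<in> homog \<omega> (int i * d)"
  by (induction i) (auto simp: homog_1 algebra_simps intro: homog_mult')

lemma homog_prod: "(\<And>i. i \<in> I \<Longrightarrow> p i \<in> homog \<omega> (e i)) \<Longrightarrow> prod p I \<in> homog \<omega> (sum e I)"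
  by (induction I rule: infinite_finite_induct) (auto simp: homog_1 intro: homog_mult)

lemma homog_monomial_eval:
  "(\<And>v. v \<in> keys t \<Longrightarrow> g v \<in> homog \<omega> (\<omega>' v)) \<Longrightarrow> monomial_eval g t \<in> homog \<omega> (wdeg \<omega>' t)"
  unfolding monomial_eval_def wdeg_def by (rule homog_prod) (rule homog_power, simp)

lemma homog_subst:
  assumes "p \<in> homog \<omega>' e" "p \<in> polys V" "\<And>v. v \<in> V \<Longrightarrow> g v \<in> homog \<omega> (\<omega>' v)"
  shows "subst g p \<in> homog \<omega> e"
  unfolding subst_def
proof (rule homog_sum)
  fix t assume t: "t \<in> keys p"
  then have "monomial_eval g t \<in> homog \<omega> (wdeg \<omega>' t)"
    using assms by (intro homog_monomial_eval) (auto simp: polys_iff)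
  moreover have "wdeg \<omega>' t = e" using assms t by (simp add: homog_def)
  ultimately show "single 0 (lookup p t) * monomial_eval g t \<in> homog \<omega> e"
    by (auto intro: homog_mult' homog_const)
qed

lemma S_homogeneous_iff: "p \<in> S_homogeneous n d \<longleftrightarrow> p \<in> polys {..<n} \<and> p \<in> homog (\<lambda>_. 1) d"
  by (simp add: S_homogeneous_def homog_def int_mdeg)

lemma sum_restr: "finite D \<Longrightarrow> (\<And>t. t \<in> keys p \<Longrightarrow> wdeg \<omega> t \<in> D) \<Longrightarrow> (\<Sum>d\<in>D. restr \<omega> {d} p) = p"
  by (rule poly_mapping_eqI) (auto simp: lookup_sum lookup_restr in_keys_iff)

section \<open>Spans\<close>

text \<open>The polynomials live in the ring of all polynomials in variables numbered by \<open>nat\<close>, so coefficients have to be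
  restricted to \<open>S\<close>. The action is a parameter: it is multiplication for ideals of \<open>S\<close>, the coordinatewise
  one for free modules, and multiplication by polynomials in the \<open>x\<^sub>i\<close> for \<open>T\<close>.\<close>
inductive_set S_span :: "nat \<Rightarrow> ((nat, 'k::field) mpoly \<Rightarrow> 'a::ab_group_add \<Rightarrow> 'a) \<Rightarrow> 'a set \<Rightarrow> 'a set"
  for n act X where
  S_span_0: "0 \<in> S_span n act X"
| S_span_step: "v \<in> S_span n act X \<Longrightarrow> c \<in> polys {..<n} \<Longrightarrow> x \<in> X \<Longrightarrow> v + act c x \<in> S_span n act X"

lemma S_span_mono: "X \<subseteq> Y \<Longrightarrow> S_span n act X \<subseteq> S_span n act Y"
proof
  fix v assume "X \<subseteq> Y" "v \<in> S_span n act X"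
  from this(2,1) show "v \<in> S_span n act Y"
    by induction (auto intro: S_span.intros)
qed

locale S_action =
  fixes act :: "(nat, 'k::field) mpoly \<Rightarrow> 'a \<Rightarrow> 'a::ab_group_add" and n :: nat
  assumes act_add_left: "act (c + d) x = act c x + act d x"
    and act_add_right: "act c (x + y) = act c x + act c y"
    and act_mult: "act (c * d) x = act c (act d x)"
    and act_1: "act 1 x = x"
begin

lemma act_0_left: "act 0 x = 0"
  using act_add_left[of 0 0 x] by simp

lemma act_0_right: "act c 0 = 0"
  using act_add_right[of c 0 0] by simp

lemma act_uminus_left: "act (- c) x = - act c x"
  using act_add_left[of c "- c" x] by (simp add: act_0_left eq_neg_iff_add_eq_0 add.commute)

lemma act_sum_right: "act c (sum f I) = (\<Sum>i\<in>I. act c (f i))"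
  by (induction I rule: infinite_finite_induct) (auto simp: act_0_right act_add_right)

abbreviation A where "A \<equiv> polys {..<n} :: (nat, 'k) mpoly set"
abbreviation Sp where "Sp \<equiv> S_span n act"

lemma Sp_base: "x \<in> X \<Longrightarrow> x \<in> Sp X"
  using S_span_step[OF S_span_0, of 1 n x X act] by (simp add: act_1)

lemma Sp_add: "v \<in> Sp X \<Longrightarrow> w \<in> Sp X \<Longrightarrow> v + w \<in> Sp X"
proof -
  assume "w \<in> Sp X" "v \<in> Sp X"
  then show "v + w \<in> Sp X"
    by induction (auto simp: add.assoc[symmetric] intro: S_span.intros)
qed

lemma Sp_act: "c \<in> A \<Longrightarrow> v \<in> Sp X \<Longrightarrow> act c v \<in> Sp X"
proof -
  assume "v \<in> Sp X" and c: "c \<in> A"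
  then show "act c v \<in> Sp X"
  proof induction
    case (S_span_step v d x)
    then show ?case
      using S_span.S_span_step[of "act c v" n act X "c * d" x]
      by (simp add: act_add_right act_mult polys_mult)
  qed (simp add: act_0_right S_span.S_span_0)
qed

lemma Sp_uminus: "v \<in> Sp X \<Longrightarrow> - v \<in> Sp X"
  using Sp_act[of "- 1" v X] by (simp add: polys_uminus act_uminus_left act_1)

lemma Sp_diff: "v \<in> Sp X \<Longrightarrow> w \<in> Sp X \<Longrightarrow> v - w \<in> Sp X"
  using Sp_add[of v X "- w"] Sp_uminus[of w X] by simp

lemma Sp_sum: "(\<And>i. i \<in> I \<Longrightarrow> f i \<in> Sp X) \<Longrightarrow> sum f I \<in> Sp X"
  by (induction I rule: infinite_finite_induct) (auto intro: Sp_add S_span_0)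

lemma Sp_least:
  assumes "X \<subseteq> Y" "0 \<in> Y" "\<And>v w. v \<in> Y \<Longrightarrow> w \<in> Y \<Longrightarrow> v + w \<in> Y" "\<And>c v. c \<in> A \<Longrightarrow> v \<in> Y \<Longrightarrow> act c v \<in> Y"
  shows "Sp X \<subseteq> Y"
proof
  fix v assume "v \<in> Sp X"
  then show "v \<in> Y" using assms by induction auto
qed

lemma Sp_subset: "X \<subseteq> Sp Y \<Longrightarrow> Sp X \<subseteq> Sp Y"
  by (rule Sp_least) (auto intro: S_span_0 Sp_add Sp_act)

lemma Sp_empty [simp]: "Sp {} = {0}"
  using Sp_least[of "{}" "{0}"] by (auto simp: act_0_right intro: S_span_0)

lemma Sp_Un: "v \<in> Sp (X \<union> Y) \<longleftrightarrow> (\<exists>x \<in> Sp X. \<exists>y \<in> Sp Y. v = x + y)"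
proof
  assume "v \<in> Sp (X \<union> Y)"
  then show "\<exists>x \<in> Sp X. \<exists>y \<in> Sp Y. v = x + y"
  proof induction
    case S_span_0
    then show ?case by (auto intro!: bexI[of _ 0] S_span.S_span_0)
  next
    case (S_span_step v c z)
    then obtain x y where xy: "x \<in> Sp X" "y \<in> Sp Y" "v = x + y" by auto
    show ?case
    proof (cases "z \<in> X")
      case True
      then have "x + act c z \<in> Sp X" using xy S_span_step by (auto intro: S_span.intros)
      then show ?thesis using xy by (metis add.assoc add.commute)
    next
      case False
      then have "y + act c z \<in> Sp Y" using xy S_span_step by (auto intro: S_span.intros)
      then show ?thesis using xy by (metis add.assoc)
    qed
  qed
next
  assume "\<exists>x \<in> Sp X. \<exists>y \<in> Sp Y. v = x + y"
  then show "v \<in> Sp (X \<union> Y)"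
    using S_span_mono[of X "X \<union> Y" n act] S_span_mono[of Y "X \<union> Y" n act] by (auto intro: Sp_add)
qed

lemma Sp_single: "Sp {x} = {act c x | c. c \<in> A}"
proof
  show "Sp {x} \<subseteq> {act c x | c. c \<in> A}"
  proof
    fix v assume "v \<in> Sp {x}"
    then show "v \<in> {act c x | c. c \<in> A}"
    proof induction
      case S_span_0
      have "0 = act 0 x" by (simp add: act_0_left)
      then show ?case using polys_0 by blast
    next
      case (S_span_step v c y)
      then obtain d where "d \<in> A" "v = act d x" by auto
      then have "v + act c y = act (d + c) x" "d + c \<in> A"
        using S_span_step by (simp_all add: act_add_left polys_add)
      then show ?case by blast
    qed
  qed
qed (auto intro: Sp_act Sp_base)

lemma Sp_insert: "v \<in> Sp (insert x X) \<longleftrightarrow> (\<exists>c \<in> A. v - act c x \<in> Sp X)"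
proof
  assume "v \<in> Sp (insert x X)"
  then have "v \<in> Sp (X \<union> {x})" by simp
  then obtain w y where "w \<in> Sp X" "y \<in> Sp {x}" "v = w + y" unfolding Sp_Un by blast
  then show "\<exists>c \<in> A. v - act c x \<in> Sp X" unfolding Sp_single by force
next
  assume "\<exists>c \<in> A. v - act c x \<in> Sp X"
  then obtain c where c: "c \<in> A" "v - act c x \<in> Sp X" by blast
  then have "(v - act c x) + act c x \<in> Sp (insert x X)"
    using S_span_mono[of X "insert x X" n act] by (intro S_span_step) auto
  then show "v \<in> Sp (insert x X)" by simp
qed

lemma Sp_insert_0 [simp]: "Sp (insert 0 X) = Sp X"
  using Sp_insert[of _ 0 X] by (auto simp: act_0_right intro: polys_0)

lemma Sp_insert_redundant: "x \<in> Sp X \<Longrightarrow> Sp (insert x X) = Sp X"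
  using Sp_subset[of "insert x X" X] S_span_mono[of X "insert x X" n act] by (auto intro: Sp_base)

end

definition lincomb :: "((nat, 'k::field) mpoly \<Rightarrow> 'a::ab_group_add \<Rightarrow> 'a) \<Rightarrow> 'a list \<Rightarrow> (nat \<Rightarrow> (nat, 'k) mpoly) \<Rightarrow> 'a" where
  "lincomb act zs u = (\<Sum>i<length zs. act (u i) (zs ! i))"

abbreviation vecs :: "nat \<Rightarrow> nat \<Rightarrow> (nat \<Rightarrow> (nat, 'k::field) mpoly) set" where
  "vecs n s \<equiv> carrier (free_module n s)"

lemma vecs_iff: "u \<in> vecs n s \<longleftrightarrow> (\<forall>j<s. u j \<in> polys {..<n}) \<and> (\<forall>j\<ge>s. u j = 0)"
  by (simp add: free_module_def)

lemma vecs_nth: "u \<in> vecs n s \<Longrightarrow> u j \<in> polys {..<n}"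
  by (cases "j < s") (auto simp: vecs_iff)

lemma vecs_0: "0 \<in> vecs n s" and vecs_add: "u \<in> vecs n s \<Longrightarrow> v \<in> vecs n s \<Longrightarrow> u + v \<in> vecs n s"
  by (auto simp: vecs_iff intro: polys_add)

definition scale_vec :: "(nat, 'k::field) mpoly \<Rightarrow> (nat \<Rightarrow> (nat, 'k) mpoly) \<Rightarrow> nat \<Rightarrow> (nat, 'k) mpoly" where
  "scale_vec c u = (\<lambda>j. c * u j)"

lemma vecs_scale: "c \<in> polys {..<n} \<Longrightarrow> u \<in> vecs n s \<Longrightarrow> scale_vec c u \<in> vecs n s"
  by (auto simp: vecs_iff scale_vec_def intro: polys_mult)

definition S_submodule :: "nat \<Rightarrow> ((nat, 'k::field) mpoly \<Rightarrow> 'a::ab_group_add \<Rightarrow> 'a) \<Rightarrow> 'a set \<Rightarrow> bool" where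
  "S_submodule n act J \<longleftrightarrow> 0 \<in> J \<and> (\<forall>x\<in>J. \<forall>y\<in>J. x + y \<in> J) \<and> (\<forall>c \<in> polys {..<n}. \<forall>x\<in>J. act c x \<in> J)"

definition syzygies :: "nat \<Rightarrow> ((nat, 'k::field) mpoly \<Rightarrow> 'a::ab_group_add \<Rightarrow> 'a) \<Rightarrow> 'a set \<Rightarrow> 'a list \<Rightarrow> (nat \<Rightarrow> (nat, 'k) mpoly) set" where
  "syzygies n act J zs = {u \<in> vecs n (length zs). lincomb act zs u \<in> J}"

text \<open>Relative to a submodule \<open>J\<close>: the classes of the list \<open>zs\<close> in the quotient by \<open>J\<close> have linear quotients. An ideal
  generated by linear forms is proper, so this includes that no entry is redundant modulo its predecessors.\<close>
definition linear_quotients :: "nat \<Rightarrow> ((nat, 'k::field) mpoly \<Rightarrow> 'a::ab_group_add \<Rightarrow> 'a) \<Rightarrow> 'a set \<Rightarrow> 'a list \<Rightarrow> bool" where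
  "linear_quotients n act J zs \<longleftrightarrow>
     (\<forall>i < length zs. \<exists>L. finite L \<and> L \<subseteq> S_homogeneous n 1 \<and>
        {c \<in> polys {..<n}. act c (zs ! i) \<in> S_span n act (J \<union> set (take i zs))} = S_span n (*) L)"

lemma linear_quotients_append:
  "linear_quotients n act J (zs @ [z]) \<longleftrightarrow> linear_quotients n act J zs \<and>
     (\<exists>L. finite L \<and> L \<subseteq> S_homogeneous n 1 \<and>
        {c \<in> polys {..<n}. act c z \<in> S_span n act (J \<union> set zs)} = S_span n (*) L)"
  (is "?l \<longleftrightarrow> ?r \<and> ?Q z (set zs)")
proof -
  have "?l \<longleftrightarrow> (\<forall>i < length zs. ?Q ((zs @ [z]) ! i) (set (take i (zs @ [z])))) \<and> ?Q z (set zs)"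
    unfolding linear_quotients_def by (simp add: All_less_Suc conj_commute)
  also have "(\<forall>i < length zs. ?Q ((zs @ [z]) ! i) (set (take i (zs @ [z])))) \<longleftrightarrow> ?r"
    unfolding linear_quotients_def by (simp add: nth_append)
  finally show ?thesis .
qed

context S_action
begin

lemma Sp_submodule: "S_submodule n act J \<Longrightarrow> Sp J = J"
  using Sp_least[of J J] by (auto simp: S_submodule_def intro: Sp_base)

lemma S_submodule_diff: "S_submodule n act J \<Longrightarrow> x \<in> J \<Longrightarrow> y \<in> J \<Longrightarrow> x - y \<in> J"
  using Sp_submodule[of J] Sp_diff[of x J y] by auto

lemma lincomb_0 [simp]: "lincomb act zs 0 = 0"
  by (simp add: lincomb_def act_0_left)

lemma lincomb_add: "lincomb act zs (u + v) = lincomb act zs u + lincomb act zs v"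
  by (simp add: lincomb_def act_add_left sum.distrib)

lemma lincomb_scale: "lincomb act zs (scale_vec c u) = act c (lincomb act zs u)"
  by (simp add: lincomb_def scale_vec_def act_sum_right act_mult)

lemma lincomb_in_Sp: "u \<in> vecs n s \<Longrightarrow> lincomb act zs u \<in> Sp (set zs)"
  unfolding lincomb_def by (rule Sp_sum, rule Sp_act) (auto intro: Sp_base vecs_nth)

lemma Sp_set_eq: "Sp (set zs) = lincomb act zs ` vecs n (length zs)"
proof
  show "Sp (set zs) \<subseteq> lincomb act zs ` vecs n (length zs)"
  proof
    fix v assume "v \<in> Sp (set zs)"
    then show "v \<in> lincomb act zs ` vecs n (length zs)"
    proof induction
      case S_span_0
      then show ?case using vecs_0 lincomb_0 by (metis image_eqI)
    next
      case (S_span_step v c x)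
      then obtain u i where u: "u \<in> vecs n (length zs)" "v = lincomb act zs u" "i < length zs" "x = zs ! i"
        by (auto simp: in_set_conv_nth)
      define w where "w = (\<lambda>j. if j = i then c else 0)"
      have "w \<in> vecs n (length zs)"
        using S_span_step u by (auto simp: vecs_iff w_def)
      moreover have "lincomb act zs w = (\<Sum>j<length zs. if j = i then act c x else 0)"
        unfolding lincomb_def by (rule sum.cong) (auto simp: w_def u act_0_left)
      then have "lincomb act zs w = act c x"
        using u by (simp add: sum.delta)
      ultimately have "v + act c x = lincomb act zs (u + w)" "u + w \<in> vecs n (length zs)"
        using u vecs_add[of u n "length zs" w] by (simp_all only: lincomb_add)
      then show ?case by (rule image_eqI)
    qed
  qed
qed (auto intro: lincomb_in_Sp)

text \<open>The graded pieces of the relations, filtered by their last nonzero coordinate, are the colon ideals. This is why the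
  property of having linear quotients can be read off from the relations alone.\<close>
lemma syzygies_leading_ideal:
  assumes J: "S_submodule n act J" and i: "i < length zs"
  shows "{u i | u. u \<in> syzygies n act J zs \<and> (\<forall>j>i. u j = 0)} =
         {c \<in> A. act c (zs ! i) \<in> Sp (J \<union> set (take i zs))}" (is "?l = ?r")
proof
  show "?l \<subseteq> ?r"
  proof
    fix c assume "c \<in> ?l"
    then obtain u where u: "c = u i" "u \<in> vecs n (length zs)" "lincomb act zs u \<in> J" "\<And>j. j > i \<Longrightarrow> u j = 0"
      by (auto simp: syzygies_def)
    have "lincomb act zs u = (\<Sum>j<Suc i. act (u j) (zs ! j))"
      unfolding lincomb_def by (rule sum.mono_neutral_right) (use u i in \<open>auto simp: act_0_left\<close>)
    also have "\<dots> = lincomb act (take i zs) u + act c (zs ! i)"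
      using i u by (simp add: lincomb_def)
    finally have "act c (zs ! i) = lincomb act zs u - lincomb act (take i zs) u" by simp
    moreover have "lincomb act zs u \<in> Sp (J \<union> set (take i zs))"
      using u by (intro Sp_base) auto
    moreover have "lincomb act (take i zs) u \<in> Sp (J \<union> set (take i zs))"
      using lincomb_in_Sp[OF u(2), of "take i zs"] S_span_mono[of "set (take i zs)" "J \<union> set (take i zs)" n act] by auto
    ultimately show "c \<in> ?r" using u by (auto intro: Sp_diff vecs_nth)
  qed
  show "?r \<subseteq> ?l"
  proof
    fix c assume "c \<in> ?r"
    then have c: "c \<in> A" "act c (zs ! i) \<in> Sp (J \<union> set (take i zs))" by auto
    then obtain x y where xy: "x \<in> J" "y \<in> Sp (set (take i zs))" "act c (zs ! i) = x + y"
      using Sp_Un Sp_submodule[OF J] by metis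
    obtain u where u: "u \<in> vecs n i" "y = lincomb act (take i zs) u"
      using xy(2) i unfolding Sp_set_eq by auto
    define w where "w = (\<lambda>j. if j < i then - u j else if j = i then c else 0)"
    have w: "w \<in> vecs n (length zs)" "w i = c" "\<forall>j>i. w j = 0"
      using u c i by (auto simp: vecs_iff w_def intro: polys_uminus)
    have "lincomb act zs w = (\<Sum>j<Suc i. act (w j) (zs ! j))"
      unfolding lincomb_def by (rule sum.mono_neutral_right) (use w i in \<open>auto simp: act_0_left\<close>)
    also have "\<dots> = - lincomb act (take i zs) u + act c (zs ! i)"
      using i u by (simp add: lincomb_def w_def sum_negf act_uminus_left)
    also have "\<dots> = x" using xy u by simp
    finally have "w \<in> syzygies n act J zs" using w xy by (simp add: syzygies_def)
    then show "c \<in> ?l" using w by auto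
  qed
qed

end

interpretation ideals: S_action "(*) :: (nat, 'k::field) mpoly \<Rightarrow> _" n for n
  by unfold_locales (simp_all add: algebra_simps)

interpretation vectors: S_action "scale_vec :: (nat, 'k::field) mpoly \<Rightarrow> _" n for n
  by unfold_locales (simp_all add: scale_vec_def fun_eq_iff algebra_simps)

abbreviation S_ideal :: "nat \<Rightarrow> (nat, 'k::field) mpoly set \<Rightarrow> (nat, 'k) mpoly set" where
  "S_ideal n L \<equiv> S_span n (*) L"

lemma S_ideal_polys: "L \<subseteq> polys {..<n} \<Longrightarrow> S_ideal n L \<subseteq> polys {..<n}"
  by (rule ideals.Sp_least) (auto intro: polys_add polys_mult)

section \<open>Ideals generated by linear forms\<close>

lemma mdeg_eq_1D: "wdeg (\<lambda>_. 1) t = 1 \<Longrightarrow> \<exists>v. t = single v 1"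
proof -
  assume "wdeg (\<lambda>_. 1) t = 1"
  then have t: "mdeg t = 1" by (simp add: int_mdeg[symmetric])
  then have "t \<noteq> 0" by auto
  then obtain v where v: "v \<in> keys t" by fastforce
  define s where "s = t - single v 1"
  have ts: "t = s + single v 1"
    using v by (intro poly_mapping_eqI) (auto simp: s_def lookup_add lookup_minus lookup_single when_def in_keys_iff)
  then have "mdeg s = 0" using t mdeg_add[of s "single v 1"] by simp
  then have "s = 0" by (simp add: mdeg_eq_0_iff)
  then show ?thesis using ts by auto
qed

lemma var_S_homogeneous: "v < n \<Longrightarrow> var v \<in> S_homogeneous n 1"
  using polys_var[of v "{..<n}"]
  by (simp add: S_homogeneous_iff) (simp add: var_def mon_def homog_single)

lemma S_homogeneous_diff: "p \<in> S_homogeneous n d \<Longrightarrow> q \<in> S_homogeneous n d \<Longrightarrow> p - q \<in> S_homogeneous n d"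
  by (simp add: S_homogeneous_iff polys_diff homog_diff)

lemma S_homogeneous_scale:
  assumes "p \<in> S_homogeneous n d"
  shows "single 0 a * p \<in> S_homogeneous n d"
  using assms homog_mult[OF homog_const[of a], of p "\<lambda>_. 1" d]
  by (simp add: S_homogeneous_iff polys_mult polys_single)

lemma S_homogeneous_subst:
  assumes "p \<in> S_homogeneous n d" "\<And>v. v < n \<Longrightarrow> g v \<in> S_homogeneous n 1"
  shows "subst g p \<in> S_homogeneous n d"
proof -
  have p: "p \<in> polys {..<n}" "p \<in> homog (\<lambda>_. 1) d" using assms by (auto simp: S_homogeneous_iff)
  have "subst g p \<in> polys {..<n}"
    using assms(2) by (intro polys_subst[OF p(1)]) (auto simp: S_homogeneous_iff)
  moreover have "subst g p \<in> homog (\<lambda>_. 1) d"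
    using assms(2) by (intro homog_subst[OF p(2,1)]) (auto simp: S_homogeneous_iff)
  ultimately show ?thesis by (simp add: S_homogeneous_iff)
qed

lemma single_1_eq_iff: "single u (Suc 0) = single v (Suc 0) \<longleftrightarrow> u = v"
  by (metis keys_single nat.distinct(1) singleton_insert_inj_eq)

lemma subst_linear_form_diff:
  fixes m :: "('v, 'k::field) mpoly"
  assumes m: "m \<in> homog (\<lambda>_. 1) 1" and h: "\<And>u. u \<noteq> v \<Longrightarrow> h u = g u"
  shows "subst h m - subst g m = single 0 (lookup m (single v 1)) * (h v - g v)"
    (is "_ = ?R m")
proof -
  have "subst h (single t a) - subst g (single t a) = ?R (single t a)"
    if "t \<in> keys m" for t a
  proof -
    have "wdeg (\<lambda>_. 1) t = 1" using that m by (auto simp: homog_def)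
    then obtain u where "t = single u 1" using mdeg_eq_1D by blast
    then show ?thesis using h[of u]
      by (cases "u = v") (auto simp: subst_single monomial_eval_def algebra_simps lookup_single when_def single_1_eq_iff)
  qed
  note terms = this
  show ?thesis
  proof (rule mpoly_keys_induct[of _ m])
    fix q r assume *: "subst h q - subst g q = ?R q" "subst h r - subst g r = ?R r"
    have "subst h (q + r) - subst g (q + r) = (subst h q - subst g q) + (subst h r - subst g r)"
      by (simp add: subst_add)
    also have "\<dots> = ?R (q + r)"
      by (simp add: * lookup_add single_add distrib_right)
    finally show "subst h (q + r) - subst g (q + r) = ?R (q + r)" .
  qed (use terms in auto)
qed

lemma subst_diff_in_ideal:
  fixes p :: "('v, 'k::field) mpoly"
  assumes ideal: "0 \<in> I" "\<And>p q. p \<in> I \<Longrightarrow> q \<in> I \<Longrightarrow> p + q \<in> I" "\<And>c p. c \<in> polys W \<Longrightarrow> p \<in> I \<Longrightarrow> c * p \<in> I"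
    and diff: "\<And>v. v \<in> V \<Longrightarrow> g v - h v \<in> I"
    and gh: "\<And>v. v \<in> V \<Longrightarrow> g v \<in> polys W" "\<And>v. v \<in> V \<Longrightarrow> h v \<in> polys W" and p: "p \<in> polys V"
  shows "subst g p - subst h p \<in> I"
proof -
  have pow: "g v ^ i - h v ^ i \<in> I" if v: "v \<in> V" for v i
  proof (induction i)
    case (Suc i)
    have "g v ^ Suc i - h v ^ Suc i = g v * (g v ^ i - h v ^ i) + h v ^ i * (g v - h v)"
      by (simp add: algebra_simps)
    moreover have "g v * (g v ^ i - h v ^ i) \<in> I" by (rule ideal(3)[OF gh(1)[OF v] Suc])
    moreover have "h v ^ i * (g v - h v) \<in> I" by (rule ideal(3)[OF polys_power[OF gh(2)[OF v]] diff[OF v]])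
    ultimately show ?case using ideal(2) by simp
  qed (simp add: ideal(1))
  have prods: "(\<Prod>v\<in>X. g v ^ i v) - (\<Prod>v\<in>X. h v ^ i v) \<in> I"
    if "finite X" "X \<subseteq> V" for X i
    using that
  proof (induction X)
    case (insert x X)
    have "(\<Prod>v\<in>insert x X. g v ^ i v) - (\<Prod>v\<in>insert x X. h v ^ i v)
      = g x ^ i x * ((\<Prod>v\<in>X. g v ^ i v) - (\<Prod>v\<in>X. h v ^ i v)) + (\<Prod>v\<in>X. h v ^ i v) * (g x ^ i x - h x ^ i x)"
      using insert by (simp add: algebra_simps)
    moreover have "(\<Prod>v\<in>X. h v ^ i v) \<in> polys W" using insert gh by (intro polys_prod polys_power) auto
    moreover have "g x ^ i x \<in> polys W" using insert gh by (intro polys_power) auto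
    ultimately show ?case using insert pow[of x "i x"] ideal by simp
  qed (simp add: ideal(1))
  have "subst g p - subst h p = (\<Sum>t\<in>keys p. single 0 (lookup p t) * (monomial_eval g t - monomial_eval h t))"
    by (simp add: subst_def sum_subtractf algebra_simps)
  moreover have "single 0 (lookup p t) * (monomial_eval g t - monomial_eval h t) \<in> I"
    if "t \<in> keys p" for t
    using p that unfolding monomial_eval_def
    by (intro ideal(3) prods polys_single) (auto simp: polys_iff)
  moreover have "sum q X \<in> I" if "\<And>t. t \<in> X \<Longrightarrow> q t \<in> I" for q and X :: "'v monomial set"
    using that by (induction X rule: infinite_finite_induct) (auto simp: ideal)
  ultimately show ?thesis by simp
qed

text \<open>Linear forms can be eliminated one at a time: if \<open>g\<close> already has kernel \<open>(L)\<close> and \<open>g(l) = a x\<^sub>v + \<dots>\<close> is not zero, compose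
  \<open>g\<close> with the substitution that solves \<open>g(l) = 0\<close> for \<open>x\<^sub>v\<close>. Since \<open>p\<close> and its image differ by an element of the ideal,
  the ideal is the whole kernel.\<close>
lemma linear_ideal_is_kernel:
  fixes L :: "(nat, 'k::field) mpoly set"
  assumes "finite L" "L \<subseteq> S_homogeneous n 1"
  shows "\<exists>g. (\<forall>v<n. g v \<in> S_homogeneous n 1) \<and> (\<forall>p \<in> polys {..<n}. p - subst g p \<in> S_ideal n L) \<and>
             (\<forall>p \<in> S_ideal n L. subst g p = 0)"
  using assms
proof (induction L)
  case empty
  show ?case
    by (rule exI[of _ var]) (auto simp: subst_var_id var_S_homogeneous)
next
  case (insert l L)
  have "L \<subseteq> S_homogeneous n 1" using insert.prems by simp
  from insert.IH[OF this] obtain g where "\<forall>v<n. g v \<in> S_homogeneous n 1"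
    "\<forall>p \<in> polys {..<n}. p - subst g p \<in> S_ideal n L" "\<forall>p \<in> S_ideal n L. subst g p = 0"
    by (elim exE conjE)
  then have g: "\<And>v. v < n \<Longrightarrow> g v \<in> S_homogeneous n 1"
    "\<And>p. p \<in> polys {..<n} \<Longrightarrow> p - subst g p \<in> S_ideal n L" "\<And>p. p \<in> S_ideal n L \<Longrightarrow> subst g p = 0"
    by simp_all
  have lA: "l \<in> polys {..<n}" using insert by (auto simp: S_homogeneous_iff)
  have mono: "p \<in> S_ideal n L \<Longrightarrow> p \<in> S_ideal n (insert l L)" for p
    using S_span_mono[of L "insert l L"] by blast
  show ?case
  proof (cases "subst g l = 0")
    case True
    have "subst g p = 0" if p: "p \<in> S_ideal n (insert l L)" for p
    proof -
      obtain c where c: "p - c * l \<in> S_ideal n L" using p unfolding ideals.Sp_insert by auto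
      have "subst g (p - c * l) = 0" using g(3)[OF c] .
      then show ?thesis using True by (simp add: subst_diff subst_mult)
    qed
    then show ?thesis using g(1) mono[OF g(2)] by (intro exI[of _ g]) simp
  next
    case False
    define m where "m = subst g l"
    have m: "m \<in> S_homogeneous n 1"
      unfolding m_def using g(1) insert.prems by (intro S_homogeneous_subst) auto
    obtain t where t: "t \<in> keys m" using False m_def by fastforce
    then have "wdeg (\<lambda>_. 1) t = 1" using m by (auto simp: S_homogeneous_iff homog_def)
    then obtain v where v: "t = single v 1" using mdeg_eq_1D by blast
    define a where "a = lookup m t"
    have a: "a \<noteq> 0" using t by (simp add: a_def in_keys_iff)
    have vn: "v < n" using t v m by (auto simp: S_homogeneous_iff polys_iff)
    \<comment> \<open>the solution of the equation \<open>m = 0\<close> for the variable \<open>v\<close>\<close>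
    define h where "h = var(v := var v - single 0 (1/a) * m)"
    have hS: "h u \<in> S_homogeneous n 1" if "u < n" for u
      using vn that by (simp add: h_def S_homogeneous_diff S_homogeneous_scale[OF m] var_S_homogeneous)
    have "subst h m - subst var m = single 0 a * (h v - var v)"
      using subst_linear_form_diff[of m v h var] m by (simp add: a_def v S_homogeneous_iff h_def)
    also have "\<dots> = - (single 0 a * single 0 (1/a) * m)"
      by (simp add: h_def algebra_simps)
    also have "\<dots> = - m" using a by (simp add: mult_single)
    finally have hm: "subst h m = 0" by (simp add: subst_var_id)
    have mI: "m \<in> S_ideal n (insert l L)"
    proof -
      have "l - m \<in> S_ideal n (insert l L)" using g(2)[OF lA] mono by (simp add: m_def)
      then have "l - (l - m) \<in> S_ideal n (insert l L)"
        by (rule ideals.Sp_diff[OF ideals.Sp_base, rotated]) simp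
      then show ?thesis by simp
    qed
    have gA: "subst g p \<in> polys {..<n}" if "p \<in> polys {..<n}" for p
      using g(1) by (intro polys_subst[OF that]) (auto simp: S_homogeneous_iff)
    have 1: "p - subst h (subst g p) \<in> S_ideal n (insert l L)" if p: "p \<in> polys {..<n}" for p
    proof -
      have "subst var (subst g p) - subst h (subst g p) \<in> S_ideal n (insert l L)"
      proof (rule subst_diff_in_ideal[where V = "{..<n}" and W = "{..<n}"])
        show "var u - h u \<in> S_ideal n (insert l L)" if "u \<in> {..<n}" for u
          using mI that by (auto simp: h_def S_span_0 intro!: ideals.Sp_act polys_single)
        show "h u \<in> polys {..<n}" if "u \<in> {..<n}" for u using hS that by (simp add: S_homogeneous_iff)
        show "subst g p \<in> polys {..<n}" by (rule gA[OF p])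
      qed (auto intro: polys_var S_span_0 ideals.Sp_add ideals.Sp_act)
      then have "(p - subst g p) + (subst g p - subst h (subst g p)) \<in> S_ideal n (insert l L)"
        using mono[OF g(2)[OF p]] by (intro ideals.Sp_add) (simp_all only: subst_var_id)
      then show ?thesis by simp
    qed
    have 2: "subst h (subst g p) = 0" if p: "p \<in> S_ideal n (insert l L)" for p
    proof -
      obtain c where c: "p - c * l \<in> S_ideal n L" using p unfolding ideals.Sp_insert by auto
      have "subst g (p - c * l) = 0" using g(3)[OF c] .
      then have "subst g p = subst g c * m" by (simp add: subst_diff subst_mult m_def)
      then show ?thesis using hm by (simp add: subst_mult)
    qed
    have 3: "subst h (g v) \<in> S_homogeneous n 1" if "v < n" for v
      using g(1)[OF that] hS by (intro S_homogeneous_subst)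
    show ?thesis
      using 1 2 3 unfolding subst_subst by (intro exI[of _ "\<lambda>v. subst h (g v)"]) simp
  qed
qed

text \<open>The ideal is the kernel of a homomorphism into a domain.\<close>
lemma linear_ideal_prime:
  fixes L :: "(nat, 'k::field) mpoly set"
  assumes L: "finite L" "L \<subseteq> S_homogeneous n 1" and c: "c \<in> polys {..<n}" "l \<in> polys {..<n}"
    and "c * l \<in> S_ideal n L" "l \<notin> S_ideal n L"
  shows "c \<in> S_ideal n L"
proof -
  obtain g where g: "\<forall>p \<in> polys {..<n}. p - subst g p \<in> S_ideal n L" "\<forall>p \<in> S_ideal n L. subst g p = 0"
    using linear_ideal_is_kernel[OF L] by blast
  have "subst g l \<noteq> 0" using g c assms by force
  moreover have "subst g c * subst g l = 0" using g assms by (simp add: subst_mult[symmetric])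
  ultimately have "subst g c = 0" by simp
  then show ?thesis using g c by force
qed

lemma linear_ideal_restr:
  assumes L: "L \<subseteq> S_homogeneous n 1" and p: "p \<in> S_ideal n L"
  shows "restr (\<lambda>_. 1) E p \<in> S_ideal n L"
  using p
proof induction
  case (S_span_step v c x)
  then have "restr (\<lambda>_. 1) E (c * x) = restr (\<lambda>_. 1) {e. e + 1 \<in> E} c * x"
    using L by (intro restr_mult_homog[where d = 1]) (auto simp: S_homogeneous_iff)
  then show ?case using S_span_step
    by (simp add: restr_add S_span.S_span_step polys_restr)
qed (simp add: S_span_0)

section \<open>Truncations of quotients by linear forms\<close>

lemma linear_quotients_append_list:
  "linear_quotients n act J (xs @ ys) \<longleftrightarrow> linear_quotients n act J xs \<and> linear_quotients n act (J \<union> set xs) ys"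
proof (induction ys rule: rev_induct)
  case Nil
  then show ?case by (simp add: linear_quotients_def)
next
  case (snoc y ys)
  then show ?case
    unfolding append_assoc[symmetric] linear_quotients_append by (simp add: Un_assoc conj_assoc)
qed

lemma linear_quotients_transfer:
  assumes "linear_quotients n act J zs" "length zs' = length zs"
    and "\<And>i c. i < length zs \<Longrightarrow> c \<in> polys {..<n} \<Longrightarrow>
      act' c (zs' ! i) \<in> S_span n act' (J' \<union> set (take i zs')) \<longleftrightarrow> act c (zs ! i) \<in> S_span n act (J \<union> set (take i zs))"
  shows "linear_quotients n act' J' zs'"
  unfolding linear_quotients_def
proof (intro allI impI)
  fix i assume i: "i < length zs'"
  then have "{c \<in> polys {..<n}. act' c (zs' ! i) \<in> S_span n act' (J' \<union> set (take i zs'))} =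
             {c \<in> polys {..<n}. act c (zs ! i) \<in> S_span n act (J \<union> set (take i zs))}"
    using assms by auto
  then show "\<exists>L. finite L \<and> L \<subseteq> S_homogeneous n 1 \<and>
       {c \<in> polys {..<n}. act' c (zs' ! i) \<in> S_span n act' (J' \<union> set (take i zs'))} = S_ideal n L"
    using assms i unfolding linear_quotients_def by simp
qed

lemma S_homogeneous_mult: "p \<in> S_homogeneous n d \<Longrightarrow> q \<in> S_homogeneous n e \<Longrightarrow> p * q \<in> S_homogeneous n (d + e)"
  by (simp add: S_homogeneous_iff polys_mult homog_mult)

lemma monomial_split:
  assumes "e \<le> mdeg t"
  shows "\<exists>s r. t = s + r \<and> mdeg r = e"
  using assms
proof (induction e)
  case 0
  show ?case by (rule exI[of _ t], rule exI[of _ 0]) simp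
next
  case (Suc e)
  then obtain s r where sr: "t = s + r" "mdeg r = e" by auto
  have "mdeg s \<noteq> 0" using Suc.prems sr by (auto simp: mdeg_add)
  then obtain v where v: "v \<in> keys s"
    by (metis mdeg_eq_0_iff keys_eq_empty equals0I)
  have "s = (s - single v 1) + single v 1"
    using v by (intro poly_mapping_eqI) (auto simp: lookup_add lookup_minus lookup_single when_def in_keys_iff)
  then have "t = (s - single v 1) + (single v 1 + r)"
    unfolding sr by (metis add.assoc)
  moreover have "mdeg (single v 1 + r) = Suc e" by (simp add: mdeg_add sr)
  ultimately show ?case by blast
qed

lemma polys_high_degree:
  assumes p: "p \<in> polys {..<n}" and e: "\<And>t. t \<in> keys p \<Longrightarrow> e \<le> mdeg t"
  shows "p \<in> S_ideal n (S_homogeneous n (int e))"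
proof (rule mpoly_keys_induct[of _ p])
  fix t a assume t: "t \<in> keys p"
  then obtain s r where sr: "t = s + r" "mdeg r = e" using monomial_split e by blast
  have "keys t \<subseteq> {..<n}" using p t by (auto simp: polys_iff)
  then have keys: "keys s \<subseteq> {..<n}" "keys r \<subseteq> {..<n}"
    by (auto simp: sr keys_plus_monomial)
  then have "mon r \<in> S_homogeneous n (int e)"
    using sr by (auto simp: S_homogeneous_iff polys_single int_mdeg[symmetric] mon_def intro: homog_single)
  moreover have "single t a = single s a * mon r"
    by (simp add: sr mon_def mult_single)
  ultimately show "single t a \<in> S_ideal n (S_homogeneous n (int e))"
    using keys by (auto intro: ideals.Sp_act ideals.Sp_base polys_single)
qed (auto intro: S_span_0 ideals.Sp_add)

lemma linear_form_in_vars: "S_homogeneous n 1 \<subseteq> S_ideal n (var ` {..<n})"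
proof
  fix p :: "(nat, 'k::field) mpoly" assume p: "p \<in> S_homogeneous n 1"
  show "p \<in> S_ideal n (var ` {..<n})"
  proof (rule mpoly_keys_induct[of _ p])
    fix t a assume t: "t \<in> keys p"
    then have "wdeg (\<lambda>_. 1) t = 1" using p by (auto simp: S_homogeneous_iff homog_def)
    then obtain v where v: "t = single v 1" using mdeg_eq_1D by blast
    then have "v < n" using p t by (auto simp: S_homogeneous_iff polys_iff)
    moreover have "single t a = single 0 a * var v"
      by (simp add: v var_def mon_def mult_single)
    ultimately show "single t a \<in> S_ideal n (var ` {..<n})"
      by (simp add: ideals.Sp_act ideals.Sp_base polys_single)
  qed (auto intro: S_span_0 ideals.Sp_add)
qed

lemma S_ideal_high_degree:
  assumes X: "X \<subseteq> S_homogeneous n d" and p: "p \<in> S_ideal n X"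
  shows "restr (\<lambda>_. 1) {d..} p = p"
  using p
proof induction
  case (S_span_step v c x)
  have "wdeg (\<lambda>_. 1) t \<ge> d" if t: "t \<in> keys (c * x)" for t
  proof -
    obtain a b where "t = a + b" "b \<in> keys x" using subsetD[OF keys_mult t] by auto
    then show ?thesis using X S_span_step by (auto simp: S_homogeneous_def mdeg_add int_mdeg[symmetric])
  qed
  then show ?case using S_span_step by (simp add: restr_add restr_ident)
qed simp

text \<open>An element of high degree that lies in \<open>(L, x\<^sub>v) + (X)\<close> uses \<open>x\<^sub>v\<close> only with a
  coefficient of degree at least \<open>e\<close>, and such coefficients are generated by \<open>us\<close> modulo \<open>L\<close>.\<close>
lemma truncation_step:
  assumes L: "L \<subseteq> S_homogeneous n 1" and v: "v < n"
    and us: "S_homogeneous n (int e) \<subseteq> S_ideal n (L \<union> set us)"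
    and X: "X \<subseteq> S_homogeneous n (int (Suc e))"
    and q: "q \<in> S_ideal n (insert (var v) L \<union> X)" "restr (\<lambda>_. 1) {int (Suc e)..} q = q"
  shows "q \<in> S_ideal n (L \<union> (*) (var v) ` set us \<union> X)"
proof -
  let ?Y = "L \<union> (*) (var v) ` set us \<union> X"
  have "q \<in> S_ideal n (insert (var v) (L \<union> X))" using q by simp
  then obtain c where c: "c \<in> polys {..<n}" "q - c * var v \<in> S_ideal n (L \<union> X)" unfolding ideals.Sp_insert by blast
  then obtain l x where lx: "l \<in> S_ideal n L" "x \<in> S_ideal n X" "q - c * var v = l + x"
    unfolding ideals.Sp_Un by blast
  let ?r = "restr (\<lambda>_. 1) {int (Suc e)..}"
  let ?c = "restr (\<lambda>_. 1) {int e..} c"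
  have q': "q = c * var v + l + x" using lx by (simp add: algebra_simps)
  have "?r (c * var v) = ?c * var v"
    using var_S_homogeneous[OF v] by (intro restr_mult_homog[where d = 1]) (auto simp: S_homogeneous_iff)
  then have "?r q = ?c * var v + ?r l + x"
    unfolding q' by (simp only: restr_add S_ideal_high_degree[OF X lx(2)])
  then have qr: "q = var v * ?c + ?r l + x" using q(2) by (simp add: mult.commute)
  have "?c \<in> S_ideal n (S_homogeneous n (int e))"
    using c by (intro polys_high_degree polys_restr) (auto simp: keys_restr int_mdeg[symmetric])
  then have "?c \<in> S_ideal n (L \<union> set us)" using ideals.Sp_subset[OF us] by blast
  then have "var v * ?c \<in> S_ideal n ?Y"
  proof induction
    case (S_span_step w d y)
    have "var v * y \<in> S_ideal n ?Y"
    proof (cases "y \<in> L")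
      case True
      then show ?thesis by (intro ideals.Sp_act[OF polys_var] ideals.Sp_base) (use v in auto)
    qed (use S_span_step in \<open>auto intro: ideals.Sp_base\<close>)
    then have "d * (var v * y) \<in> S_ideal n ?Y" using S_span_step by (intro ideals.Sp_act[of d])
    then have "var v * w + d * (var v * y) \<in> S_ideal n ?Y" using S_span_step by (intro ideals.Sp_add)
    then show ?case by (simp add: algebra_simps)
  qed (simp add: S_span_0)
  moreover have "?r l \<in> S_ideal n ?Y"
    using linear_ideal_restr[OF L lx(1)] S_span_mono[of L ?Y n "(*)"] by blast
  moreover have "x \<in> S_ideal n ?Y"
    using lx(2) S_span_mono[of X ?Y n "(*)"] by blast
  ultimately have "var v * ?c + ?r l + x \<in> S_ideal n ?Y" by (intro ideals.Sp_add)
  then show ?thesis using qr by simp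
qed

lemma truncation_generators_0:
  assumes "finite L" "L \<subseteq> S_homogeneous n 1"
  shows "\<exists>us. set us \<subseteq> S_homogeneous n 0 \<and> S_homogeneous n 0 \<subseteq> S_ideal n (L \<union> set us) \<and> linear_quotients n (*) L us"
proof (intro exI[of _ "[1]"] conjI)
  show "set [1] \<subseteq> S_homogeneous n 0" by (simp add: S_homogeneous_iff homog_1)
  have "p \<in> S_ideal n (L \<union> set [1])" if "p \<in> polys {..<n}" for p
    using ideals.Sp_act[OF that, of 1 "L \<union> set [1]"] by (simp add: ideals.Sp_base)
  then show "S_homogeneous n 0 \<subseteq> S_ideal n (L \<union> set [1])" by (auto simp: S_homogeneous_iff)
  have "L \<subseteq> polys {..<n}" using assms by (auto simp: S_homogeneous_iff)
  then have "{c \<in> polys {..<n}. c \<in> S_ideal n L} = S_ideal n L" using S_ideal_polys[of L n] by blast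
  then show "linear_quotients n (*) L [1]"
    using assms unfolding linear_quotients_def by auto
qed

text \<open>If \<open>x\<^sub>v\<close> is not in \<open>(L)\<close>,
  it is a nonzerodivisor on \<open>S/(L)\<close>; take first the multiples by \<open>x\<^sub>v\<close> of the generators in degree \<open>e - 1\<close>, and then
  the generators in degree \<open>e\<close> for \<open>S/(L, x\<^sub>v)\<close>. The set \<open>V\<close> consists of the variables not yet treated; once none are
  left, \<open>(L)\<close> is the maximal ideal.\<close>
lemma truncation_generators:
  fixes L :: "(nat, 'k::field) mpoly set"
  assumes "finite V" "V \<subseteq> {..<n}" "finite L" "L \<subseteq> S_homogeneous n 1" "var ` {..<n} \<subseteq> S_ideal n (L \<union> var ` V)"
  shows "\<exists>us. set us \<subseteq> S_homogeneous n (int e) \<and> S_homogeneous n (int e) \<subseteq> S_ideal n (L \<union> set us) \<and>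
              linear_quotients n (*) L us"
  using assms
proof (induction V arbitrary: L e)
  case empty
  show ?case
  proof (cases e)
    case 0
    then show ?thesis using truncation_generators_0[OF empty.prems(2,3)] by simp
  next
    case (Suc e')
    have "p \<in> S_ideal n L" if p: "p \<in> S_homogeneous n (int e)" for p
    proof -
      have "p \<in> S_ideal n (S_homogeneous n (int 1))"
        using p Suc by (intro polys_high_degree) (auto simp: S_homogeneous_def)
      also have "\<dots> \<subseteq> S_ideal n (var ` {..<n})" by (rule ideals.Sp_subset) (use linear_form_in_vars in simp)
      also have "\<dots> \<subseteq> S_ideal n L" by (rule ideals.Sp_subset) (use empty.prems in simp)
      finally show ?thesis .
    qed
    then show ?thesis by (intro exI[of _ "[]"]) (auto simp: linear_quotients_def)
  qed
next
  case (insert v V)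
  have v: "v < n" using insert.prems by simp
  show ?case
  proof (cases "var v \<in> S_ideal n L")
    case True
    have "insert (var v) (L \<union> var ` V) \<subseteq> S_ideal n (L \<union> var ` V)"
      using True S_span_mono[of L "L \<union> var ` V" n "(*)"] by (auto intro: ideals.Sp_base)
    then have "S_ideal n (L \<union> var ` insert v V) \<subseteq> S_ideal n (L \<union> var ` V)"
      unfolding image_insert Un_insert_right by (rule ideals.Sp_subset)
    then have "var ` {..<n} \<subseteq> S_ideal n (L \<union> var ` V)" using insert.prems(4) by (rule subset_trans[rotated])
    moreover have "V \<subseteq> {..<n}" using insert.prems(1) by simp
    ultimately show ?thesis using insert.IH insert.prems(2,3) by simp
  next
    case False
    show ?thesis
    proof (induction e)
      case 0
      then show ?case using truncation_generators_0[OF insert.prems(2,3)] by simp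
    next
      case (Suc e)
      then obtain us where us: "set us \<subseteq> S_homogeneous n (int e)" 
        "S_homogeneous n (int e) \<subseteq> S_ideal n (L \<union> set us)" "linear_quotients n (*) L us" by (elim exE conjE)
      have "insert (var v) L \<union> var ` V = L \<union> var ` insert v V" by auto
      moreover have "insert (var v) L \<subseteq> S_homogeneous n 1" using insert.prems var_S_homogeneous[OF v] by auto
      ultimately have "\<exists>ws. set ws \<subseteq> S_homogeneous n (int (Suc e)) \<and> 
        S_homogeneous n (int (Suc e)) \<subseteq> S_ideal n (insert (var v) L \<union> set ws) \<and> linear_quotients n (*) (insert (var v) L) ws"
        using insert.prems by (intro insert.IH) simp_all
      then obtain ws where ws: "set ws \<subseteq> S_homogeneous n (int (Suc e))" 
        "S_homogeneous n (int (Suc e)) \<subseteq> S_ideal n (insert (var v) L \<union> set ws)" "linear_quotients n (*) (insert (var v) L) ws"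
        by (elim exE conjE)
      note step = truncation_step[OF insert.prems(3) v us(2)]
      let ?us = "map ((*) (var v)) us"
      have "linear_quotients n (*) L ?us"
      proof (rule linear_quotients_transfer[OF us(3)])
        fix i and c :: "(nat, 'k) mpoly" assume i: "i < length us" and c: "c \<in> polys {..<n}"
        have "c * (var v * us ! i) \<in> S_ideal n (L \<union> (*) (var v) ` set (take i us)) \<longleftrightarrow>
              c * us ! i \<in> S_ideal n (L \<union> set (take i us))" (is "?l \<longleftrightarrow> ?r")
        proof
          assume ?l
          then obtain l x where lx: "l \<in> S_ideal n L" "x \<in> S_ideal n ((*) (var v) ` set (take i us))"
            "c * (var v * us ! i) = l + x" unfolding ideals.Sp_Un by blast
          have "\<exists>y \<in> S_ideal n (set (take i us)). x = var v * y" using lx(2)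
          proof induction
            case S_span_0
            show ?case by (intro bexI[of _ 0]) (auto intro: S_span.S_span_0)
          next
            case (S_span_step w d z)
            then obtain y y' where y: "y \<in> S_ideal n (set (take i us))" "w = var v * y" "y' \<in> set (take i us)" "z = var v * y'"
              by blast
            have "y + d * y' \<in> S_ideal n (set (take i us))" using y S_span_step(2) by (intro S_span.S_span_step)
            moreover have "w + d * z = var v * (y + d * y')" unfolding y(2,4) by (simp add: algebra_simps)
            ultimately show ?case by blast
          qed
          then obtain y where y: "y \<in> S_ideal n (set (take i us))" "x = var v * y" by blast
          have "set (take i us) \<subseteq> polys {..<n}"
            using us(1) by (auto simp: S_homogeneous_iff dest!: in_set_takeD)
          then have yA: "y \<in> polys {..<n}" using y S_ideal_polys by blast
          have uA: "us ! i \<in> polys {..<n}" using us(1) nth_mem[OF i] by (auto simp: S_homogeneous_iff)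
          have "(c * us ! i - y) * var v = c * (var v * us ! i) - var v * y" by (simp add: algebra_simps)
          also have "\<dots> = l" unfolding lx(3) y(2) by simp
          finally have "(c * us ! i - y) * var v = l" .
          \<comment> \<open>cancel \<open>x\<^sub>v\<close>\<close>
          then have "c * us ! i - y \<in> S_ideal n L"
            using lx(1) False v yA uA c linear_ideal_prime[OF insert.prems(2,3), of "c * us ! i - y" "var v"]
            by (simp add: polys_var polys_diff polys_mult)
          then have "(c * us ! i - y) + y \<in> S_ideal n (L \<union> set (take i us))"
            unfolding ideals.Sp_Un by (intro bexI[where x = y] bexI[where x = "c * us ! i - y"] refl y(1))
          then show ?r by simp
        next
          assume ?r
          then obtain l x where lx: "l \<in> S_ideal n L" "x \<in> S_ideal n (set (take i us))"
            "c * us ! i = l + x" unfolding ideals.Sp_Un by blast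
          have "var v * x \<in> S_ideal n ((*) (var v) ` set (take i us))" using lx(2)
          proof induction
            case (S_span_step w d z)
            then have "var v * w + d * (var v * z) \<in> S_ideal n ((*) (var v) ` set (take i us))"
              by (auto intro: S_span.S_span_step)
            then show ?case by (simp add: algebra_simps)
          qed (simp add: S_span_0)
          moreover have "var v * l \<in> S_ideal n L" using lx v by (intro ideals.Sp_act polys_var) auto
          moreover have "c * (var v * us ! i) = var v * l + var v * x"
            using lx(3) by (metis mult.left_commute distrib_left)
          ultimately show ?l unfolding ideals.Sp_Un by blast
        qed
        then show "c * ?us ! i \<in> S_ideal n (L \<union> set (take i ?us)) \<longleftrightarrow> c * us ! i \<in> S_ideal n (L \<union> set (take i us))"
          using i by (simp add: take_map)
      qed simp
      moreover have "linear_quotients n (*) (L \<union> set ?us) ws"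
      proof (rule linear_quotients_transfer[OF ws(3)])
        fix i and c :: "(nat, 'k) mpoly" assume i: "i < length ws" and c: "c \<in> polys {..<n}"
        let ?X = "set (take i ws)"
        have X: "?X \<subseteq> S_homogeneous n (int (Suc e))" using ws(1) by (auto dest: in_set_takeD)
        have "S_ideal n (L \<union> set ?us \<union> ?X) \<subseteq> S_ideal n (insert (var v) L \<union> ?X)"
        proof (rule ideals.Sp_subset)
          have "var v * u \<in> S_ideal n (insert (var v) L \<union> ?X)" if "u \<in> set us" for u
          proof -
            have "u \<in> polys {..<n}" using that us(1) by (auto simp: S_homogeneous_iff)
            then have "u * var v \<in> S_ideal n (insert (var v) L \<union> ?X)"
              by (intro ideals.Sp_act ideals.Sp_base) auto
            then show ?thesis by (simp add: mult.commute)
          qed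
          then show "L \<union> set ?us \<union> ?X \<subseteq> S_ideal n (insert (var v) L \<union> ?X)"
            by (auto intro: ideals.Sp_base)
        qed
        moreover have "c * ws ! i \<in> S_ideal n (L \<union> set ?us \<union> ?X)"
          if "c * ws ! i \<in> S_ideal n (insert (var v) L \<union> ?X)"
        proof -
          have "c * ws ! i \<in> S_ideal n {ws ! i}" using c by (intro ideals.Sp_act ideals.Sp_base) auto
          then have "restr (\<lambda>_. 1) {int (Suc e)..} (c * ws ! i) = c * ws ! i"
            using ws(1) nth_mem[OF i] by (intro S_ideal_high_degree[where X = "{ws ! i}"]) auto
          then show ?thesis using step[OF X that] by simp
        qed
        ultimately show "c * ws ! i \<in> S_ideal n (L \<union> set ?us \<union> ?X) \<longleftrightarrow> c * ws ! i \<in> S_ideal n (insert (var v) L \<union> ?X)"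
          by blast
      qed simp
      ultimately have "linear_quotients n (*) L (?us @ ws)" by (simp only: linear_quotients_append_list)
      moreover have "set (?us @ ws) \<subseteq> S_homogeneous n (int (Suc e))"
      proof -
        have "var v * u \<in> S_homogeneous n (int (Suc e))" if "u \<in> set us" for u
          using S_homogeneous_mult[OF var_S_homogeneous[OF v] subsetD[OF us(1) that]] by simp
        then show ?thesis using ws(1) by auto
      qed
      moreover have "S_homogeneous n (int (Suc e)) \<subseteq> S_ideal n (L \<union> set (?us @ ws))"
      proof
        fix p :: "(nat, 'k) mpoly" assume p: "p \<in> S_homogeneous n (int (Suc e))"
        then have "restr (\<lambda>_. 1) {int (Suc e)..} p = p"
          using restr_of_homog[of p "\<lambda>_. 1" "int (Suc e)" "{int (Suc e)..}"] by (simp add: S_homogeneous_iff)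
        moreover have "p \<in> S_ideal n (insert (var v) L \<union> set ws)" using p ws(2) by blast
        ultimately show "p \<in> S_ideal n (L \<union> set (?us @ ws))"
          using step[OF ws(1)] by (simp add: Un_assoc)
      qed
      ultimately show ?case by (intro exI[of _ "?us @ ws"] conjI)
    qed
  qed
qed

section \<open>Linear resolutions\<close>

text \<open>Linear quotients, expressed by the relation module \<open>Z\<close> of the generators alone. The condition on the parts of degree 1 is what
  remains of homogeneity: a linear form in a colon ideal comes from a relation with linear entries.\<close>
definition linear_relation_module :: "nat \<Rightarrow> nat \<Rightarrow> (nat \<Rightarrow> (nat, 'k::field) mpoly) set \<Rightarrow> bool" where
  "linear_relation_module n s Z \<longleftrightarrow>
     S_submodule n scale_vec Z \<and> Z \<subseteq> vecs n s \<and>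
     (\<forall>u\<in>Z. (\<lambda>i. restr (\<lambda>_. 1) {1} (u i)) \<in> Z) \<and>
     (\<forall>i<s. \<exists>L. finite L \<and> L \<subseteq> S_homogeneous n 1 \<and> {u i | u. u \<in> Z \<and> (\<forall>j>i. u j = 0)} = S_ideal n L)"

lemma (in S_action) linear_relation_moduleI:
  assumes J: "S_submodule n act J" and lq: "linear_quotients n act J zs"
    and deg1: "\<And>u. u \<in> syzygies n act J zs \<Longrightarrow> (\<lambda>i. restr (\<lambda>_. 1) {1} (u i)) \<in> syzygies n act J zs"
  shows "linear_relation_module n (length zs) (syzygies n act J zs)"
  unfolding linear_relation_module_def
proof (intro conjI)
  show "S_submodule n scale_vec (syzygies n act J zs)"
    using J unfolding S_submodule_def syzygies_def
    by (simp add: vecs_0 vecs_add vecs_scale lincomb_add lincomb_scale)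
  show "\<forall>i<length zs. \<exists>L. finite L \<and> L \<subseteq> S_homogeneous n 1 \<and>
          {u i | u. u \<in> syzygies n act J zs \<and> (\<forall>j>i. u j = 0)} = S_ideal n L"
    using lq syzygies_leading_ideal[OF J] unfolding linear_quotients_def by auto
qed (use deg1 in \<open>auto simp: syzygies_def\<close>)

definition linear_vecs :: "nat \<Rightarrow> (nat \<Rightarrow> (nat, 'k::field) mpoly) set" where
  "linear_vecs n = {z. \<forall>j. z j \<in> S_homogeneous n 1}"

lemma lincomb_vec_apply: "lincomb scale_vec zs u j = (\<Sum>i<length zs. u i * (zs ! i) j)"
proof -
  have *: "(\<Sum>i\<in>I. f i) j = (\<Sum>i\<in>I. f i j)" for I and f :: "nat \<Rightarrow> nat \<Rightarrow> (nat, 'a) mpoly"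
    by (induction I rule: infinite_finite_induct) auto
  show ?thesis by (simp add: lincomb_def scale_vec_def *)
qed

text \<open>Multiplication by linear entries raises degrees by 1, so the quadratic part of the equation that defines a
  relation is the equation for its linear part.\<close>
lemma syzygies_linear_vecs_restr:
  assumes "set zs \<subseteq> linear_vecs n" "u \<in> syzygies n scale_vec {0} zs"
  shows "(\<lambda>i. restr (\<lambda>_. 1) {1} (u i)) \<in> syzygies n scale_vec {0} zs"
proof -
  have u: "u \<in> vecs n (length zs)" "lincomb scale_vec zs u = 0" using assms by (auto simp: syzygies_def)
  have "lincomb scale_vec zs (\<lambda>i. restr (\<lambda>_. 1) {1} (u i)) j = 0" for j
  proof -
    have "lincomb scale_vec zs (\<lambda>i. restr (\<lambda>_. 1) {1} (u i)) j = (\<Sum>i<length zs. restr (\<lambda>_. 1) {2} (u i * (zs ! i) j))"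
      unfolding lincomb_vec_apply
    proof (rule sum.cong)
      fix i assume "i \<in> {..<length zs}"
      then have "(zs ! i) j \<in> homog (\<lambda>_. 1) 1"
        using subsetD[OF assms(1), of "zs ! i"] by (simp add: linear_vecs_def S_homogeneous_iff)
      then show "restr (\<lambda>_. 1) {1} (u i) * (zs ! i) j = restr (\<lambda>_. 1) {2} (u i * (zs ! i) j)"
        by (rule restr_mult_homog[symmetric]) auto
    qed simp
    also have "\<dots> = restr (\<lambda>_. 1) {2} (lincomb scale_vec zs u j)" by (simp add: lincomb_vec_apply restr_sum)
    finally show ?thesis by (simp add: u)
  qed
  then have "lincomb scale_vec zs (\<lambda>i. restr (\<lambda>_. 1) {1} (u i)) = 0" by (simp add: fun_eq_iff)
  moreover have "(\<lambda>i. restr (\<lambda>_. 1) {1} (u i)) \<in> vecs n (length zs)"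
    using u(1) by (simp add: vecs_iff polys_restr)
  ultimately show ?thesis by (simp add: syzygies_def)
qed

text \<open>Linear quotients pass to relations. \<open>F i\<close> consists of the relations supported on the first \<open>i\<close> coordinates; the
  generators of \<open>F (i + 1)\<close> are those of \<open>F i\<close>, followed by lifts \<open>z\<close> of linear forms \<open>l\<close> generating the ideal of
  \<open>i\<close>-th coordinates. Forms in the ideal of the earlier ones are skipped. For the others,
  a multiple of \<open>z\<close> is a combination of the earlier generators if and only if its coefficient lies in the ideal
  of the earlier forms, as this ideal is prime.\<close>
lemma linear_relation_module_generators:
  fixes Z :: "(nat \<Rightarrow> (nat, 'k::field) mpoly) set"
  assumes Z: "linear_relation_module n s Z"
  shows "\<exists>zs. set zs \<subseteq> linear_vecs n \<and> S_span n scale_vec (set zs) = Z \<and>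
              linear_relation_module n (length zs) (syzygies n scale_vec {0} zs)"
proof -
  have sub: "S_submodule n scale_vec Z" and Zv: "Z \<subseteq> vecs n s"
    and deg1: "\<And>u. u \<in> Z \<Longrightarrow> (\<lambda>i. restr (\<lambda>_. 1) {1} (u i)) \<in> Z"
    and ideal: "\<And>i. i < s \<Longrightarrow> \<exists>L. finite L \<and> L \<subseteq> S_homogeneous n 1 \<and> {u i | u. u \<in> Z \<and> (\<forall>j>i. u j = 0)} = S_ideal n L"
    using Z by (auto simp: linear_relation_module_def)
  define F where "F i = {u \<in> Z. \<forall>j\<ge>i. u j = 0}" for i
  have subF: "u \<in> F i \<Longrightarrow> v \<in> F i \<Longrightarrow> u - v \<in> F i" 
    "c \<in> polys {..<n} \<Longrightarrow> u \<in> F i \<Longrightarrow> scale_vec c u \<in> F i" "u \<in> F i \<Longrightarrow> v \<in> F i \<Longrightarrow> u + v \<in> F i" for u v i c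
    using sub vectors.S_submodule_diff[OF sub, of u v]
    by (simp_all add: F_def S_submodule_def scale_vec_def)
  define good where "good i L zs \<longleftrightarrow> set zs \<subseteq> linear_vecs n \<and> linear_quotients n scale_vec {0} zs \<and>
      S_span n scale_vec (set zs) = {u \<in> F (Suc i). u i \<in> S_ideal n L}" for i L zs
  have inner: "\<exists>zs. good i L' zs"
    if i: "i < s" and L: "finite L'" "L' \<subseteq> L" "L \<subseteq> S_homogeneous n 1" "{u i | u. u \<in> Z \<and> (\<forall>j>i. u j = 0)} = S_ideal n L"
      and base: "set zs0 \<subseteq> linear_vecs n" "linear_quotients n scale_vec {0} zs0" "S_span n scale_vec (set zs0) = F i"
    for i L' L zs0
    using L(1,2)
  proof (induction L')
    case empty
    have "{u \<in> F (Suc i). u i = 0} = F i" by (auto simp: F_def Suc_le_eq) (metis le_neq_implies_less)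
    then have "good i {} zs0" using base by (simp add: good_def)
    then show ?case by blast
  next
    case (insert l L')
    then obtain zs where zs: "good i L' zs" by auto
    have L': "finite L'" "L' \<subseteq> S_homogeneous n 1" using insert L by auto
    have l1: "l \<in> S_homogeneous n 1" using insert.prems L by auto
    then have lA: "l \<in> polys {..<n}" by (simp add: S_homogeneous_iff)
    show ?case
    proof (cases "l \<in> S_ideal n L'")
      case True
      then have "good i (insert l L') zs" using zs by (simp add: good_def ideals.Sp_insert_redundant)
      then show ?thesis by blast
    next
      case False
      have "l \<in> {u i | u. u \<in> Z \<and> (\<forall>j>i. u j = 0)}"
        unfolding L(4) using insert.prems by (intro ideals.Sp_base) auto
      then obtain u where u: "u \<in> Z" "\<forall>j>i. u j = 0" "u i = l" by auto
      define z where "z = (\<lambda>j. restr (\<lambda>_. 1) {1} (u j))"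
      have zZ: "z \<in> Z" using deg1[OF u(1)] by (simp add: z_def)
      have zi: "z i = l" using l1 u(3) restr_of_homog[of l "\<lambda>_. 1" 1 "{1}"] by (simp add: z_def S_homogeneous_iff)
      have zF: "z \<in> F (Suc i)" using zZ u(2) by (simp add: F_def z_def)
      have "u j \<in> polys {..<n}" for j using u(1) Zv vecs_nth by blast
      then have zlin: "z \<in> linear_vecs n"
        by (simp add: linear_vecs_def z_def S_homogeneous_iff polys_restr restr_homog)
      have zs_span: "S_span n scale_vec (set zs) = {u \<in> F (Suc i). u i \<in> S_ideal n L'}"
        using zs by (simp add: good_def)
      have "{c \<in> polys {..<n}. scale_vec c z \<in> S_span n scale_vec ({0} \<union> set zs)} = S_ideal n L'"
      proof -
        have "c \<in> S_ideal n L' \<longleftrightarrow> c * l \<in> S_ideal n L'" if c: "c \<in> polys {..<n}" for c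
        proof
          assume "c \<in> S_ideal n L'"
          then have "l * c \<in> S_ideal n L'" using lA by (intro ideals.Sp_act)
          then show "c * l \<in> S_ideal n L'" by (simp add: mult.commute)
        qed (use linear_ideal_prime[OF L' c lA] False in blast)
        moreover have "scale_vec c z \<in> S_span n scale_vec ({0} \<union> set zs) \<longleftrightarrow> c * l \<in> S_ideal n L'"
          if c: "c \<in> polys {..<n}" for c
          using subF(2)[OF c zF] by (simp add: zs_span scale_vec_def zi)
        moreover have "S_ideal n L' \<subseteq> polys {..<n}"
          using L' by (intro S_ideal_polys) (auto simp: S_homogeneous_iff)
        ultimately show ?thesis by blast
      qed
      then have "linear_quotients n scale_vec {0} (zs @ [z])"
        unfolding linear_quotients_append using zs L' by (auto simp: good_def)
      moreover have "S_span n scale_vec (set (zs @ [z])) = {u \<in> F (Suc i). u i \<in> S_ideal n (insert l L')}"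
      proof -
        have "v \<in> S_span n scale_vec (insert z (set zs)) \<longleftrightarrow> v \<in> F (Suc i) \<and> v i \<in> S_ideal n (insert l L')" for v
        proof -
          have "v \<in> S_span n scale_vec (insert z (set zs)) \<longleftrightarrow>
            (\<exists>c \<in> polys {..<n}. v - scale_vec c z \<in> F (Suc i) \<and> v i - c * l \<in> S_ideal n L')"
            unfolding vectors.Sp_insert zs_span by (simp add: scale_vec_def zi)
          also have "\<dots> \<longleftrightarrow> (\<exists>c \<in> polys {..<n}. v \<in> F (Suc i) \<and> v i - c * l \<in> S_ideal n L')"
          proof (rule bex_cong[OF refl])
            fix c :: "(nat, 'k) mpoly" assume "c \<in> polys {..<n}"
            then have "scale_vec c z \<in> F (Suc i)" using subF(2) zF by blast
            then have "v - scale_vec c z \<in> F (Suc i) \<longleftrightarrow> v \<in> F (Suc i)"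
              using subF(3)[of "v - scale_vec c z" "Suc i" "scale_vec c z"] subF(1)[of v "Suc i" "scale_vec c z"] by auto
            then show "(v - scale_vec c z \<in> F (Suc i) \<and> v i - c * l \<in> S_ideal n L') \<longleftrightarrow>
              (v \<in> F (Suc i) \<and> v i - c * l \<in> S_ideal n L')" by simp
          qed
          finally show ?thesis unfolding ideals.Sp_insert by blast
        qed
        then show ?thesis by auto
      qed
      ultimately have "good i (insert l L') (zs @ [z])"
        using zs zlin by (simp add: good_def)
      then show ?thesis by blast
    qed
  qed
  have outer: "\<exists>zs. set zs \<subseteq> linear_vecs n \<and> linear_quotients n scale_vec {0} zs \<and> S_span n scale_vec (set zs) = F i"
    if "i \<le> s" for i
    using that
  proof (induction i)
    case 0
    have "F 0 = {0}" using sub by (auto simp: F_def S_submodule_def fun_eq_iff)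
    then show ?case by (intro exI[of _ "[]"]) (simp add: linear_quotients_def)
  next
    case (Suc i)
    then have "i \<le> s" by simp
    from Suc.IH[OF this] obtain zs where zs: "set zs \<subseteq> linear_vecs n" "linear_quotients n scale_vec {0} zs" "S_span n scale_vec (set zs) = F i"
      by (elim exE conjE)
    obtain L where L: "finite L" "L \<subseteq> S_homogeneous n 1" "{u i | u. u \<in> Z \<and> (\<forall>j>i. u j = 0)} = S_ideal n L"
      using ideal[of i] Suc.prems by auto
    obtain ws where ws: "good i L ws"
      using inner[OF _ L(1) order_refl L(2,3) zs] Suc.prems by auto
    have "u i \<in> S_ideal n L" if "u \<in> F (Suc i)" for u
      using that unfolding L(3)[symmetric] by (auto simp: F_def)
    then have "{u \<in> F (Suc i). u i \<in> S_ideal n L} = F (Suc i)" by blast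
    then show ?case using ws unfolding good_def by (intro exI[of _ ws]) (simp only: simp_thms)
  qed
  obtain zs where zs: "set zs \<subseteq> linear_vecs n" "linear_quotients n scale_vec {0} zs" "S_span n scale_vec (set zs) = F s"
    using outer[OF order_refl] by (elim exE conjE)
  have "F s = Z" using Zv by (auto simp: F_def vecs_iff)
  moreover have "linear_relation_module n (length zs) (syzygies n scale_vec {0} zs)"
    by (rule vectors.linear_relation_moduleI)
       (use zs syzygies_linear_vecs_restr in \<open>auto simp: S_submodule_def scale_vec_def\<close>)
  ultimately show ?thesis using zs by blast
qed

lemma graded_hom_lincomb:
  fixes zs :: "(nat \<Rightarrow> (nat, 'k::field) mpoly) list"
  assumes zs: "set zs \<subseteq> linear_vecs n" "set zs \<subseteq> vecs n s"
  shows "graded_hom n (free_module n (length zs)) (shifted_grading n (length zs) (\<lambda>_. d + 1))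
           (free_module n s) (shifted_grading n s (\<lambda>_. d)) (lincomb scale_vec zs)"
  unfolding graded_hom_def
proof (intro conjI ballI allI)
  have vec: "lincomb scale_vec zs u \<in> vecs n s" if "u \<in> vecs n (length zs)" for u
    unfolding lincomb_def
  proof -
    have "(\<Sum>i\<in>I. scale_vec (u i) (zs ! i)) \<in> vecs n s" if "finite I" "I \<subseteq> {..<length zs}" for I
      using that
    proof (induction I)
      case (insert i I)
      then have "scale_vec (u i) (zs ! i) \<in> vecs n s"
        using zs(2) vecs_nth[OF \<open>u \<in> vecs n (length zs)\<close>] by (intro vecs_scale) auto
      then show ?case using insert by (simp add: vecs_add del: plus_fun_apply)
    qed (simp add: vecs_0)
    then show "(\<Sum>i<length zs. scale_vec (u i) (zs ! i)) \<in> vecs n s" by blast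
  qed
  then show "lincomb scale_vec zs \<in> vecs n (length zs) \<rightarrow> vecs n s" by blast
  show "lincomb scale_vec zs (u \<oplus>\<^bsub>free_module n (length zs)\<^esub> v) = lincomb scale_vec zs u \<oplus>\<^bsub>free_module n s\<^esub> lincomb scale_vec zs v" for u v
    using vectors.lincomb_add[of zs u v] by (simp add: free_module_def plus_fun_def)
  show "lincomb scale_vec zs (c \<odot>\<^bsub>free_module n (length zs)\<^esub> u) = c \<odot>\<^bsub>free_module n s\<^esub> lincomb scale_vec zs u" for c u
    using vectors.lincomb_scale[of zs c u] by (simp add: free_module_def scale_vec_def)
  show "lincomb scale_vec zs ` shifted_grading n (length zs) (\<lambda>_. d + 1) e \<subseteq> shifted_grading n s (\<lambda>_. d) e" for e
  proof
    fix w assume "w \<in> lincomb scale_vec zs ` shifted_grading n (length zs) (\<lambda>_. d + 1) e"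
    then obtain u where u: "u \<in> vecs n (length zs)" "\<forall>i<length zs. u i \<in> S_homogeneous n (e - (d + 1))" "w = lincomb scale_vec zs u"
      by (auto simp: shifted_grading_def)
    have "w j \<in> S_homogeneous n (e - d)" for j
    proof -
      have "u i * (zs ! i) j \<in> S_homogeneous n (e - d)" if "i < length zs" for i
        using S_homogeneous_mult[of "u i" n "e - (d + 1)" "(zs ! i) j" 1] u(2) that
          subsetD[OF zs(1) nth_mem[OF that]] by (simp add: linear_vecs_def)
      then show ?thesis unfolding u(3) lincomb_vec_apply
        by (auto simp: S_homogeneous_iff intro: polys_sum homog_sum)
    qed
    then show "w \<in> shifted_grading n s (\<lambda>_. d) e" using vec[OF u(1)] u(3) by (simp add: shifted_grading_def)
  qed
qed

text \<open>Each relation module provides the next matrix \<open>zs i\<close>, whose relations form the next relation module. The sequence may go on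
  forever by zero modules.\<close>
theorem linear_resolution_of_relation_module:
  fixes \<epsilon> :: "(nat \<Rightarrow> (nat, 'k::field) mpoly) \<Rightarrow> 'b"
  assumes Z: "linear_relation_module n s (a_kernel (free_module n s) N \<epsilon>)"
    and \<epsilon>: "graded_hom n (free_module n s) (shifted_grading n s (\<lambda>_. d)) N G \<epsilon>"
    and surj: "\<epsilon> ` vecs n s = carrier N"
  shows "has_linear_resolution n N G"
proof -
  let ?Z0 = "a_kernel (free_module n s) N \<epsilon>"
  define P where "P = (\<lambda>(r, Z :: (nat \<Rightarrow> (nat, 'k) mpoly) set, zs). linear_relation_module n r Z \<and>
      set zs \<subseteq> linear_vecs n \<and> S_span n scale_vec (set zs) = Z \<and>
      linear_relation_module n (length zs) (syzygies n scale_vec {0} zs))"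
  define Q where "Q = (\<lambda>(r :: nat, Z :: (nat \<Rightarrow> (nat, 'k) mpoly) set, zs :: (nat \<Rightarrow> (nat, 'k) mpoly) list)
      (r', Z' :: (nat \<Rightarrow> (nat, 'k) mpoly) set, zs' :: (nat \<Rightarrow> (nat, 'k) mpoly) list).
      r' = length zs \<and> Z' = syzygies n scale_vec {0} zs)"
  have "\<exists>f. \<forall>i. (P (f i) \<and> (i = 0 \<longrightarrow> fst (f i) = s \<and> fst (snd (f i)) = ?Z0)) \<and> Q (f i) (f (Suc i))"
  proof (rule dependent_nat_choice)
    obtain zs where "P (s, ?Z0, zs)"
      using linear_relation_module_generators[OF Z] Z by (auto simp: P_def)
    then show "\<exists>x. P x \<and> (0 = (0::nat) \<longrightarrow> fst x = s \<and> fst (snd x) = ?Z0)"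
      by (intro exI[of _ "(s, ?Z0, zs)"]) simp
  next
    fix x :: "nat \<times> (nat \<Rightarrow> (nat, 'k) mpoly) set \<times> (nat \<Rightarrow> (nat, 'k) mpoly) list" and i :: nat
    assume "P x \<and> (i = 0 \<longrightarrow> fst x = s \<and> fst (snd x) = ?Z0)"
    moreover obtain r Z zs where x: "x = (r, Z, zs)" by (cases x) auto
    ultimately have lrm: "linear_relation_module n (length zs) (syzygies n scale_vec {0} zs)" by (simp add: P_def)
    obtain ws where "P (length zs, syzygies n scale_vec {0} zs, ws)"
      using linear_relation_module_generators[OF lrm] lrm by (auto simp: P_def)
    then show "\<exists>y. (P y \<and> (Suc i = 0 \<longrightarrow> fst y = s \<and> fst (snd y) = ?Z0)) \<and> Q x y"
      by (intro exI[of _ "(length zs, syzygies n scale_vec {0} zs, ws)"]) (simp add: x Q_def)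
  qed
  then obtain f where f: "\<And>i. P (f i)" "fst (f 0) = s" "fst (snd (f 0)) = ?Z0" "\<And>i. Q (f i) (f (Suc i))"
    by blast
  define b where "b i = fst (f i)" for i
  define K where "K i = fst (snd (f i))" for i
  define zs where "zs i = snd (snd (f i))" for i
  have fi: "f i = (b i, K i, zs i)" for i by (simp add: b_def K_def zs_def)
  have b0: "b 0 = s" and K0: "K 0 = ?Z0" using f by (simp_all add: b_def K_def)
  have bS: "b (Suc i) = length (zs i)" and KS: "K (Suc i) = syzygies n scale_vec {0} (zs i)" for i
    using f(4)[of i] by (simp_all add: fi Q_def)
  have lin: "set (zs i) \<subseteq> linear_vecs n" and span: "S_span n scale_vec (set (zs i)) = K i"
    and lrm: "linear_relation_module n (b i) (K i)" for i
    using f(1)[of i] by (simp_all add: fi P_def)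
  have zsv: "set (zs i) \<subseteq> vecs n (b i)" for i
    using lrm[of i] span[of i] vectors.Sp_base[of _ "set (zs i)" n] by (auto simp: linear_relation_module_def)
  define \<phi> where "\<phi> i = lincomb scale_vec (zs i)" for i
  have image: "\<phi> i ` vecs n (b (Suc i)) = K i" for i
    using vectors.Sp_set_eq[of n "zs i"] by (simp add: \<phi>_def bS span)
  have kernel: "a_kernel (free_module n (b (Suc i))) (free_module n (b i)) (\<phi> i) = K (Suc i)" for i
    by (auto simp: a_kernel_def' KS syzygies_def \<phi>_def bS free_module_def zero_fun_def)
  have "graded_free_resolution n N G b (\<lambda>i j. d + int i) \<epsilon> \<phi>"
    unfolding graded_free_resolution_def Let_def
  proof (intro conjI allI)
    show "graded_hom n (free_module n (b 0)) (shifted_grading n (b 0) (\<lambda>j. d + int 0)) N G \<epsilon>"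
      using \<epsilon> by (simp add: b0)
    show "graded_hom n (free_module n (b (Suc i))) (shifted_grading n (b (Suc i)) (\<lambda>j. d + int (Suc i)))
            (free_module n (b i)) (shifted_grading n (b i) (\<lambda>j. d + int i)) (\<phi> i)" for i
      using graded_hom_lincomb[OF lin zsv, of i "d + int i"] by (simp add: \<phi>_def bS algebra_simps)
    show "\<epsilon> ` vecs n (b 0) = carrier N" using surj by (simp add: b0)
    show "\<phi> 0 ` vecs n (b 1) = a_kernel (free_module n (b 0)) N \<epsilon>" using image[of 0] by (simp add: b0 K0)
    show "\<phi> (Suc i) ` vecs n (b (Suc (Suc i))) = a_kernel (free_module n (b (Suc i))) (free_module n (b i)) (\<phi> i)" for i
      by (simp add: image kernel)
  qed
  moreover have "lookup (\<phi> i u j) 0 = 0" if u: "u \<in> vecs n (b (Suc i))" for i u j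
  proof -
    have "lookup (u l * (zs i ! l) j) 0 = 0" if "l < length (zs i)" for l
    proof -
      have lin1: "(zs i ! l) j \<in> homog (\<lambda>_. 1) 1"
        using subsetD[OF lin nth_mem[OF that]] by (simp add: linear_vecs_def S_homogeneous_iff)
      have "0 \<notin> keys (u l * (zs i ! l) j)"
      proof (intro notI)
        assume "0 \<in> keys (u l * (zs i ! l) j)"
        then obtain s t where st: "0 = s + t" "t \<in> keys ((zs i ! l) j)"
          using keys_mult[of "u l" "(zs i ! l) j"] by auto
        have "mdeg (s + t) = 0" using st(1) by (metis mdeg_0)
        then have "int (mdeg t) = 0" by (simp add: mdeg_add)
        moreover have "int (mdeg t) = 1" using lin1 st(2) by (simp add: homog_def int_mdeg)
        ultimately show False by simp
      qed
      then show ?thesis by (simp add: in_keys_iff)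
    qed
    then show ?thesis by (simp add: \<phi>_def lincomb_vec_apply lookup_sum)
  qed
  ultimately have "minimal_graded_free_resolution n N G b (\<lambda>i j. d + int i) \<epsilon> \<phi>"
    by (simp add: minimal_graded_free_resolution_def)
  then show ?thesis unfolding has_linear_resolution_def by blast
qed

section \<open>The parts of a monomial\<close>

lemma lookup_x_part: "lookup (x_part t) i = lookup t (Inl i)"
  by (simp add: x_part_def map_key.rep_eq)

lemma lookup_y_part: "lookup (y_part t) j = lookup t (Inr j)"
  by (simp add: y_part_def map_key.rep_eq)

lemma keys_x_part: "keys (x_part t) = Inl -` keys t"
  by (auto simp: in_keys_iff lookup_x_part)

lemma keys_y_part: "keys (y_part t) = Inr -` keys t"
  by (auto simp: in_keys_iff lookup_y_part)

lemma x_part_add: "x_part (s + t) = x_part s + x_part t" and y_part_add: "y_part (s + t) = y_part s + y_part t"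
  by (rule poly_mapping_eqI; simp add: lookup_x_part lookup_y_part lookup_add)+

lemma x_part_0 [simp]: "x_part 0 = 0" and y_part_0 [simp]: "y_part 0 = 0"
  by (rule poly_mapping_eqI; simp add: lookup_x_part lookup_y_part)+

lemma monomial_parts_eqI: "x_part s = x_part t \<Longrightarrow> y_part s = y_part t \<Longrightarrow> s = t"
  by (rule poly_mapping_eqI) (metis lookup_x_part lookup_y_part sum.exhaust)

lemma wdeg_parts: "wdeg (case_sum \<alpha> \<beta>) t = wdeg \<alpha> (x_part t) + wdeg \<beta> (y_part t)"
proof -
  have keys: "keys t = Inl ` keys (x_part t) \<union> Inr ` keys (y_part t)"
  proof (rule Set.set_eqI)
    fix v show "v \<in> keys t \<longleftrightarrow> v \<in> Inl ` keys (x_part t) \<union> Inr ` keys (y_part t)"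
      by (cases v) (auto simp: keys_x_part keys_y_part)
  qed
  show ?thesis
    unfolding wdeg_def keys
    by (subst sum.union_disjoint) (auto simp: sum.reindex lookup_x_part lookup_y_part)
qed

definition y_weight :: "'x + 'y \<Rightarrow> int" where
  "y_weight = case_sum (\<lambda>_. 0) (\<lambda>_. 1)"

lemma y_weight_simps [simp]: "y_weight (Inl i) = 0" "y_weight (Inr j) = 1"
  by (simp_all add: y_weight_def)

lemma wdeg_y_weight: "wdeg y_weight t = int (mdeg (y_part t))"
proof -
  have "wdeg (\<lambda>_. 0) s = 0" for s :: "'x monomial" by (simp add: wdeg_def)
  then show ?thesis by (simp add: y_weight_def wdeg_parts int_mdeg)
qed

section \<open>The module and its generators\<close>

abbreviation T_vars :: "nat \<Rightarrow> nat \<Rightarrow> (nat + nat) set" where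
  "T_vars n m \<equiv> {..<n} <+> {..<m}"

text \<open>Here \<open>'y\<close> stands for the indices of the \<open>y\<^sub>j\<close> as well as for the elements of \<open>M\<close>.\<close>
definition x_poly :: "(nat, 'k::field) mpoly \<Rightarrow> (nat + 'y, 'k) mpoly" where
  "x_poly s = rename_vars Inl s"

lemma x_poly_eq: "x_poly s = subst (\<lambda>i. var (Inl i)) s"
  by (simp add: x_poly_def rename_vars_eq_subst)

lemma x_poly_0 [simp]: "x_poly 0 = 0" and x_poly_1: "x_poly 1 = 1" and x_poly_add: "x_poly (p + q) = x_poly p + x_poly q"
  and x_poly_diff: "x_poly (p - q) = x_poly p - x_poly q"
  and x_poly_mult: "x_poly (p * q) = x_poly p * x_poly q"
  and x_poly_sum: "x_poly (sum r I) = (\<Sum>i\<in>I. x_poly (r i))"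
  by (simp_all add: x_poly_eq subst_add subst_mult subst_diff subst_sum)

lemma polys_x_poly: "p \<in> polys {..<n} \<Longrightarrow> x_poly p \<in> polys ({..<n} <+> Y)"
  unfolding x_poly_eq by (rule polys_subst) (auto intro: polys_var)

lemma homog_var: "\<omega> v = e \<Longrightarrow> var v \<in> homog \<omega> e"
  by (simp add: var_def mon_def homog_single)

lemma homog_x_poly:
  assumes "p \<in> S_homogeneous n d" "\<And>i. \<omega> (Inl i) = 1"
  shows "x_poly p \<in> homog \<omega> d"
  unfolding x_poly_eq
  by (rule homog_subst[where \<omega>' = "\<lambda>_. 1" and V = "{..<n}"]) (use assms in \<open>auto simp: S_homogeneous_iff intro: homog_var\<close>)

lemma homog_x_poly_0:
  assumes "p \<in> polys {..<n}" "\<And>i. \<omega> (Inl i) = 0"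
  shows "x_poly p \<in> homog \<omega> 0"
  unfolding x_poly_eq
proof (rule homog_subst[where \<omega>' = "\<lambda>_. 0" and V = "{..<n}"])
  show "p \<in> homog (\<lambda>_. 0) 0" by (simp add: homog_def wdeg_def)
qed (use assms in \<open>auto intro: homog_var\<close>)

definition linear_poly :: "nat \<Rightarrow> (nat \<Rightarrow> (nat, 'k::field) mpoly) \<Rightarrow> (nat + nat, 'k) mpoly" where
  "linear_poly m s = (\<Sum>j<m. x_poly (s j) * var (Inr j))"

lemma linear_poly_add: "linear_poly m (s + t) = linear_poly m s + linear_poly m t"
  by (simp add: linear_poly_def x_poly_add distrib_right sum.distrib)

lemma linear_poly_diff: "linear_poly m (s - t) = linear_poly m s - linear_poly m t"
  by (simp add: linear_poly_def x_poly_diff left_diff_distrib sum_subtractf fun_diff_def)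

lemma linear_poly_scale: "linear_poly m (scale_vec c s) = x_poly c * linear_poly m s"
  by (simp add: linear_poly_def x_poly_mult scale_vec_def sum_distrib_left mult.assoc)

lemma linear_poly_polys: "s \<in> vecs n m \<Longrightarrow> linear_poly m s \<in> polys (T_vars n m)"
  unfolding linear_poly_def
  by (intro polys_sum polys_mult polys_x_poly polys_var) (auto simp: vecs_iff)

lemma vecs_diff: "u \<in> vecs n s \<Longrightarrow> v \<in> vecs n s \<Longrightarrow> u - v \<in> vecs n s"
  by (auto simp: vecs_iff intro: polys_diff)

text \<open>The degree of a generator is chosen by a function on \<open>M\<close>, because the grading of the symmetric power
  assigns degrees to elements of \<open>M\<close> and not to indices.\<close>
locale graded_generators =
  fixes n m :: nat and M :: "((nat, 'k::field) mpoly, 'b) module" and G :: "int \<Rightarrow> 'b set"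
    and f :: "nat \<Rightarrow> 'b" and deg_of :: "'b \<Rightarrow> int"
  assumes graded: "graded_module n M G"
    and generators: "minimal_homogeneous_generators n M G m f"
    and deg_of: "\<And>j. j < m \<Longrightarrow> f j \<in> G (deg_of (f j))"
begin

sublocale Mod: module "S_ring n" M
  using graded by (simp add: graded_module_def)

definition gen_deg :: "nat \<Rightarrow> int" where "gen_deg j = deg_of (f j)"

lemma f_carrier: "j < m \<Longrightarrow> f j \<in> carrier M"
  using generators by (simp add: minimal_homogeneous_generators_def)

lemma G_subgroup: "subgroup (G d) (add_monoid M)"
  using graded by (simp add: graded_module_def)

lemma G_carrier: "z \<in> G d \<Longrightarrow> z \<in> carrier M"
  using subgroup.subset[OF G_subgroup] by auto

lemma G_zero: "\<zero>\<^bsub>M\<^esub> \<in> G d"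
  using subgroup.one_closed[OF G_subgroup] by simp

lemma G_add: "z \<in> G d \<Longrightarrow> w \<in> G d \<Longrightarrow> z \<oplus>\<^bsub>M\<^esub> w \<in> G d"
  using subgroup.m_closed[OF G_subgroup] by simp

lemma G_smult: "c \<in> S_homogeneous n i \<Longrightarrow> z \<in> G d \<Longrightarrow> c \<odot>\<^bsub>M\<^esub> z \<in> G (i + d)"
  using graded unfolding graded_module_def by blast

definition combination :: "(nat \<Rightarrow> (nat, 'k) mpoly) \<Rightarrow> 'b" where
  "combination s = finsum M (\<lambda>j. s j \<odot>\<^bsub>M\<^esub> f j) {..<m}"

lemma smult_f_carrier: "s \<in> vecs n m \<Longrightarrow> j < m \<Longrightarrow> s j \<odot>\<^bsub>M\<^esub> f j \<in> carrier M"
  by (simp add: vecs_iff f_carrier)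

lemma combination_carrier: "s \<in> vecs n m \<Longrightarrow> combination s \<in> carrier M"
  unfolding combination_def by (rule Mod.finsum_closed) (auto intro: smult_f_carrier)

lemma combination_add:
  assumes "s \<in> vecs n m" "t \<in> vecs n m"
  shows "combination (s + t) = combination s \<oplus>\<^bsub>M\<^esub> combination t"
proof -
  have "combination (s + t) = finsum M (\<lambda>j. s j \<odot>\<^bsub>M\<^esub> f j \<oplus>\<^bsub>M\<^esub> t j \<odot>\<^bsub>M\<^esub> f j) {..<m}"
    unfolding combination_def
    by (rule Mod.finsum_cong')
       (use assms in \<open>auto simp: vecs_iff f_carrier Mod.smult_l_distr[of "s j" "t j" "f j" for j, simplified]\<close>)
  also have "\<dots> = combination s \<oplus>\<^bsub>M\<^esub> combination t"
    unfolding combination_def by (rule Mod.finsum_addf) (use assms in \<open>auto intro: smult_f_carrier\<close>)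
  finally show ?thesis .
qed

lemma combination_scale:
  assumes "s \<in> vecs n m" "c \<in> polys {..<n}"
  shows "combination (scale_vec c s) = c \<odot>\<^bsub>M\<^esub> combination s"
proof -
  have "combination (scale_vec c s) = finsum M (\<lambda>j. c \<odot>\<^bsub>M\<^esub> (s j \<odot>\<^bsub>M\<^esub> f j)) {..<m}"
    unfolding combination_def
    by (rule Mod.finsum_cong')
       (use assms in \<open>auto simp: vecs_iff f_carrier scale_vec_def Mod.smult_assoc1[of c "s j" "f j" for j, simplified]\<close>)
  also have "\<dots> = c \<odot>\<^bsub>M\<^esub> combination s"
    unfolding combination_def
    by (rule Mod.finsum_smult_ldistr[symmetric]) (use assms in \<open>auto intro: smult_f_carrier\<close>)
  finally show ?thesis .
qed

lemma combination_0: "combination 0 = \<zero>\<^bsub>M\<^esub>"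
proof -
  have "scale_vec 0 0 = (0 :: nat \<Rightarrow> (nat, 'k) mpoly)" by (simp add: scale_vec_def fun_eq_iff)
  then show ?thesis
    using combination_scale[OF vecs_0 polys_0] combination_carrier[OF vecs_0] Mod.smult_l_null[of "combination 0"]
    by (simp only: poly_ring_ops)
qed

lemma combination_diff_eq_0:
  assumes "s \<in> vecs n m" "t \<in> vecs n m" "combination s = combination t"
  shows "combination (s - t) = \<zero>\<^bsub>M\<^esub>"
proof -
  have st: "s - t \<in> vecs n m" using assms vecs_diff by blast
  have "combination (s - t) \<oplus>\<^bsub>M\<^esub> combination t = combination t"
    using combination_add[OF st assms(2)] assms(3) by simp
  then show ?thesis
    using Mod.M.add.r_cancel_one'[of "combination t" "combination (s - t)"] combination_carrier st assms by simp
qed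

definition unit_vec :: "nat \<Rightarrow> nat \<Rightarrow> (nat, 'k) mpoly" where
  "unit_vec j = (\<lambda>i. if i = j then 1 else 0)"

lemma unit_vec_vecs: "j < m \<Longrightarrow> unit_vec j \<in> vecs n m"
  by (auto simp: vecs_iff unit_vec_def)

lemma combination_unit_vec:
  assumes "j < m" shows "combination (unit_vec j) = f j"
proof -
  have "combination (unit_vec j) = finsum M (\<lambda>i. if j = i then f i else \<zero>\<^bsub>M\<^esub>) {..<m}"
    unfolding combination_def
    by (rule Mod.finsum_cong') 
       (use assms Mod.smult_one Mod.smult_l_null in \<open>auto simp: unit_vec_def f_carrier\<close>)
  then show ?thesis using assms by (simp add: Mod.finsum_singleton f_carrier)
qed

lemma linear_poly_unit_vec: "j < m \<Longrightarrow> linear_poly m (unit_vec j) = var (Inr j)"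
proof -
  assume "j < m"
  have "linear_poly m (unit_vec j) = (\<Sum>i<m. if i = j then var (Inr i) else 0)"
    unfolding linear_poly_def by (rule sum.cong) (auto simp: unit_vec_def x_poly_1)
  then show ?thesis using \<open>j < m\<close> by simp
qed

lemma generated_submodule_combinations:
  assumes "z \<in> generated_submodule n M (f ` {..<m})"
  shows "\<exists>s \<in> vecs n m. z = combination s"
proof -
  let ?H = "combination ` vecs n m"
  have "submodule ?H (S_ring n) M"
  proof (rule Mod.submoduleI)
    show "\<zero>\<^bsub>M\<^esub> \<in> ?H" using combination_0 vecs_0 by (metis image_eqI)
    show "\<ominus>\<^bsub>M\<^esub> z \<in> ?H" if z: "z \<in> ?H" for z
    proof -
      obtain s where s: "s \<in> vecs n m" "z = combination s" using z by auto
      have "combination (scale_vec (- 1) s) = \<ominus>\<^bsub>M\<^esub> z"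
        using combination_scale[OF s(1), of "- 1"] Mod.smult_l_minus[of "1" z] combination_carrier[OF s(1)] s(2)
          Mod.smult_one[of z]
        by (simp add: polys_uminus a_inv_poly_ring)
      moreover have "scale_vec (- 1) s \<in> vecs n m" using s by (intro vecs_scale) (simp_all add: polys_uminus)
      ultimately show ?thesis by (metis image_eqI)
    qed
    show "z \<oplus>\<^bsub>M\<^esub> w \<in> ?H" if zw: "z \<in> ?H" "w \<in> ?H" for z w
    proof -
      obtain s t where "s \<in> vecs n m" "z = combination s" "t \<in> vecs n m" "w = combination t" using zw by auto
      then show ?thesis using combination_add[of s t] vecs_add[of s n m t] by (metis image_eqI)
    qed
    show "c \<odot>\<^bsub>M\<^esub> z \<in> ?H" if cz: "c \<in> polys {..<n}" "z \<in> ?H" for c z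
    proof -
      obtain s where "s \<in> vecs n m" "z = combination s" using cz by auto
      then show ?thesis using combination_scale[of s c] vecs_scale[of c n s m] cz(1) by (metis image_eqI)
    qed
  qed (auto intro: combination_carrier)
  moreover have "f ` {..<m} \<subseteq> ?H"
    using combination_unit_vec unit_vec_vecs by (metis image_eqI image_subsetI lessThan_iff)
  ultimately show ?thesis using assms by (auto simp: generated_submodule_def)
qed

lemma carrier_combinations: "z \<in> carrier M \<Longrightarrow> \<exists>s \<in> vecs n m. z = combination s"
  using generated_submodule_combinations generators by (simp add: minimal_homogeneous_generators_def)

section \<open>Homogeneous components of relations\<close>

definition component :: "(nat \<Rightarrow> (nat, 'k) mpoly) \<Rightarrow> int \<Rightarrow> nat \<Rightarrow> (nat, 'k) mpoly" where
  "component s d = (\<lambda>j. restr (\<lambda>_. 1) {d - gen_deg j} (s j))"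

lemma component_vecs: "s \<in> vecs n m \<Longrightarrow> component s d \<in> vecs n m"
  by (simp add: vecs_iff component_def polys_restr)

lemma component_homogeneous: "s \<in> vecs n m \<Longrightarrow> component s d j \<in> S_homogeneous n (d - gen_deg j)"
  using vecs_nth[of s n m j] by (simp add: component_def S_homogeneous_iff polys_restr restr_homog)

lemma combination_homogeneous:
  assumes "s \<in> vecs n m" "\<And>j. j < m \<Longrightarrow> s j \<in> S_homogeneous n (d - gen_deg j)"
  shows "combination s \<in> G d"
proof -
  have "finsum M (\<lambda>j. s j \<odot>\<^bsub>M\<^esub> f j) {..<k} \<in> G d" if "k \<le> m" for k
    using that
  proof (induction k)
    case 0
    then show ?case by (simp add: Mod.finsum_empty G_zero)
  next
    case (Suc k)
    have "s k \<odot>\<^bsub>M\<^esub> f k \<in> G ((d - gen_deg k) + gen_deg k)"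
      using assms(2)[of k] deg_of[of k] Suc.prems unfolding gen_deg_def by (intro G_smult) auto
    then have "s k \<odot>\<^bsub>M\<^esub> f k \<in> G d" by simp
    moreover have "finsum M (\<lambda>j. s j \<odot>\<^bsub>M\<^esub> f j) {..<Suc k} = s k \<odot>\<^bsub>M\<^esub> f k \<oplus>\<^bsub>M\<^esub> finsum M (\<lambda>j. s j \<odot>\<^bsub>M\<^esub> f j) {..<k}"
      unfolding lessThan_Suc by (rule Mod.finsum_insert) (use assms Suc.prems in \<open>auto intro!: smult_f_carrier\<close>)
    ultimately show ?case using Suc G_add by simp
  qed
  then show ?thesis unfolding combination_def by blast
qed

lemma finite_component_degrees:
  "\<exists>D. finite D \<and> (\<forall>j<m. \<forall>t \<in> keys (s j). wdeg (\<lambda>_. 1) t + gen_deg j \<in> D)"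
  by (rule exI[of _ "\<Union>j<m. (\<lambda>t. wdeg (\<lambda>_. 1) t + gen_deg j) ` keys (s j)"]) auto

lemma sum_components:
  assumes s: "s \<in> vecs n m" and D: "finite D" "\<And>j t. j < m \<Longrightarrow> t \<in> keys (s j) \<Longrightarrow> wdeg (\<lambda>_. 1) t + gen_deg j \<in> D"
  shows "(\<Sum>d\<in>D. component s d j) = s j"
proof (cases "j < m")
  case True
  show ?thesis
  proof (rule poly_mapping_eqI)
    fix t
    have "lookup (\<Sum>d\<in>D. component s d j) t = 
        (\<Sum>d\<in>D. if wdeg (\<lambda>_. 1) t + gen_deg j = d then lookup (s j) t else 0)"
      unfolding lookup_sum by (rule sum.cong) (auto simp: component_def lookup_restr)
    also have "\<dots> = lookup (s j) t"
      using D(1) D(2)[OF True, of t] by (auto simp: sum.delta' in_keys_iff)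
    finally show "lookup (\<Sum>d\<in>D. component s d j) t = lookup (s j) t" .
  qed
next
  case False
  then have "s j = 0" "component s d j = 0" for d using s by (simp_all add: vecs_iff component_def)
  then show ?thesis by simp
qed

lemma component_eq_0:
  assumes "s \<in> vecs n m" "\<And>j t. j < m \<Longrightarrow> t \<in> keys (s j) \<Longrightarrow> wdeg (\<lambda>_. 1) t + gen_deg j \<in> D" "d \<notin> D"
  shows "component s d = 0"
proof -
  have "component s d j = 0" for j
  proof (cases "j < m")
    case True
    then show ?thesis unfolding component_def using assms(2)[OF True] assms(3)
      by (intro restr_eq_0) force
  next
    case False
    then show ?thesis using assms(1) by (simp add: vecs_iff component_def)
  qed
  then show ?thesis by (simp add: fun_eq_iff)
qed

text \<open>Uniqueness of the decomposition into homogeneous components, applied to the family of the combinations of \<open>component s d\<close>. For the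
  combination zero it says that the homogeneous components of a relation are relations.\<close>
lemma combination_component:
  assumes s: "s \<in> vecs n m" and z: "combination s \<in> G e"
  shows "combination (component s d) = (if d = e then combination s else \<zero>\<^bsub>M\<^esub>)"
proof -
  let ?z = "combination s"
  define c where "c d = combination (component s d)" for d
  define c' where "c' d = (if d = e then ?z else \<zero>\<^bsub>M\<^esub>)" for d
  obtain D where D: "finite D" "\<And>j t. j < m \<Longrightarrow> t \<in> keys (s j) \<Longrightarrow> wdeg (\<lambda>_. 1) t + gen_deg j \<in> D"
    using finite_component_degrees[of s] by blast
  have cc: "c d \<in> carrier M" for d unfolding c_def by (rule combination_carrier) (rule component_vecs[OF s])
  have c0: "c d = \<zero>\<^bsub>M\<^esub>" if "d \<notin> D" for d
    using component_eq_0[OF s D(2) that] by (simp add: c_def combination_0)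
  have supp: "{d. c d \<noteq> \<zero>\<^bsub>M\<^esub>} \<subseteq> D" using c0 by auto
  have part: "finsum M c E = combination (\<lambda>j. \<Sum>d\<in>E. component s d j) \<and> (\<lambda>j. \<Sum>d\<in>E. component s d j) \<in> vecs n m"
    if "finite E" for E
    using that
  proof (induction E)
    case empty
    then show ?case using combination_0 vecs_0[of n m] by (simp add: Mod.finsum_empty zero_fun_def)
  next
    case (insert e E)
    have eq: "(\<lambda>j. \<Sum>d\<in>insert e E. component s d j) = component s e + (\<lambda>j. \<Sum>d\<in>E. component s d j)"
      using insert by (simp add: fun_eq_iff)
    have "finsum M c (insert e E) = c e \<oplus>\<^bsub>M\<^esub> finsum M c E"
      using insert cc by (intro Mod.finsum_insert) auto
    moreover have "component s e \<in> vecs n m" by (rule component_vecs[OF s])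
    ultimately show ?case unfolding eq using insert combination_add vecs_add by (metis c_def)
  qed
  have "finsum M c {d. c d \<noteq> \<zero>\<^bsub>M\<^esub>} = finsum M c D"
    by (rule Mod.add.finprod_mono_neutral_cong_left) (use D supp cc in auto)
  also have "\<dots> = combination s"
    using part[OF D(1)] sum_components[OF s D] by simp
  finally have sum_c: "?z = finsum M c {d. c d \<noteq> \<zero>\<^bsub>M\<^esub>}" ..
  have "c d \<in> G d" for d
    unfolding c_def using component_vecs[OF s] component_homogeneous[OF s] by (rule combination_homogeneous)
  then have P: "(\<forall>d. c d \<in> G d) \<and> finite {d. c d \<noteq> \<zero>\<^bsub>M\<^esub>} \<and> ?z = finsum M c {d. c d \<noteq> \<zero>\<^bsub>M\<^esub>}"
    using sum_c finite_subset[OF supp D(1)] by blast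
  have zc: "?z \<in> carrier M" by (rule combination_carrier[OF s])
  have supp': "{d. c' d \<noteq> \<zero>\<^bsub>M\<^esub>} \<subseteq> {e}" by (auto simp: c'_def)
  have "finsum M c' {d. c' d \<noteq> \<zero>\<^bsub>M\<^esub>} = finsum M c' {e}"
    by (rule Mod.add.finprod_mono_neutral_cong_left) (use supp' zc in \<open>auto simp: c'_def\<close>)
  also have "\<dots> = ?z" using zc by (subst Mod.finsum_insert) (simp_all add: c'_def Mod.finsum_empty)
  finally have P': "(\<forall>d. c' d \<in> G d) \<and> finite {d. c' d \<noteq> \<zero>\<^bsub>M\<^esub>} \<and> ?z = finsum M c' {d. c' d \<noteq> \<zero>\<^bsub>M\<^esub>}"
    using z G_zero finite_subset[OF supp'] by (simp add: c'_def)
  have "\<exists>!c. (\<forall>d. c d \<in> G d) \<and> finite {d. c d \<noteq> \<zero>\<^bsub>M\<^esub>} \<and> ?z = finsum M c {d. c d \<noteq> \<zero>\<^bsub>M\<^esub>}"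
    using graded zc unfolding graded_module_def by blast
  then have "c = c'" using P P' by blast
  then show ?thesis by (metis c'_def c_def)
qed

text \<open>A nonzero constant term of \<open>s\<^sub>i\<close> forces the homogeneous \<open>s\<^sub>i\<close> to be a unit, and then \<open>f\<^sub>i\<close> is a combination of the other generators.\<close>
lemma homogeneous_relation_coefficient:
  assumes s: "s \<in> vecs n m" and hom: "\<And>j. j < m \<Longrightarrow> s j \<in> S_homogeneous n (d - gen_deg j)"
    and zero: "combination s = \<zero>\<^bsub>M\<^esub>" and i: "i < m"
  shows "lookup (s i) 0 = 0"
proof (rule ccontr)
  let ?a = "lookup (s i) 0"
  assume a: "?a \<noteq> 0"
  then have "0 \<in> keys (s i)" by (simp add: in_keys_iff)
  then have d: "d - gen_deg i = 0" using hom[OF i] by (auto simp: S_homogeneous_iff homog_def)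
  have si: "s i = single 0 ?a"
  proof (rule poly_mapping_eqI)
    fix t
    have "t \<notin> keys (s i)" if "t \<noteq> 0"
      using hom[OF i] that mdeg_eq_0_iff[of t] unfolding d by (auto simp: S_homogeneous_def)
    then show "lookup (s i) t = lookup (single 0 ?a) t"
      by (cases "t = 0") (auto simp: in_keys_iff lookup_single)
  qed
  let ?B = "{..<m} - {i}"
  have fi: "f i \<in> H" if H: "submodule H (S_ring n) M" "f ` ?B \<subseteq> H" for H
  proof -
    note HE = Mod.submoduleE[OF H(1)]
    have H0: "\<zero>\<^bsub>M\<^esub> \<in> H" using HE(2,4) Mod.smult_l_null HE(1) by (metis ex_in_conv polys_0 subsetD poly_ring_ops(3))
    have rest: "finsum M (\<lambda>j. s j \<odot>\<^bsub>M\<^esub> f j) B \<in> H" if "finite B" "B \<subseteq> ?B" for B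
      using that
    proof (induction B)
      case (insert j B)
      have "s j \<odot>\<^bsub>M\<^esub> f j \<in> H" using HE(4) H(2) insert.prems s by (auto simp: vecs_iff)
      moreover have "finsum M (\<lambda>j. s j \<odot>\<^bsub>M\<^esub> f j) (insert j B) = s j \<odot>\<^bsub>M\<^esub> f j \<oplus>\<^bsub>M\<^esub> finsum M (\<lambda>j. s j \<odot>\<^bsub>M\<^esub> f j) B"
        using insert s by (intro Mod.finsum_insert) (auto intro!: smult_f_carrier)
      ultimately show ?case using insert HE(5) by simp
    qed (simp add: H0 Mod.finsum_empty)
    let ?r = "finsum M (\<lambda>j. s j \<odot>\<^bsub>M\<^esub> f j) ?B"
    have rH: "?r \<in> H" using rest[of ?B] by simp
    have rc: "?r \<in> carrier M" using rH HE(1) by blast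
    have sc: "s i \<odot>\<^bsub>M\<^esub> f i \<in> carrier M" using smult_f_carrier[OF s i] .
    have "insert i ?B = {..<m}" using i by auto
    then have "combination s = finsum M (\<lambda>j. s j \<odot>\<^bsub>M\<^esub> f j) (insert i ?B)" by (simp add: combination_def)
    also have "\<dots> = s i \<odot>\<^bsub>M\<^esub> f i \<oplus>\<^bsub>M\<^esub> ?r"
      using s i by (intro Mod.finsum_insert) (auto intro!: smult_f_carrier)
    finally have "s i \<odot>\<^bsub>M\<^esub> f i \<oplus>\<^bsub>M\<^esub> ?r = \<zero>\<^bsub>M\<^esub>" using zero by simp
    then have "s i \<odot>\<^bsub>M\<^esub> f i = \<ominus>\<^bsub>M\<^esub> ?r" using Mod.M.minus_equality[of "s i \<odot>\<^bsub>M\<^esub> f i" ?r] rc sc by simp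
    then have "s i \<odot>\<^bsub>M\<^esub> f i \<in> H" using HE(3)[OF rH] by simp
    then have "single 0 (1 / ?a) \<odot>\<^bsub>M\<^esub> (s i \<odot>\<^bsub>M\<^esub> f i) \<in> H"
      using HE(4) by (simp add: polys_single)
    moreover have "single 0 (1 / ?a) \<odot>\<^bsub>M\<^esub> (s i \<odot>\<^bsub>M\<^esub> f i) = (single 0 (1 / ?a) * s i) \<odot>\<^bsub>M\<^esub> f i"
      using Mod.smult_assoc1[of "single 0 (1 / ?a)" "s i" "f i"] f_carrier[OF i] vecs_nth[OF s]
      by (simp add: polys_single)
    moreover have "single 0 (1 / ?a) * s i = 1"
      by (subst si) (use a in \<open>simp add: mult_single\<close>)
    ultimately show ?thesis using Mod.smult_one[OF f_carrier[OF i]] by simp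
  qed
  have "f ` {..<m} \<subseteq> H" if H: "submodule H (S_ring n) M" "f ` ?B \<subseteq> H" for H
    using fi[OF H] H(2) by (auto simp: image_subset_iff)
  then have "generated_submodule n M (f ` {..<m}) \<subseteq> generated_submodule n M (f ` ?B)"
    unfolding generated_submodule_def by blast
  moreover have "generated_submodule n M (f ` ?B) \<subseteq> carrier M"
  proof -
    have "f ` ?B \<subseteq> carrier M" using f_carrier by auto
    then show ?thesis unfolding generated_submodule_def using Mod.carrier_is_submodule by blast
  qed
  ultimately have "generated_submodule n M (f ` ?B) = carrier M"
    using generators by (simp add: minimal_homogeneous_generators_def)
  moreover have "?B \<subset> {..<m}" using i by auto
  ultimately show False using generators unfolding minimal_homogeneous_generators_def by blast
qed

end

section \<open>The presentation ideal\<close>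

context graded_generators
begin

abbreviation W where "W \<equiv> {..<n} <+> carrier M"
abbreviation I where "I \<equiv> sym_relations n M"

definition sym_generators :: "(nat + 'b, 'k) mpoly set" where
  "sym_generators =
     {var (Inr (z \<oplus>\<^bsub>M\<^esub> w)) - var (Inr z) - var (Inr w) | z w. z \<in> carrier M \<and> w \<in> carrier M} \<union>
     {var (Inr (s \<odot>\<^bsub>M\<^esub> z)) - x_poly s * var (Inr z) | s z. s \<in> polys {..<n} \<and> z \<in> carrier M}"

lemma I_eq: "I = Idl\<^bsub>poly_ring W\<^esub> sym_generators"
  by (simp add: sym_relations_def sym_generators_def sym_cover_def x_poly_def)

lemma sym_generators_polys: "sym_generators \<subseteq> polys W"
proof -
  have "var (Inr z) \<in> polys W" if "z \<in> carrier M" for z :: 'b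
    using that by (intro polys_var) auto
  then show ?thesis
    unfolding sym_generators_def by (auto intro!: polys_diff polys_mult polys_x_poly)
qed

lemma I_ideal: "ideal I (poly_ring W)"
proof -
  interpret C: cring "poly_ring W :: (nat + 'b, 'k) mpoly ring" by (rule cring_poly_ring)
  show ?thesis unfolding I_eq by (rule C.genideal_ideal) (rule sym_generators_polys)
qed

lemma I_polys: "p \<in> I \<Longrightarrow> p \<in> polys W"
  using ideal.Icarr[OF I_ideal] .

lemma I_zero: "0 \<in> I"
  using additive_subgroup.zero_closed[OF ideal.axioms(1)[OF I_ideal]] by simp

lemma I_add: "p \<in> I \<Longrightarrow> q \<in> I \<Longrightarrow> p + q \<in> I"
  using additive_subgroup.a_closed[OF ideal.axioms(1)[OF I_ideal]] by simp

lemma I_mult: "c \<in> polys W \<Longrightarrow> p \<in> I \<Longrightarrow> c * p \<in> I"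
  using ideal.I_l_closed[OF I_ideal] by simp

lemma I_uminus: "p \<in> I \<Longrightarrow> - p \<in> I"
  using I_mult[of "- 1" p] by (simp add: polys_uminus)

lemma I_diff: "p \<in> I \<Longrightarrow> q \<in> I \<Longrightarrow> p - q \<in> I"
  using I_add[of p "- q"] I_uminus by simp

lemma I_generators: "sym_generators \<subseteq> I"
proof -
  interpret C: cring "poly_ring W :: (nat + 'b, 'k) mpoly ring" by (rule cring_poly_ring)
  show ?thesis unfolding I_eq by (rule C.genideal_self) (rule sym_generators_polys)
qed

lemma I_least:
  assumes "K \<subseteq> polys W" "0 \<in> K" "\<And>p q. p \<in> K \<Longrightarrow> q \<in> K \<Longrightarrow> p + q \<in> K"
    "\<And>c p. c \<in> polys W \<Longrightarrow> p \<in> K \<Longrightarrow> c * p \<in> K" "sym_generators \<subseteq> K"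
  shows "I \<subseteq> K"
proof -
  interpret C: cring "poly_ring W :: (nat + 'b, 'k) mpoly ring" by (rule cring_poly_ring)
  have "ideal K (poly_ring W)"
  proof (rule idealI)
    show "ring (poly_ring W :: (nat + 'b, 'k) mpoly ring)" by (rule C.ring_axioms)
    show "subgroup K (add_monoid (poly_ring W))"
    proof (rule C.add.subgroupI)
      fix p assume p: "p \<in> K"
      then have "(- 1) * p \<in> K" by (intro assms(4)) (simp_all add: polys_uminus)
      then show "\<ominus>\<^bsub>poly_ring W\<^esub> p \<in> K" using p assms(1) by (simp add: a_inv_poly_ring subset_iff)
    qed (use assms in auto)
  next
    fix a x :: "(nat + 'b, 'k) mpoly" assume "a \<in> K" "x \<in> polys W"
    then have "x * a \<in> K" by (intro assms(4))
    then show "x \<otimes>\<^bsub>poly_ring W\<^esub> a \<in> K" "a \<otimes>\<^bsub>poly_ring W\<^esub> x \<in> K" by (simp_all add: mult.commute)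
  qed
  then show ?thesis unfolding I_eq by (rule C.genideal_minimal) (rule assms)
qed

abbreviation cls where "cls \<equiv> sym_class n M"

lemma cls_eq: "cls p = I +>\<^bsub>poly_ring W\<^esub> p"
  by (simp add: sym_class_def sym_cover_def)

lemma cls_eq_iff: "p \<in> polys W \<Longrightarrow> q \<in> polys W \<Longrightarrow> cls p = cls q \<longleftrightarrow> p - q \<in> I"
proof -
  interpret C: cring "poly_ring W :: (nat + 'b, 'k) mpoly ring" by (rule cring_poly_ring)
  assume "p \<in> polys W" "q \<in> polys W"
  then show ?thesis
    using C.quotient_eq_iff_same_a_r_cos[OF I_ideal, of p q] by (simp add: cls_eq a_minus_poly_ring)
qed

lemma sym_algebra_ops:
  "\<zero>\<^bsub>sym_algebra n M\<^esub> = I"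
  "a \<oplus>\<^bsub>sym_algebra n M\<^esub> b = a <+>\<^bsub>poly_ring W\<^esub> b"
  "s \<odot>\<^bsub>sym_algebra n M\<^esub> b = rcoset_mult (poly_ring W) I (cls (x_poly s)) b"
  by (simp_all add: sym_algebra_def Let_def ring.defs module.defs FactRing_def sym_cover_def x_poly_def)

lemma cls_zero: "cls 0 = I"
proof -
  interpret C: cring "poly_ring W :: (nat + 'b, 'k) mpoly ring" by (rule cring_poly_ring)
  show ?thesis unfolding cls_eq using C.a_coset_add_zero[of I] I_polys by (simp add: subsetI)
qed

lemma cls_add: "p \<in> polys W \<Longrightarrow> q \<in> polys W \<Longrightarrow> cls p \<oplus>\<^bsub>sym_algebra n M\<^esub> cls q = cls (p + q)"
  using ideal.a_rcos_sum[OF I_ideal, of p q] by (simp add: sym_algebra_ops cls_eq)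

lemma cls_smult: "s \<in> polys {..<n} \<Longrightarrow> p \<in> polys W \<Longrightarrow> s \<odot>\<^bsub>sym_algebra n M\<^esub> cls p = cls (x_poly s * p)"
  using ideal.rcoset_mult_add[OF I_ideal, of "x_poly s" p] by (simp add: sym_algebra_ops cls_eq polys_x_poly)

text \<open>The map \<open>T \<rightarrow> S[Y\<^sub>z | z \<in> M]\<close> with \<open>y\<^sub>j \<mapsto> Y\<close> indexed by \<open>f\<^sub>j\<close>, which induces the presentation of the symmetric algebra.\<close>
definition rho :: "(nat + nat, 'k) mpoly \<Rightarrow> (nat + 'b, 'k) mpoly" where
  "rho = subst (\<lambda>v. var (map_sum id f v))"

abbreviation V where "V \<equiv> T_vars n m"
abbreviation J where "J \<equiv> presentation_ideal n M m f"
abbreviation pres where "pres \<equiv> sym_presentation n M f"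

lemma pres_eq: "pres p = cls (rho p)"
  by (simp add: sym_presentation_def rho_def rename_vars_eq_subst)

lemma rho_polys: "p \<in> polys V \<Longrightarrow> rho p \<in> polys W"
  unfolding rho_def by (rule polys_subst) (auto intro!: polys_var f_carrier)

lemma rho_x_poly: "rho (x_poly s) = x_poly s"
  by (simp add: rho_def x_poly_eq subst_subst)

lemma J_iff: "p \<in> J \<longleftrightarrow> p \<in> polys V \<and> rho p \<in> I"
proof -
  have "pres p = I \<longleftrightarrow> rho p \<in> I" if "p \<in> polys V"
    using cls_eq_iff[OF rho_polys[OF that] polys_0] by (simp add: pres_eq cls_zero)
  then show ?thesis by (auto simp: presentation_ideal_def a_kernel_def' sym_algebra_ops)
qed

lemma J_zero: "0 \<in> J"
  by (simp add: J_iff rho_def I_zero)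

lemma J_add: "p \<in> J \<Longrightarrow> q \<in> J \<Longrightarrow> p + q \<in> J"
  by (simp add: J_iff rho_def subst_add polys_add I_add)

lemma J_mult: "c \<in> polys V \<Longrightarrow> p \<in> J \<Longrightarrow> c * p \<in> J"
  using rho_polys[of c] by (simp add: J_iff rho_def subst_mult polys_mult I_mult)

lemma pres_add: "p \<in> polys V \<Longrightarrow> q \<in> polys V \<Longrightarrow> pres (p + q) = pres p \<oplus>\<^bsub>sym_algebra n M\<^esub> pres q"
  by (simp add: pres_eq cls_add rho_polys) (simp add: rho_def subst_add)

lemma pres_smult: "s \<in> polys {..<n} \<Longrightarrow> p \<in> polys V \<Longrightarrow> pres (x_poly s * p) = s \<odot>\<^bsub>sym_algebra n M\<^esub> pres p"
  by (simp add: pres_eq cls_smult rho_polys) (simp add: rho_def subst_mult rho_x_poly[unfolded rho_def])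

lemma pres_eq_iff: "p \<in> polys V \<Longrightarrow> q \<in> polys V \<Longrightarrow> pres p = pres q \<longleftrightarrow> p - q \<in> J"
  by (simp add: pres_eq cls_eq_iff rho_polys J_iff polys_diff) (simp add: rho_def subst_diff)

lemma I_sum_relation: "z \<in> carrier M \<Longrightarrow> w \<in> carrier M \<Longrightarrow> var (Inr (z \<oplus>\<^bsub>M\<^esub> w)) - var (Inr z) - var (Inr w) \<in> I"
  using I_generators unfolding sym_generators_def by blast

lemma I_smult_relation: "s \<in> polys {..<n} \<Longrightarrow> z \<in> carrier M \<Longrightarrow> var (Inr (s \<odot>\<^bsub>M\<^esub> z)) - x_poly s * var (Inr z) \<in> I"
  using I_generators unfolding sym_generators_def by blast

lemma var_zero: "var (Inr \<zero>\<^bsub>M\<^esub>) \<in> I"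
proof -
  have "var (Inr \<zero>\<^bsub>M\<^esub>) - var (Inr \<zero>\<^bsub>M\<^esub>) - var (Inr \<zero>\<^bsub>M\<^esub>) \<in> I"
    using I_sum_relation[of "\<zero>\<^bsub>M\<^esub>" "\<zero>\<^bsub>M\<^esub>"] by simp
  from I_uminus[OF this] show ?thesis by simp
qed

text \<open>The defining relations make \<open>z \<mapsto> Y\<^sub>z\<close> linear over \<open>S\<close>.\<close>
lemma var_combination:
  assumes s: "s \<in> vecs n m"
  shows "var (Inr (combination s)) - rho (linear_poly m s) \<in> I"
proof -
  have rho: "rho (linear_poly m s) = (\<Sum>j<m. x_poly (s j) * var (Inr (f j)))"
    by (simp add: linear_poly_def rho_def subst_sum subst_mult rho_x_poly[unfolded rho_def])
  have "var (Inr (finsum M (\<lambda>j. s j \<odot>\<^bsub>M\<^esub> f j) {..<k})) - (\<Sum>j<k. x_poly (s j) * var (Inr (f j))) \<in> I" if "k \<le> m" for k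
    using that
  proof (induction k)
    case 0
    show ?case by (simp add: Mod.finsum_empty var_zero)
  next
    case (Suc k)
    let ?z = "finsum M (\<lambda>j. s j \<odot>\<^bsub>M\<^esub> f j) {..<k}"
    let ?w = "s k \<odot>\<^bsub>M\<^esub> f k"
    have z: "?z \<in> carrier M" by (rule Mod.finsum_closed) (use Suc.prems s in \<open>auto intro!: smult_f_carrier\<close>)
    have w: "?w \<in> carrier M" using Suc.prems s by (intro smult_f_carrier) auto
    have "finsum M (\<lambda>j. s j \<odot>\<^bsub>M\<^esub> f j) {..<Suc k} = ?w \<oplus>\<^bsub>M\<^esub> ?z"
      unfolding lessThan_Suc by (rule Mod.finsum_insert) (use s Suc.prems in \<open>auto intro!: smult_f_carrier\<close>)
    then have eq: "var (Inr (finsum M (\<lambda>j. s j \<odot>\<^bsub>M\<^esub> f j) {..<Suc k})) - (\<Sum>j<Suc k. x_poly (s j) * var (Inr (f j))) =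
       (var (Inr (?w \<oplus>\<^bsub>M\<^esub> ?z)) - var (Inr ?w) - var (Inr ?z)) + (var (Inr ?w) - x_poly (s k) * var (Inr (f k))) +
       (var (Inr ?z) - (\<Sum>j<k. x_poly (s j) * var (Inr (f j))))"
      by simp
    have "var (Inr ?w) - x_poly (s k) * var (Inr (f k)) \<in> I"
      using Suc.prems by (intro I_smult_relation vecs_nth[OF s] f_carrier) auto
    moreover have "var (Inr ?z) - (\<Sum>j<k. x_poly (s j) * var (Inr (f j))) \<in> I" using Suc by simp
    ultimately show ?case unfolding eq by (intro I_add I_sum_relation[OF w z])
  qed
  then show ?thesis unfolding rho combination_def by blast
qed

section \<open>Generation by linear relations\<close>

text \<open>The ideal generated by the homogeneous linear relations. Coefficients are restricted to terms so that each summand is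
  homogeneous.\<close>
inductive_set relation_span :: "(nat + nat, 'k) mpoly set" where
  relation_span_0: "0 \<in> relation_span"
| relation_span_step: "p \<in> relation_span \<Longrightarrow> keys t \<subseteq> V \<Longrightarrow> s \<in> vecs n m \<Longrightarrow>
     (\<And>j. j < m \<Longrightarrow> s j \<in> S_homogeneous n (d - gen_deg j)) \<Longrightarrow> combination s = \<zero>\<^bsub>M\<^esub> \<Longrightarrow>
     p + single t c * linear_poly m s \<in> relation_span"

lemma relation_span_add: 
  assumes "p \<in> relation_span" "q \<in> relation_span" shows "p + q \<in> relation_span"
  using assms(2)
proof induction
  case (relation_span_step q t s d c)
  then have "(p + q) + single t c * linear_poly m s \<in> relation_span"
    by (intro relation_span.relation_span_step)
  then show ?case by (simp add: add.assoc)
qed (use assms in simp)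

lemma relation_span_mult:
  assumes "q \<in> polys V" "p \<in> relation_span" shows "q * p \<in> relation_span"
  using assms(2)
proof induction
  case (relation_span_step p t s d c)
  have "q * (single t c * linear_poly m s) \<in> relation_span"
  proof (rule mpoly_keys_induct[of _ q])
    fix u a assume "u \<in> keys q"
    then have "keys (u + t) \<subseteq> V"
      using assms(1) relation_span_step by (auto simp: polys_iff keys_plus_monomial)
    then have "0 + single (u + t) (a * c) * linear_poly m s \<in> relation_span"
      using relation_span_step by (intro relation_span.relation_span_step relation_span_0)
    then show "single u a * (single t c * linear_poly m s) \<in> relation_span"
      by (simp add: mult_single mult.assoc[symmetric])
  qed (auto simp: relation_span_0 distrib_right intro: relation_span_add)
  then show ?case using relation_span_step.IH by (simp add: distrib_left relation_span_add)
qed (simp add: relation_span_0)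

lemma relation_in_span:
  assumes s: "s \<in> vecs n m" and zero: "combination s = \<zero>\<^bsub>M\<^esub>"
  shows "linear_poly m s \<in> relation_span"
proof -
  obtain D where D: "finite D" "\<And>j t. j < m \<Longrightarrow> t \<in> keys (s j) \<Longrightarrow> wdeg (\<lambda>_. 1) t + gen_deg j \<in> D"
    using finite_component_degrees[of s] by blast
  have comp: "linear_poly m (component s d) \<in> relation_span" for d
  proof -
    have "combination (component s d) = \<zero>\<^bsub>M\<^esub>"
      using combination_component[OF s, of d d] zero G_zero[of d] by simp
    then have "0 + single 0 1 * linear_poly m (component s d) \<in> relation_span"
      by (intro relation_span_step relation_span_0) (auto intro: component_vecs[OF s] component_homogeneous[OF s])
    then show ?thesis by simp
  qed
  have "(\<Sum>d\<in>D. linear_poly m (component s d)) \<in> relation_span"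
    using D(1) by (induction D) (auto simp: relation_span_0 relation_span_add comp)
  moreover have "(\<Sum>d\<in>D. linear_poly m (component s d)) = linear_poly m s"
    unfolding linear_poly_def
    by (subst sum.swap) (simp add: sum_distrib_right[symmetric] x_poly_sum[symmetric] sum_components[OF s D])
  ultimately show ?thesis by simp
qed

lemma relation_span_subset_J: "relation_span \<subseteq> J"
proof
  fix p assume "p \<in> relation_span"
  then show "p \<in> J"
  proof induction
    case (relation_span_step p t s d c)
    have "rho (linear_poly m s) \<in> I"
      using I_diff[OF var_zero var_combination[OF relation_span_step.hyps(3)]] relation_span_step.hyps(5) by simp
    then have "linear_poly m s \<in> J"
      using linear_poly_polys relation_span_step by (simp add: J_iff)
    then show ?case using relation_span_step by (intro J_add J_mult polys_single)
  qed (rule J_zero)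
qed

text \<open>Coefficients that express \<open>z\<close> in terms of the generators, homogeneous of the right degrees if \<open>z\<close> is homogeneous. For \<open>z = 0\<close>, which has every
  degree, the quantifier over \<open>d\<close> is harmless since the zero vector qualifies.\<close>
definition lift :: "'b \<Rightarrow> nat \<Rightarrow> (nat, 'k) mpoly" where
  "lift z = (SOME s. s \<in> vecs n m \<and> combination s = z \<and>
     (\<forall>d. z \<in> G d \<longrightarrow> (\<forall>j<m. s j \<in> S_homogeneous n (d - gen_deg j))))"

lemma lift:
  assumes z: "z \<in> carrier M"
  shows "lift z \<in> vecs n m" "combination (lift z) = z"
    "z \<in> G d \<Longrightarrow> j < m \<Longrightarrow> lift z j \<in> S_homogeneous n (d - gen_deg j)"
proof -
  obtain s where s: "s \<in> vecs n m" "z = combination s" using carrier_combinations[OF z] by blast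
  have "\<exists>s. s \<in> vecs n m \<and> combination s = z \<and> (\<forall>d. z \<in> G d \<longrightarrow> (\<forall>j<m. s j \<in> S_homogeneous n (d - gen_deg j)))"
  proof (cases "z = \<zero>\<^bsub>M\<^esub> \<or> (\<forall>d. z \<notin> G d)")
    case True
    then show ?thesis
    proof
      assume "z = \<zero>\<^bsub>M\<^esub>"
      then show ?thesis using combination_0 vecs_0[of n m] by (intro exI[of _ 0]) (auto simp: S_homogeneous_iff)
    next
      assume "\<forall>d. z \<notin> G d"
      then show ?thesis using s by blast
    qed
  next
    case False
    then obtain e where e: "z \<in> G e" and nz: "z \<noteq> \<zero>\<^bsub>M\<^esub>" by blast
    have c: "combination (component s e) = z" using combination_component[OF s(1), of e e] e s(2) by simp
    have "d = e" if "z \<in> G d" for d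
      using combination_component[OF s(1), of d e] that c nz s(2) by (auto split: if_splits)
    then show ?thesis
      using component_vecs[OF s(1), of e] component_homogeneous[OF s(1), of e] c by (intro exI[of _ "component s e"]) auto
  qed
  from someI_ex[OF this]
  show "lift z \<in> vecs n m" "combination (lift z) = z"
    "z \<in> G d \<Longrightarrow> j < m \<Longrightarrow> lift z j \<in> S_homogeneous n (d - gen_deg j)"
    unfolding lift_def by blast+
qed

text \<open>A homomorphism in the opposite direction to \<open>rho\<close>, inverse to it modulo the relations. It replaces \<open>Y\<^sub>z\<close> by a linear form in the \<open>y\<^sub>j\<close>
  representing \<open>z\<close>; the choice is not additive in \<open>z\<close>, but it is so modulo linear relations.\<close>
definition psi_var :: "nat + 'b \<Rightarrow> (nat + nat, 'k) mpoly" where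
  "psi_var = case_sum (\<lambda>i. var (Inl i)) (\<lambda>z. linear_poly m (lift z))"

definition psi :: "(nat + 'b, 'k) mpoly \<Rightarrow> (nat + nat, 'k) mpoly" where
  "psi = subst psi_var"

lemma psi_var_polys: "v \<in> W \<Longrightarrow> psi_var v \<in> polys V"
  by (auto simp: psi_var_def intro!: polys_var linear_poly_polys lift)

lemma psi_polys: "p \<in> polys W \<Longrightarrow> psi p \<in> polys V"
  unfolding psi_def by (rule polys_subst) (auto intro!: psi_var_polys)

lemma psi_x_poly: "psi (x_poly s) = x_poly s"
  by (simp add: psi_def x_poly_eq subst_subst psi_var_def)

lemma psi_I: "p \<in> I \<Longrightarrow> psi p \<in> relation_span"
proof -
  let ?K = "{p \<in> polys W. psi p \<in> relation_span}"
  have "I \<subseteq> ?K"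
  proof (rule I_least)
    show "sym_generators \<subseteq> ?K"
    proof
      fix p assume p: "p \<in> sym_generators"
      then have pW: "p \<in> polys W" using sym_generators_polys by blast
      consider (sum) z w where "z \<in> carrier M" "w \<in> carrier M" "p = var (Inr (z \<oplus>\<^bsub>M\<^esub> w)) - var (Inr z) - var (Inr w)"
        | (smult) s z where "s \<in> polys {..<n}" "z \<in> carrier M" "p = var (Inr (s \<odot>\<^bsub>M\<^esub> z)) - x_poly s * var (Inr z)"
        using p unfolding sym_generators_def by blast
      then have "psi p \<in> relation_span"
      proof cases
        case sum
        then have zw: "z \<oplus>\<^bsub>M\<^esub> w \<in> carrier M" by simp
        have "psi p = linear_poly m (lift (z \<oplus>\<^bsub>M\<^esub> w) - (lift z + lift w))"
          by (simp add: sum(3) psi_def subst_diff psi_var_def linear_poly_diff linear_poly_add del: plus_fun_apply)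
        moreover have "lift z + lift w \<in> vecs n m" using lift(1) sum by (intro vecs_add)
        moreover have "combination (lift z + lift w) = z \<oplus>\<^bsub>M\<^esub> w"
          using combination_add[OF lift(1) lift(1)] lift(2) sum by simp
        ultimately show ?thesis
          using lift[OF zw] by (auto intro!: relation_in_span combination_diff_eq_0 vecs_diff)
      next
        case smult
        then have sz: "s \<odot>\<^bsub>M\<^esub> z \<in> carrier M" by simp
        have "psi p = linear_poly m (lift (s \<odot>\<^bsub>M\<^esub> z) - scale_vec s (lift z))"
          using psi_x_poly[of s]
          by (simp add: smult(3) psi_def subst_diff subst_mult psi_var_def linear_poly_diff linear_poly_scale)
        moreover have "scale_vec s (lift z) \<in> vecs n m" using lift(1) smult by (intro vecs_scale)
        moreover have "combination (scale_vec s (lift z)) = s \<odot>\<^bsub>M\<^esub> z"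
          using combination_scale[OF lift(1)] lift(2) smult by simp
        ultimately show ?thesis
          using lift[OF sz] by (auto intro!: relation_in_span combination_diff_eq_0 vecs_diff)
      qed
      then show "p \<in> ?K" using pW by simp
    qed
  qed (use psi_polys in \<open>auto simp: psi_def relation_span_0 subst_add subst_mult intro: polys_add polys_mult relation_span_add relation_span_mult\<close>)
  then show "p \<in> I \<Longrightarrow> psi p \<in> relation_span" by blast
qed

lemma psi_rho:
  assumes p: "p \<in> polys V" shows "p - psi (rho p) \<in> relation_span"
proof -
  have "subst var p - subst (\<lambda>v. psi_var (map_sum id f v)) p \<in> relation_span"
  proof (rule subst_diff_in_ideal[where V = V and W = V])
    fix v assume v: "v \<in> V"
    show "var v - psi_var (map_sum id f v) \<in> relation_span"
    proof (cases v)
      case (Inl i)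
      then show ?thesis by (simp add: psi_var_def relation_span_0)
    next
      case (Inr j)
      then have j: "j < m" using v by auto
      have "linear_poly m (unit_vec j - lift (f j)) \<in> relation_span"
        using j lift[OF f_carrier[OF j]] unit_vec_vecs[OF j] combination_unit_vec[OF j]
        by (intro relation_in_span combination_diff_eq_0 vecs_diff) auto
      then show ?thesis using Inr j by (simp add: psi_var_def linear_poly_diff linear_poly_unit_vec)
    qed
    show "psi_var (map_sum id f v) \<in> polys V"
      using v by (intro psi_var_polys) (auto intro: f_carrier)
  qed (use p in \<open>auto intro: relation_span_0 relation_span_add relation_span_mult polys_var\<close>)
  then show ?thesis by (simp add: subst_var_id psi_def rho_def subst_subst)
qed

text \<open>If \<open>p \<in> J\<close>, then \<open>psi (rho p)\<close> is in the span of the linear relations because \<open>psi\<close> maps the defining relations of the symmetric algebra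
  there, and it differs from \<open>p\<close> by an element of that span.\<close>
lemma J_eq_relation_span: "J = relation_span"
proof
  show "J \<subseteq> relation_span"
  proof
    fix p assume "p \<in> J"
    then have "p - psi (rho p) \<in> relation_span" "psi (rho p) \<in> relation_span"
      using psi_rho psi_I by (auto simp: J_iff)
    then have "(p - psi (rho p)) + psi (rho p) \<in> relation_span" by (rule relation_span_add)
    then show "p \<in> relation_span" by simp
  qed
qed (rule relation_span_subset_J)

lemma rho_psi:
  assumes p: "p \<in> polys W" shows "p - rho (psi p) \<in> I"
proof -
  have "subst var p - subst (\<lambda>v. rho (psi_var v)) p \<in> I"
  proof (rule subst_diff_in_ideal[where V = W and W = W])
    fix v assume v: "v \<in> W"
    show "var v - rho (psi_var v) \<in> I"
    proof (cases v)
      case (Inl i)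
      then show ?thesis by (simp add: psi_var_def rho_def I_zero)
    next
      case (Inr z)
      then have z: "z \<in> carrier M" using v by auto
      show ?thesis using var_combination[OF lift(1)[OF z]] lift(2)[OF z] Inr by (simp add: psi_var_def)
    qed
    show "rho (psi_var v) \<in> polys W" by (rule rho_polys[OF psi_var_polys[OF v]])
  qed (use p in \<open>auto intro: I_zero I_add I_mult polys_var\<close>)
  then show ?thesis by (simp add: subst_var_id psi_def rho_def subst_subst)
qed

section \<open>Gradings\<close>

definition weight :: "nat + nat \<Rightarrow> int" where "weight = case_sum (\<lambda>_. 1) gen_deg"

lemma linear_poly_weight:
  assumes "\<And>j. j < m \<Longrightarrow> s j \<in> S_homogeneous n (d - gen_deg j)"
  shows "linear_poly m s \<in> homog weight d"
  unfolding linear_poly_def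
proof (rule homog_sum)
  fix j assume j: "j \<in> {..<m}"
  then have "x_poly (s j) \<in> homog weight (d - gen_deg j)"
    using assms by (intro homog_x_poly) (auto simp: weight_def)
  moreover have "var (Inr j) \<in> homog weight (gen_deg j)" by (rule homog_var) (simp add: weight_def)
  ultimately show "x_poly (s j) * var (Inr j) \<in> homog weight d" by (rule homog_mult') simp
qed

lemma linear_poly_y_weight:
  assumes "s \<in> vecs n m"
  shows "linear_poly m s \<in> homog y_weight 1"
  unfolding linear_poly_def
proof (rule homog_sum)
  fix j assume j: "j \<in> {..<m}"
  then have "x_poly (s j) \<in> homog y_weight 0"
    using assms by (intro homog_x_poly_0) (auto simp: y_weight_def vecs_iff)
  moreover have "var (Inr j) \<in> homog y_weight 1" by (rule homog_var) (simp add: y_weight_def)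
  ultimately show "x_poly (s j) * var (Inr j) \<in> homog y_weight 1" by (rule homog_mult') simp
qed

lemma J_restr:
  assumes "p \<in> J" and \<omega>: "\<And>(s :: nat \<Rightarrow> (nat, 'k) mpoly) d. s \<in> vecs n m \<Longrightarrow> (\<And>j. j < m \<Longrightarrow> s j \<in> S_homogeneous n (d - gen_deg j)) \<Longrightarrow> 
     \<exists>e. linear_poly m s \<in> homog \<omega> e"
  shows "restr \<omega> E p \<in> J"
  using assms(1) unfolding J_eq_relation_span
proof induction
  case (relation_span_step p t s d c)
  from relation_span_step.hyps(3) have "\<exists>e. linear_poly m s \<in> homog \<omega> e"
    by (rule \<omega>) (rule relation_span_step.hyps(4))
  then obtain e where "linear_poly m s \<in> homog \<omega> e" by blast
  then have "single t c * linear_poly m s \<in> homog \<omega> (wdeg \<omega> t + e)"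
    by (intro homog_mult homog_single refl)
  then have "restr \<omega> E (single t c * linear_poly m s) \<in> {0, single t c * linear_poly m s}"
    by (simp add: restr_of_homog)
  then consider "restr \<omega> E (single t c * linear_poly m s) = 0"
    | "restr \<omega> E (single t c * linear_poly m s) = single t c * linear_poly m s" by blast
  then show ?case
  proof cases
    case 2
    then show ?thesis using relation_span_step
      by (simp only: restr_add) (rule relation_span.relation_span_step)
  qed (simp add: restr_add relation_span_step)
qed (simp add: relation_span_0)

lemma J_restr_weight: "p \<in> J \<Longrightarrow> restr weight E p \<in> J"
  by (rule J_restr) (use linear_poly_weight in blast)+

lemma J_restr_y_weight: "p \<in> J \<Longrightarrow> restr y_weight E p \<in> J"
  by (rule J_restr) (use linear_poly_y_weight in blast)+

text \<open>This is where the minimality of the generators enters.\<close>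
lemma J_x_part:
  assumes "p \<in> J" "t \<in> keys p"
  shows "x_part t \<noteq> 0"
  using assms unfolding J_eq_relation_span
proof (induction arbitrary: t)
  case (relation_span_step p u s d c)
  have lin: "x_part t \<noteq> 0" if t: "t \<in> keys (linear_poly m s)" for t
  proof -
    obtain j where j: "j < m" "t \<in> keys (x_poly (s j) * var (Inr j))"
      using t keys_sum[of "\<lambda>j. x_poly (s j) * var (Inr j)" "{..<m}"] by (auto simp: linear_poly_def)
    then obtain a where a: "t = a + single (Inr j) 1" "a \<in> keys (x_poly (s j))"
      using keys_mult[of "x_poly (s j)" "var (Inr j)"] by (auto simp: var_def mon_def)
    have "lookup (s j) 0 = 0"
      using relation_span_step j by (intro homogeneous_relation_coefficient)
    then have "0 \<notin> keys (s j)" by (simp add: in_keys_iff)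
    moreover obtain r where r: "r \<in> keys (s j)" "a = rename_monomial Inl r"
      using a(2) keys_sum[of "\<lambda>t. single (rename_monomial Inl t) (lookup (s j) t)" "keys (s j)"]
      by (auto simp: x_poly_def rename_vars_def split: if_splits)
    ultimately have "r \<noteq> 0" by blast
    then obtain i where i: "i \<in> keys r" by fastforce
    have "lookup (x_part t) i \<ge> lookup a (Inl i)"
      by (simp add: a lookup_x_part lookup_add)
    moreover have "lookup a (Inl i) = (\<Sum>v\<in>keys r. if v = i then lookup r v else 0)"
      unfolding r(2) rename_monomial_def lookup_sum by (rule sum.cong) (auto simp: lookup_single when_def)
    ultimately have "lookup (x_part t) i \<noteq> 0" using i by (simp add: in_keys_iff)
    then show ?thesis by auto
  qed
  have "t \<in> keys p \<or> t \<in> keys (single u c * linear_poly m s)"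
    using relation_span_step.prems keys_add[of p "single u c * linear_poly m s"] by blast
  then show ?case
  proof
    assume "t \<in> keys (single u c * linear_poly m s)"
    then obtain v where "t = u + v" "v \<in> keys (linear_poly m s)"
      using keys_mult[of "single u c" "linear_poly m s"] by (auto split: if_splits)
    then have "keys (x_part v) \<noteq> {}" "keys (x_part t) = keys (x_part u) \<union> keys (x_part v)"
      using lin[of v] by (simp_all add: x_part_add keys_plus_monomial)
    then show ?thesis by auto
  qed (rule relation_span_step.IH)
qed simp

lemma rho_homog:
  assumes "p \<in> homog (\<lambda>v. \<omega> (map_sum id f v)) e"
  shows "rho p \<in> homog \<omega> e"
  unfolding rho_def
  by (rule homog_subst[OF assms, where V = UNIV]) (auto simp: polys_iff intro: homog_var)

lemma psi_homog_y_weight: 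
  assumes "p \<in> polys W" "p \<in> homog y_weight k" shows "psi p \<in> homog y_weight k"
  unfolding psi_def
  by (rule homog_subst[OF assms(2,1)])
     (auto simp: psi_var_def intro!: homog_var linear_poly_y_weight lift)

lemma homog_y_weight_iff: "p \<in> homog y_weight (int k) \<longleftrightarrow> (\<forall>t \<in> keys p. mdeg (y_part t) = k)"
  by (simp add: homog_def wdeg_y_weight)

text \<open>Every form of degree \<open>k\<close> in the \<open>Y\<^sub>z\<close> has the same class as its image under \<open>psi\<close>, a form of degree \<open>k\<close> in the \<open>y\<^sub>j\<close>; likewise for the
  grading below.\<close>
lemma sym_power_carrier: "carrier (sym_power n M k) = pres ` (polys V \<inter> homog y_weight (int k))"
proof
  show "carrier (sym_power n M k) \<subseteq> pres ` (polys V \<inter> homog y_weight (int k))"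
  proof
    fix c assume "c \<in> carrier (sym_power n M k)"
    then obtain p where p: "c = cls p" "p \<in> polys W" "p \<in> homog y_weight (int k)"
      by (auto simp: sym_power_def sym_cover_def homog_y_weight_iff)
    then have "c = pres (psi p)"
      using rho_psi[OF p(2)] psi_polys[OF p(2)] by (simp add: pres_eq cls_eq_iff rho_polys)
    then show "c \<in> pres ` (polys V \<inter> homog y_weight (int k))"
      using psi_polys[OF p(2)] psi_homog_y_weight[OF p(2,3)] by blast
  qed
  show "pres ` (polys V \<inter> homog y_weight (int k)) \<subseteq> carrier (sym_power n M k)"
  proof
    fix c assume "c \<in> pres ` (polys V \<inter> homog y_weight (int k))"
    then obtain p where p: "c = pres p" "p \<in> polys V" "p \<in> homog y_weight (int k)" by auto
    have "(\<lambda>v. y_weight (map_sum id f v)) = (y_weight :: nat + nat \<Rightarrow> int)"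
      by (auto simp: fun_eq_iff y_weight_def split: sum.split)
    then have "rho p \<in> homog y_weight (int k)" using p(3) by (intro rho_homog) simp
    then show "c \<in> carrier (sym_power n M k)"
      using p rho_polys by (auto simp: sym_power_def sym_cover_def pres_eq homog_y_weight_iff)
  qed
qed

lemma sym_power_grading_eq:
  "sym_power_grading n M G k e = pres ` (polys V \<inter> homog y_weight (int k) \<inter> homog weight e)"
proof
  show "sym_power_grading n M G k e \<subseteq> pres ` (polys V \<inter> homog y_weight (int k) \<inter> homog weight e)"
  proof
    fix c assume "c \<in> sym_power_grading n M G k e"
    then obtain p where p: "c = cls p" "p \<in> polys W" "p \<in> homog y_weight (int k)"
      and hom: "\<And>t. t \<in> keys p \<Longrightarrow> \<exists>\<delta>. (\<forall>z \<in> keys (y_part t). z \<in> G (\<delta> z)) \<and>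
              int (mdeg (x_part t)) + (\<Sum>z \<in> keys (y_part t). int (lookup (y_part t) z) * \<delta> z) = e"
      unfolding sym_power_grading_def sym_cover_def by (auto simp: homog_y_weight_iff)
    have "monomial_eval psi_var t \<in> homog weight e" if t: "t \<in> keys p" for t
    proof -
      obtain \<delta> where \<delta>: "\<forall>z \<in> keys (y_part t). z \<in> G (\<delta> z)"
         "int (mdeg (x_part t)) + wdeg \<delta> (y_part t) = e"
        using hom[OF t] unfolding wdeg_def by blast
      have "monomial_eval psi_var t \<in> homog weight (wdeg (case_sum (\<lambda>_. 1) \<delta>) t)"
      proof (rule homog_monomial_eval)
        fix v assume v: "v \<in> keys t"
        show "psi_var v \<in> homog weight (case_sum (\<lambda>_. 1) \<delta> v)"
        proof (cases v)
          case (Inl i)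
          then show ?thesis by (auto simp: psi_var_def weight_def intro!: homog_var)
        next
          case (Inr z)
          then have z: "z \<in> G (\<delta> z)" using \<delta>(1) v by (simp add: keys_y_part)
          then show ?thesis using Inr lift(3)[OF G_carrier[OF z] z] by (simp add: psi_var_def linear_poly_weight)
        qed
      qed
      then show ?thesis using \<delta>(2) by (simp add: wdeg_parts int_mdeg)
    qed
    then have "psi p \<in> homog weight e"
      unfolding psi_def subst_def by (intro homog_sum homog_mult'[OF homog_const]) auto
    moreover have "c = pres (psi p)"
      using p rho_psi[OF p(2)] psi_polys[OF p(2)] by (simp add: pres_eq cls_eq_iff rho_polys)
    ultimately show "c \<in> pres ` (polys V \<inter> homog y_weight (int k) \<inter> homog weight e)"
      using psi_polys[OF p(2)] psi_homog_y_weight[OF p(2,3)] by blast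
  qed
  show "pres ` (polys V \<inter> homog y_weight (int k) \<inter> homog weight e) \<subseteq> sym_power_grading n M G k e"
  proof
    fix c assume "c \<in> pres ` (polys V \<inter> homog y_weight (int k) \<inter> homog weight e)"
    then obtain p where p: "c = pres p" "p \<in> polys V" "p \<in> homog y_weight (int k)" "p \<in> homog weight e" by auto
    have "(\<lambda>v. y_weight (map_sum id f v)) = (y_weight :: nat + nat \<Rightarrow> int)"
      by (auto simp: fun_eq_iff y_weight_def split: sum.split)
    then have 1: "rho p \<in> homog y_weight (int k)" using p(3) by (intro rho_homog) simp
    have "(\<lambda>v. case_sum (\<lambda>_. 1) deg_of (map_sum id f v)) = weight"
      by (auto simp: fun_eq_iff weight_def gen_deg_def split: sum.split)
    then have 2: "rho p \<in> homog (case_sum (\<lambda>_. 1) deg_of) e" using p(4) by (intro rho_homog) simp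
    have 3: "rho p \<in> polys ({..<n} <+> f ` {..<m})"
      unfolding rho_def using p(2) by (rule polys_subst) (auto intro!: polys_var)
    have "\<exists>\<delta>. (\<forall>z \<in> keys (y_part t). z \<in> G (\<delta> z)) \<and>
              int (mdeg (x_part t)) + (\<Sum>z \<in> keys (y_part t). int (lookup (y_part t) z) * \<delta> z) = e"
      if t: "t \<in> keys (rho p)" for t
    proof (intro exI[of _ deg_of] conjI ballI)
      fix z assume "z \<in> keys (y_part t)"
      then have "Inr z \<in> {..<n} <+> f ` {..<m}" using 3 t by (auto simp: keys_y_part polys_iff)
      then show "z \<in> G (deg_of z)" using deg_of by auto
    next
      have "wdeg (case_sum (\<lambda>_. 1) deg_of) t = e" using 2 t by (simp add: homog_def)
      then show "int (mdeg (x_part t)) + (\<Sum>z \<in> keys (y_part t). int (lookup (y_part t) z) * deg_of z) = e"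
        by (simp add: wdeg_parts int_mdeg) (simp add: wdeg_def)
    qed
    then show "c \<in> sym_power_grading n M G k e"
      using p(1) rho_polys[OF p(2)] 1 unfolding sym_power_grading_def sym_cover_def
      by (auto simp: pres_eq homog_y_weight_iff)
  qed
qed

end

section \<open>Monomial orders and monomial ideals\<close>

lemma monomial_orderD:
  assumes "monomial_order V lt"
  shows "keys s \<subseteq> V \<Longrightarrow> \<not> lt s s"
    and "keys s \<subseteq> V \<Longrightarrow> keys t \<subseteq> V \<Longrightarrow> keys u \<subseteq> V \<Longrightarrow> lt s t \<Longrightarrow> lt t u \<Longrightarrow> lt s u"
    and "keys s \<subseteq> V \<Longrightarrow> keys t \<subseteq> V \<Longrightarrow> s \<noteq> t \<Longrightarrow> lt s t \<or> lt t s"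
    and "keys s \<subseteq> V \<Longrightarrow> keys t \<subseteq> V \<Longrightarrow> keys u \<subseteq> V \<Longrightarrow> lt s t \<Longrightarrow> lt (s + u) (t + u)"
  using assms unfolding monomial_order_def Let_def by blast+

lemma monomial_order_block:
  assumes y: "monomial_order {..<m} less_y" and x: "monomial_order {..<n} less_x"
  shows "monomial_order (T_vars n m) (block_order less_y less_x)"
proof -
  have kx: "keys (x_part t) \<subseteq> {..<n}" and ky: "keys (y_part t) \<subseteq> {..<m}"
    if "keys t \<subseteq> T_vars n m" for t :: "(nat + nat) monomial"
    using that by (auto simp: keys_x_part keys_y_part)
  show ?thesis
    unfolding monomial_order_def Let_def mem_Collect_eq Ball_Collect Collect_mono_iff
  proof (intro conjI ballI allI impI)
    fix s :: "(nat + nat) monomial" assume s: "keys s \<subseteq> T_vars n m"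
    show "\<not> block_order less_y less_x s s"
      using monomial_orderD(1)[OF y ky[OF s]] monomial_orderD(1)[OF x kx[OF s]] by (simp add: block_order_def)
    show "block_order less_y less_x 0 s" if "s \<noteq> 0"
    proof (cases "y_part s = 0")
      case True
      then have "x_part s \<noteq> 0" using that monomial_parts_eqI[of s 0] by auto
      then have "less_x 0 (x_part s)" using x kx[OF s] unfolding monomial_order_def Let_def by blast
      then show ?thesis using True by (simp add: block_order_def)
    next
      case False
      then have "less_y 0 (y_part s)" using y ky[OF s] unfolding monomial_order_def Let_def by blast
      then show ?thesis by (simp add: block_order_def)
    qed
    fix t :: "(nat + nat) monomial" assume t: "keys t \<subseteq> T_vars n m"
    show "block_order less_y less_x s t \<or> block_order less_y less_x t s" if "s \<noteq> t"
    proof (cases "y_part s = y_part t")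
      case True
      then have "x_part s \<noteq> x_part t" using that monomial_parts_eqI by blast
      then show ?thesis using True monomial_orderD(3)[OF x kx[OF s] kx[OF t]] by (auto simp: block_order_def)
    next
      case False
      then show ?thesis using monomial_orderD(3)[OF y ky[OF s] ky[OF t]] by (auto simp: block_order_def)
    qed
    fix u :: "(nat + nat) monomial" assume u: "keys u \<subseteq> T_vars n m"
    show "block_order less_y less_x s u" if "block_order less_y less_x s t" "block_order less_y less_x t u"
      using that monomial_orderD(2)[OF y ky[OF s] ky[OF t] ky[OF u]] monomial_orderD(2)[OF x kx[OF s] kx[OF t] kx[OF u]]
      by (auto simp: block_order_def)
    show "block_order less_y less_x (s + u) (t + u)" if "block_order less_y less_x s t"
      using that monomial_orderD(4)[OF y ky[OF s] ky[OF t] ky[OF u]] monomial_orderD(4)[OF x kx[OF s] kx[OF t] kx[OF u]]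
      by (auto simp: block_order_def x_part_add y_part_add)
  qed
qed

lemma finite_monomials_max:
  assumes "monomial_order V lt" "finite F" "F \<noteq> {}" "\<And>t. t \<in> F \<Longrightarrow> keys t \<subseteq> V"
  shows "\<exists>t\<in>F. \<forall>s\<in>F. s \<noteq> t \<longrightarrow> lt s t"
  using assms(2-4)
proof (induction rule: finite_ne_induct)
  case (insert a F)
  then obtain t where t: "t \<in> F" "\<forall>s\<in>F. s \<noteq> t \<longrightarrow> lt s t" by auto
  have ka: "keys a \<subseteq> V" and kt: "keys t \<subseteq> V" using insert t by auto
  consider "lt a t" | "lt t a" using monomial_orderD(3)[OF assms(1) ka kt] insert t by blast
  then show ?case
  proof cases
    case 1
    then show ?thesis using t by auto
  next
    case 2
    have "lt s a" if "s \<in> F" for s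
      using t(2) that 2 monomial_orderD(2)[OF assms(1) _ kt ka, of s] insert.prems by (cases "s = t") auto
    then show ?thesis by auto
  qed
qed auto

lemma leading_monomial_exists:
  assumes "monomial_order V lt" "p \<in> polys V" "p \<noteq> 0"
  shows "\<exists>t. is_leading_monomial lt p t"
  using finite_monomials_max[OF assms(1), of "keys p"] assms(2,3)
  by (auto simp: is_leading_monomial_def polys_iff)

lemma lookup_mon_mult: "lookup (mon u * p) (u + t) = lookup p t"
proof (induction p rule: mpoly_keys_induct)
  case (single s a)
  then show ?case by (simp add: mon_def mult_single lookup_single when_def)
qed (auto simp: lookup_add distrib_left)

lemma keys_mon_mult: "t \<in> keys (mon u * p) \<Longrightarrow> \<exists>s \<in> keys p. t = u + s"
  using keys_mult[of "mon u" p] by (auto simp: mon_def)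

lemma leading_monomial_mult:
  assumes "monomial_order V lt" "p \<in> polys V" "keys u \<subseteq> V" "is_leading_monomial lt p t"
  shows "is_leading_monomial lt (mon u * p) (u + t)"
  unfolding is_leading_monomial_def
proof (intro conjI ballI impI)
  show "u + t \<in> keys (mon u * p)"
    using assms(4) by (simp add: is_leading_monomial_def in_keys_iff lookup_mon_mult)
  fix s assume "s \<in> keys (mon u * p)" "s \<noteq> u + t"
  then obtain r where r: "r \<in> keys p" "s = u + r" "r \<noteq> t" using keys_mon_mult[of s u p] by auto
  then have "lt r t" using assms(4) by (simp add: is_leading_monomial_def)
  then have "lt (r + u) (t + u)"
    using assms r by (intro monomial_orderD(4)[OF assms(1)]) (auto simp: polys_iff is_leading_monomial_def)
  then show "lt s (u + t)" using r by (simp add: add.commute)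
qed

lemma monomial_in_monomial_ideal:
  fixes C :: "'v monomial set"
  assumes C: "\<And>t. t \<in> C \<Longrightarrow> keys t \<subseteq> V"
    and t: "(mon t :: ('v, 'k::field) mpoly) \<in> Idl\<^bsub>poly_ring V\<^esub> (mon ` C)"
  shows "\<exists>c\<in>C. \<exists>r. t = c + r"
proof -
  interpret R: cring "poly_ring V :: ('v, 'k) mpoly ring" by (rule cring_poly_ring)
  define K :: "('v, 'k) mpoly set" where
    "K = {p \<in> polys V. \<forall>t \<in> keys p. \<exists>c\<in>C. \<exists>r. t = c + r}"
  have K: "p \<in> polys V" "t \<in> keys p \<Longrightarrow> \<exists>c\<in>C. \<exists>r. t = c + r" if "p \<in> K" for p t
    using that by (auto simp: K_def)
  have KI: "p \<in> K" if "p \<in> polys V" "\<And>t. t \<in> keys p \<Longrightarrow> \<exists>c\<in>C. \<exists>r. t = c + r" for p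
    using that by (auto simp: K_def)
  have mult: "c * p \<in> K" if c: "c \<in> polys V" and p: "p \<in> K" for c p
  proof (rule KI)
    show "c * p \<in> polys V" using c K(1)[OF p] by (rule polys_mult)
    fix s assume s: "s \<in> keys (c * p)"
    obtain a b where ab: "s = a + b" "b \<in> keys p" using s keys_mult[of c p] by blast
    then obtain d r where "d \<in> C" "b = d + r" using K(2)[OF p] by blast
    then show "\<exists>d\<in>C. \<exists>r. s = d + r" using ab by (metis add.assoc add.commute)
  qed
  have add: "p + q \<in> K" if p: "p \<in> K" and q: "q \<in> K" for p q
  proof (rule KI)
    show "p + q \<in> polys V" using K(1)[OF p] K(1)[OF q] by (rule polys_add)
    fix s assume "s \<in> keys (p + q)"
    then have "s \<in> keys p \<or> s \<in> keys q" using keys_add[of p q] by blast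
    then show "\<exists>d\<in>C. \<exists>r. s = d + r" using K(2)[OF p] K(2)[OF q] by blast
  qed
  have "ideal K (poly_ring V)"
  proof (rule idealI)
    show "ring (poly_ring V :: ('v, 'k) mpoly ring)" by (rule R.ring_axioms)
    show "subgroup K (add_monoid (poly_ring V))"
    proof (rule R.add.subgroupI)
      fix p assume p: "p \<in> K"
      have "(- 1) * p \<in> K" by (rule mult[OF _ p]) (simp add: polys_uminus)
      then show "\<ominus>\<^bsub>poly_ring V\<^esub> p \<in> K" using K(1)[OF p] by (simp add: a_inv_poly_ring)
    next
      have "0 \<in> K" by (rule KI) simp_all
      then show "K \<noteq> {}" by blast
    qed (use add K(1) in auto)
  next
    fix a x :: "('v, 'k) mpoly" assume "a \<in> K" "x \<in> polys V"
    then have "x * a \<in> K" by (intro mult)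
    then show "x \<otimes>\<^bsub>poly_ring V\<^esub> a \<in> K" "a \<otimes>\<^bsub>poly_ring V\<^esub> x \<in> K" by (simp_all add: mult.commute)
  qed
  moreover have "mon ` C \<subseteq> K"
  proof
    fix p :: "('v, 'k) mpoly" assume "p \<in> mon ` C"
    then obtain c where c: "c \<in> C" "p = mon c" by auto
    show "p \<in> K"
    proof (rule KI)
      show "p \<in> polys V" unfolding c(2) by (rule polys_mon[OF C[OF c(1)]])
      fix t assume "t \<in> keys p"
      then have "t = c + 0" by (simp add: c(2) mon_def)
      then show "\<exists>c\<in>C. \<exists>r. t = c + r" using c(1) by blast
    qed
  qed
  ultimately have "Idl\<^bsub>poly_ring V\<^esub> (mon ` C) \<subseteq> K" by (rule R.genideal_minimal)
  then have "mon t \<in> K" using t by blast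
  moreover have "t \<in> keys (mon t :: ('v, 'k) mpoly)" by (simp add: mon_def)
  ultimately show ?thesis using K(2) by blast
qed

text \<open>Proper divisors have smaller degree, so every leading monomial is a multiple of one that is minimal for divisibility. The minimal ones
  form a minimal set of monomial generators of the initial ideal, to which the hypothesis on \<open>P\<close> applies.\<close>
lemma leading_monomial_minimal_divisor:
  fixes J :: "('v, 'k::field) mpoly set"
  assumes J: "J \<subseteq> polys V" 
    and min: "\<And>B. minimal_monomial_generators V (initial_ideal V lt J) B \<Longrightarrow> (\<forall>t\<in>B. P t)"
    and e: "p \<in> J" "p \<noteq> 0" "is_leading_monomial lt p e"
  shows "\<exists>t q r. q \<in> J \<and> q \<noteq> 0 \<and> is_leading_monomial lt q t \<and> e = t + r \<and> P t"
proof -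
  interpret R: cring "poly_ring V :: ('v, 'k) mpoly ring" by (rule cring_poly_ring)
  define E where "E = {t. \<exists>p. p \<in> J \<and> p \<noteq> 0 \<and> is_leading_monomial lt p t}"
  \<comment> \<open>monomials are written additively, so \<open>t = s + r\<close> means that \<open>s\<close> divides \<open>t\<close>\<close>
  define B where "B = {t \<in> E. \<forall>s\<in>E. \<forall>r. t = s + r \<longrightarrow> s = t}"
  have EV: "keys t \<subseteq> V" if tE: "t \<in> E" for t
  proof -
    obtain p where "p \<in> J" "t \<in> keys p" using tE by (auto simp: E_def is_leading_monomial_def)
    then show ?thesis using subsetD[OF J, of p] by (simp add: polys_iff)
  qed
  have div: "\<exists>t\<in>B. \<exists>r. e = t + r" if "e \<in> E" for e
    using that
  proof (induction "mdeg e" arbitrary: e rule: less_induct)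
    case less
    show ?case
    proof (cases "e \<in> B")
      case True
      then show ?thesis by (intro bexI[of _ e] exI[of _ 0]) auto
    next
      case False
      then obtain s r where s: "s \<in> E" "e = s + r" "s \<noteq> e" using less.prems by (auto simp: B_def)
      then have "r \<noteq> 0" by auto
      then have "mdeg s < mdeg e" using s(2) mdeg_eq_0_iff[of r] by (simp add: mdeg_add)
      then obtain t r' where "t \<in> B" "s = t + r'" using less.hyps s(1) by blast
      then show ?thesis using s(2) by (metis add.assoc)
    qed
  qed
  have init: "initial_ideal V lt J = Idl\<^bsub>poly_ring V\<^esub> (mon ` E)"
    unfolding initial_ideal_def E_def by (rule arg_cong[where f = "\<lambda>X. Idl\<^bsub>poly_ring V\<^esub> X"]) auto
  have sub: "mon ` X \<subseteq> polys V" if "X \<subseteq> E" for X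
    using that EV by (auto intro: polys_mon)
  have BE: "B \<subseteq> E" by (auto simp: B_def)
  have "Idl\<^bsub>poly_ring V\<^esub> (mon ` B) = Idl\<^bsub>poly_ring V\<^esub> (mon ` E :: ('v, 'k) mpoly set)"
  proof
    have idealB: "ideal (Idl\<^bsub>poly_ring V\<^esub> (mon ` B)) (poly_ring V :: ('v, 'k) mpoly ring)"
      by (rule R.genideal_ideal) (rule sub[OF BE])
    show "Idl\<^bsub>poly_ring V\<^esub> (mon ` B) \<subseteq> Idl\<^bsub>poly_ring V\<^esub> (mon ` E :: ('v, 'k) mpoly set)"
      using BE R.genideal_self[OF sub[OF order_refl]]
      by (intro R.genideal_minimal R.genideal_ideal sub[OF order_refl]) blast
    show "Idl\<^bsub>poly_ring V\<^esub> (mon ` E) \<subseteq> Idl\<^bsub>poly_ring V\<^esub> (mon ` B :: ('v, 'k) mpoly set)"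
    proof (rule R.genideal_minimal[OF idealB])
      show "mon ` E \<subseteq> Idl\<^bsub>poly_ring V\<^esub> (mon ` B :: ('v, 'k) mpoly set)"
      proof
        fix p :: "('v, 'k) mpoly" assume "p \<in> mon ` E"
        then obtain e where e: "e \<in> E" "p = mon e" by auto
        then obtain t r where tr: "t \<in> B" "e = t + r" using div by blast
        have rV: "keys r \<subseteq> V" using EV[OF e(1)] tr(2) by (simp add: keys_plus_monomial)
        have "(mon t :: ('v, 'k) mpoly) \<in> Idl\<^bsub>poly_ring V\<^esub> (mon ` B)"
          using R.genideal_self[OF sub[OF BE]] tr(1) by blast
        from ideal.I_l_closed[OF idealB this polys_mon[OF rV]]
        have "mon r * mon t \<in> Idl\<^bsub>poly_ring V\<^esub> (mon ` B :: ('v, 'k) mpoly set)" by simp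
        moreover have "p = mon r * mon t" unfolding e(2) tr(2) mon_add by (rule mult.commute)
        ultimately show "p \<in> Idl\<^bsub>poly_ring V\<^esub> (mon ` B)" by simp
      qed
    qed
  qed
  moreover have "Idl\<^bsub>poly_ring V\<^esub> (mon ` C) \<noteq> Idl\<^bsub>poly_ring V\<^esub> (mon ` E :: ('v, 'k) mpoly set)" if C: "C \<subset> B" for C
  proof
    assume eq: "Idl\<^bsub>poly_ring V\<^esub> (mon ` C) = Idl\<^bsub>poly_ring V\<^esub> (mon ` E :: ('v, 'k) mpoly set)"
    obtain t where t: "t \<in> B" "t \<notin> C" using C by blast
    then have "(mon t :: ('v, 'k) mpoly) \<in> mon ` E" using BE by blast
    then have "(mon t :: ('v, 'k) mpoly) \<in> Idl\<^bsub>poly_ring V\<^esub> (mon ` C)"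
      unfolding eq using R.genideal_self[OF sub[OF order_refl]] by (rule rev_subsetD)
    moreover have "keys t \<subseteq> V" if "t \<in> C" for t using that C BE EV by blast
    ultimately have "\<exists>c\<in>C. \<exists>r. t = c + r" by (intro monomial_in_monomial_ideal)
    then obtain c r where c: "c \<in> C" "t = c + r" by blast
    have "\<forall>s\<in>E. \<forall>r. t = s + r \<longrightarrow> s = t" using t(1) by (simp add: B_def)
    moreover have "c \<in> E" using c(1) C BE by blast
    ultimately have "c = t" using c(2) by blast
    then show False using t(2) c(1) by simp
  qed
  ultimately have "minimal_monomial_generators V (initial_ideal V lt J) B"
    unfolding minimal_monomial_generators_def init using subsetD[OF BE, THEN EV] by simp
  then have P: "\<forall>t\<in>B. P t" by (rule min)
  have "e \<in> E" using e by (auto simp: E_def)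
  then obtain t r where tr: "t \<in> B" "e = t + r" using div by blast
  from tr(1) have "t \<in> E" using BE by blast
  then obtain q where q: "q \<in> J \<and> q \<noteq> 0 \<and> is_leading_monomial lt q t" unfolding E_def by blast
  have "P t" using P tr(1) by blast
  then show ?thesis using q tr(2) by (intro exI[of _ t] exI[of _ q] exI[of _ r]) simp
qed

lemma finite_monomials: "finite {t :: nat monomial. keys t \<subseteq> {..<n} \<and> mdeg t = d}"
proof (induction d)
  case 0
  have "{t :: nat monomial. keys t \<subseteq> {..<n} \<and> mdeg t = 0} \<subseteq> {0}" by (auto simp: mdeg_eq_0_iff)
  then show ?case by (rule finite_subset) simp
next
  case (Suc d)
  let ?F = "{t :: nat monomial. keys t \<subseteq> {..<n} \<and> mdeg t = d}"
  have "{t :: nat monomial. keys t \<subseteq> {..<n} \<and> mdeg t = Suc d} \<subseteq> (\<Union>v<n. (\<lambda>t. t + single v 1) ` ?F)"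
  proof
    fix t :: "nat monomial" assume t: "t \<in> {t. keys t \<subseteq> {..<n} \<and> mdeg t = Suc d}"
    then obtain s r where sr: "t = s + r" "mdeg r = 1" using monomial_split[of 1 t] by auto
    then obtain v where v: "r = single v 1" using mdeg_eq_1D[of r] by (auto simp: int_mdeg[symmetric])
    have "mdeg s = d" using t sr by (simp add: mdeg_add)
    moreover have "keys s \<subseteq> {..<n}" "v < n"
      using t by (auto simp: sr(1) v keys_plus_monomial)
    ultimately show "t \<in> (\<Union>v<n. (\<lambda>t. t + single v 1) ` ?F)" using sr v by auto
  qed
  then show ?case by (rule finite_subset) (use Suc in auto)
qed

section \<open>Coefficients with respect to the y-variables\<close>

definition xy :: "nat monomial \<Rightarrow> nat monomial \<Rightarrow> (nat + nat) monomial" where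
  "xy u w = rename_monomial Inl u + rename_monomial Inr w"

lemma lookup_rename_monomial:
  assumes "inj g" shows "lookup (rename_monomial g t) (g v) = lookup t v"
proof -
  have "lookup (rename_monomial g t) (g v) = (\<Sum>u\<in>keys t. if u = v then lookup t u else 0)"
    unfolding rename_monomial_def lookup_sum
    by (rule sum.cong) (auto simp: lookup_single when_def dest: injD[OF assms])
  then show ?thesis by (auto simp: in_keys_iff)
qed

lemma lookup_rename_monomial_0: "v \<notin> range g \<Longrightarrow> lookup (rename_monomial g t) v = 0"
  by (auto simp: rename_monomial_def lookup_sum lookup_single when_def intro!: sum.neutral)

lemma lookup_rename_monomial_Inl_Inr [simp]:
  "lookup (rename_monomial Inl u) (Inr j) = 0" "lookup (rename_monomial Inr w) (Inl i) = 0"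
  by (rule lookup_rename_monomial_0; blast)+

lemma x_part_xy [simp]: "x_part (xy u w) = u"
  by (rule poly_mapping_eqI) (simp add: lookup_x_part xy_def lookup_add lookup_rename_monomial)

lemma y_part_xy [simp]: "y_part (xy u w) = w"
  by (rule poly_mapping_eqI) (simp add: lookup_y_part xy_def lookup_add lookup_rename_monomial)

lemma xy_parts: "xy (x_part t) (y_part t) = t"
  by (rule monomial_parts_eqI) simp_all

lemma xy_add: "xy u w + xy u' w' = xy (u + u') (w + w')"
  by (rule monomial_parts_eqI) (simp_all add: x_part_add y_part_add)

lemma keys_xy: "keys (xy u w) = keys u <+> keys w"
proof (rule Set.set_eqI)
  fix v show "v \<in> keys (xy u w) \<longleftrightarrow> v \<in> keys u <+> keys w"
    using lookup_x_part[of "xy u w"] lookup_y_part[of "xy u w"] by (cases v) (auto simp: in_keys_iff)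
qed

lemma x_poly_single: "x_poly (single u a) = (single (xy u 0) a :: (nat + nat, 'k::field) mpoly)"
  by (simp add: x_poly_def rename_vars_def xy_def) (simp add: rename_monomial_def)

lemma x_poly_single_mult: "x_poly (single u a) * mon (xy u' w) = single (xy (u + u') w) a"
  by (simp add: x_poly_single mon_def mult_single xy_add)

lemma lookup_x_poly_mult:
  "lookup (x_poly l * mon (xy 0 w)) t = (if y_part t = w then lookup l (x_part t) else 0)"
proof (induction l rule: mpoly_keys_induct)
  case (single u a)
  have "xy u w = t \<longleftrightarrow> y_part t = w \<and> u = x_part t" by (metis x_part_xy y_part_xy xy_parts)
  then show ?case by (simp add: x_poly_single_mult lookup_single when_def)
qed (auto simp: x_poly_add distrib_right lookup_add)

lemma keys_x_poly_mult:
  "keys (x_poly l * mon (xy 0 w)) = (\<lambda>u. xy u w) ` keys l"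
proof (rule Set.set_eqI)
  fix t
  have "t \<in> keys (x_poly l * mon (xy 0 w)) \<longleftrightarrow> y_part t = w \<and> x_part t \<in> keys l"
    by (simp add: in_keys_iff lookup_x_poly_mult)
  also have "\<dots> \<longleftrightarrow> t \<in> (\<lambda>u. xy u w) ` keys l"
  proof
    assume "y_part t = w \<and> x_part t \<in> keys l"
    then show "t \<in> (\<lambda>u. xy u w) ` keys l"
      using xy_parts[of t] by (intro image_eqI[of t _ "x_part t"]) simp_all
  qed auto
  finally show "t \<in> keys (x_poly l * mon (xy 0 w)) \<longleftrightarrow> t \<in> (\<lambda>u. xy u w) ` keys l" .
qed

lemma keys_x_poly: "keys (x_poly l :: (nat + nat, 'k::field) mpoly) = (\<lambda>u. xy u 0) ` keys l"
proof -
  have "mon (xy 0 0) = (1 :: (nat + nat, 'k) mpoly)" by (simp add: mon_def xy_def rename_monomial_def)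
  moreover have "keys (x_poly l * (mon (xy 0 0) :: (nat + nat, 'k) mpoly)) = (\<lambda>u. xy u 0) ` keys l"
    by (rule keys_x_poly_mult)
  ultimately show ?thesis by simp
qed

text \<open>The polynomial \<open>l\<close> is the coefficient of the \<open>y\<close>-monomial \<open>w\<close> in \<open>p\<close>.\<close>
lemma y_coefficient:
  assumes p: "p \<in> polys (T_vars n m)"
  shows "\<exists>l r. p = x_poly l * mon (xy 0 w) + r \<and> l \<in> polys {..<n} \<and>
     keys l = {u. xy u w \<in> keys p} \<and>
     keys r = {t \<in> keys p. y_part t \<noteq> w}"
proof -
  define l where "l = Poly_Mapping.map_key (\<lambda>u. xy u w) p"
  have "inj (\<lambda>u. xy u w)" by (rule injI) (metis x_part_xy)
  then have ll: "lookup l u = lookup p (xy u w)" for u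
    by (simp add: l_def map_key.rep_eq)
  define r where "r = p - x_poly l * mon (xy 0 w)"
  have lr: "lookup r t = (if y_part t = w then 0 else lookup p t)" for t
  proof (cases "y_part t = w")
    case True
    then have "xy (x_part t) w = t" using xy_parts[of t] by simp
    then show ?thesis using True by (simp add: r_def lookup_minus lookup_x_poly_mult ll)
  qed (simp add: r_def lookup_minus lookup_x_poly_mult)
  have kl: "keys l = {u. xy u w \<in> keys p}" by (auto simp: in_keys_iff ll)
  have kr: "keys r = {t \<in> keys p. y_part t \<noteq> w}"
    by (auto simp: in_keys_iff lr split: if_splits)
  have "keys u \<subseteq> {..<n}" if "xy u w \<in> keys p" for u
  proof -
    have "keys u <+> keys w \<subseteq> T_vars n m"
      using p that unfolding polys_iff keys_xy[symmetric] by blast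
    then show ?thesis by auto
  qed
  then have "l \<in> polys {..<n}" unfolding polys_iff kl by blast
  moreover have "p = x_poly l * mon (xy 0 w) + r" by (simp add: r_def)
  ultimately show ?thesis using kl kr by blast
qed

lemma restr_x_poly:
  assumes "\<And>i. \<omega> (Inl i) = 1"
  shows "restr \<omega> E (x_poly p) = (x_poly (restr (\<lambda>_. 1) E p) :: (nat + nat, 'k::field) mpoly)"
proof (induction p rule: mpoly_keys_induct)
  case (single u a)
  have "\<omega> = case_sum (\<lambda>i. 1) (\<lambda>j. \<omega> (Inr j))" using assms by (auto simp: fun_eq_iff split: sum.split)
  then have "wdeg \<omega> (xy u 0) = wdeg (\<lambda>_. 1) u" using wdeg_parts[of "\<lambda>i. 1" "\<lambda>j. \<omega> (Inr j)" "xy u 0"] by simp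
  then show ?case by (simp add: x_poly_single restr_single)
qed (auto simp: x_poly_add restr_add)

section \<open>The x-condition\<close>

locale linear_initial_ideal = graded_generators n m M G f deg_of
  for n m :: nat and M :: "((nat, 'k::field) mpoly, 'b) module" and G f deg_of +
  fixes less_x less_y :: "nat monomial \<Rightarrow> nat monomial \<Rightarrow> bool"
  assumes order_y: "monomial_order {..<m} less_y" and order_x: "monomial_order {..<n} less_x"
    and x_cond: "x_condition n m (block_order less_y less_x) (presentation_ideal n M m f)"
begin

abbreviation lt where "lt \<equiv> block_order less_y less_x"

lemma order: "monomial_order V lt"
  by (rule monomial_order_block[OF order_y order_x])

lemma wdeg_weight_xy: "wdeg weight (xy v w) = int (mdeg v) + wdeg gen_deg w"
  by (simp add: weight_def wdeg_parts int_mdeg)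

lemma J_polys: "p \<in> J \<Longrightarrow> p \<in> polys V"
  by (simp add: J_iff)

definition lower :: "nat monomial \<Rightarrow> (nat + nat, 'k) mpoly set" where
  "lower w = {p \<in> polys V. \<forall>t \<in> keys p. less_y (y_part t) w}"

text \<open>The colon ideal of \<open>w\<close> with respect to the smaller \<open>y\<close>-monomials, modulo \<open>J\<close>.\<close>
definition colon :: "nat monomial \<Rightarrow> (nat, 'k) mpoly set" where
  "colon w = {q \<in> polys {..<n}. \<exists>r \<in> lower w. x_poly q * mon (xy 0 w) + r \<in> J}"

lemma lower_0: "0 \<in> lower w"
  by (simp add: lower_def)

lemma lower_add: "p \<in> lower w \<Longrightarrow> q \<in> lower w \<Longrightarrow> p + q \<in> lower w"
  using keys_add[of p q] by (auto simp: lower_def polys_add)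

lemma lower_mult:
  assumes "c \<in> polys {..<n}" "p \<in> lower w" shows "x_poly c * p \<in> lower w"
proof -
  have "less_y (y_part t) w" if t: "t \<in> keys (x_poly c * p)" for t
  proof -
    obtain a b where ab: "t = a + b" "a \<in> keys (x_poly c :: (nat + nat, 'k) mpoly)" "b \<in> keys p"
      using t keys_mult[of "x_poly c" p] by blast
    have "y_part a = 0" using ab(2) by (auto simp: keys_x_poly)
    then show ?thesis using assms(2) ab by (simp add: lower_def y_part_add)
  qed
  then show ?thesis using assms by (simp add: lower_def polys_mult polys_x_poly)
qed

lemma colon_add: "p \<in> colon w \<Longrightarrow> q \<in> colon w \<Longrightarrow> p + q \<in> colon w"
proof -
  assume "p \<in> colon w" "q \<in> colon w"
  then obtain r s where "p \<in> polys {..<n}" "q \<in> polys {..<n}" "r \<in> lower w" "s \<in> lower w"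
    and J: "x_poly p * mon (xy 0 w) + r \<in> J" "x_poly q * mon (xy 0 w) + s \<in> J" by (auto simp: colon_def)
  moreover have "x_poly (p + q) * mon (xy 0 w) + (r + s) \<in> J"
    using J_add[OF J] by (simp add: x_poly_add algebra_simps)
  ultimately show ?thesis unfolding colon_def using lower_add polys_add by blast
qed

lemma colon_mult: "c \<in> polys {..<n} \<Longrightarrow> q \<in> colon w \<Longrightarrow> c * q \<in> colon w"
proof -
  assume c: "c \<in> polys {..<n}" and "q \<in> colon w"
  then obtain r where q: "q \<in> polys {..<n}" "r \<in> lower w" "x_poly q * mon (xy 0 w) + r \<in> J" by (auto simp: colon_def)
  have "x_poly c * (x_poly q * mon (xy 0 w) + r) \<in> J" using q c by (intro J_mult polys_x_poly)
  then have "x_poly (c * q) * mon (xy 0 w) + x_poly c * r \<in> J" by (simp add: x_poly_mult algebra_simps)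
  then show ?thesis unfolding colon_def using lower_mult[OF c q(2)] polys_mult[OF c q(1)] by blast
qed

lemma colon_0: "0 \<in> colon w"
  using lower_0 J_zero by (auto simp: colon_def)

lemma colon_diff: "p \<in> colon w \<Longrightarrow> q \<in> colon w \<Longrightarrow> p - q \<in> colon w"
  using colon_add[of p w "- q"] colon_mult[of "- 1" q w] by (simp add: polys_uminus)

lemma colon_restr:
  assumes "q \<in> colon w" shows "restr (\<lambda>_. 1) {d} q \<in> colon w"
proof -
  obtain r where r: "q \<in> polys {..<n}" "r \<in> lower w" "x_poly q * mon (xy 0 w) + r \<in> J"
    using assms by (auto simp: colon_def)
  let ?e = "wdeg gen_deg w"
  have "restr weight {d + ?e} (x_poly q * mon (xy 0 w)) = restr weight {d} (x_poly q) * mon (xy 0 w)"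
    by (rule restr_mult_homog[where d = ?e]) (simp_all add: mon_def homog_single wdeg_weight_xy)
  also have "restr weight {d} (x_poly q) = x_poly (restr (\<lambda>_. 1) {d} q)"
    by (rule restr_x_poly) (simp add: weight_def)
  finally have "x_poly (restr (\<lambda>_. 1) {d} q) * mon (xy 0 w) + restr weight {d + ?e} r \<in> J"
    using J_restr_weight[OF r(3), of "{d + ?e}"] by (simp add: restr_add)
  moreover have "restr weight {d + ?e} r \<in> lower w"
    using r(2) by (auto simp: lower_def polys_restr keys_restr)
  ultimately show ?thesis using polys_restr[OF r(1)] unfolding colon_def by blast
qed

text \<open>A linear form in \<open>colon w\<close> with leading variable \<open>x\<^sub>c\<close>, together with a relation \<open>l w + r \<in> J\<close> that is homogeneous for both gradings. The
  condition on the \<open>x\<close>-parts bounds the degrees of the \<open>y\<close>-monomials occurring in \<open>r\<close> by that of \<open>w\<close>.\<close>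
definition linear_generator :: "nat monomial \<Rightarrow> nat \<Rightarrow> (nat, 'k) mpoly \<Rightarrow> bool" where
  "linear_generator w c l \<longleftrightarrow> l \<in> S_homogeneous n 1 \<and> is_leading_monomial less_x l (single c 1) \<and>
     (\<exists>r \<in> lower w. x_poly l * mon (xy 0 w) + r \<in> J \<and> r \<in> homog y_weight (int (mdeg w)) \<and>
        r \<in> homog weight (wdeg gen_deg w + 1) \<and> (\<forall>t \<in> keys r. x_part t \<noteq> 0))"

text \<open>If \<open>u\<close> is the leading monomial of \<open>q\<close>, then \<open>u w\<close> is a leading monomial of \<open>J\<close>. By the \<open>x\<close>-condition it is a multiple of a leading monomial
  \<open>t\<close> of \<open>J\<close> with at most one factor \<open>x\<^sub>c\<close>; there is exactly one since the terms of elements of \<open>J\<close> involve some \<open>x\<^sub>i\<close>. Multiplying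
  by the missing \<open>y\<^sub>j\<close> turns \<open>t\<close> into \<open>x\<^sub>c w\<close>, and the form is found in the homogeneous component containing this term.\<close>
lemma linear_generator_exists:
  assumes w: "keys w \<subseteq> {..<m}" and q: "q \<in> colon w" and u: "is_leading_monomial less_x q u"
  shows "\<exists>c v l. u = v + single c 1 \<and> c < n \<and> linear_generator w c l"
proof -
  obtain r where r: "q \<in> polys {..<n}" "r \<in> lower w" "x_poly q * mon (xy 0 w) + r \<in> J"
    using q by (auto simp: colon_def)
  let ?p = "x_poly q * mon (xy 0 w) + r"
  have irr: "\<not> less_y w w" by (rule monomial_orderD(1)[OF order_y w])
  have rw: "less_y (y_part t) w" if "t \<in> keys r" for t using r(2) that by (simp add: lower_def)
  have pu: "xy u w \<in> keys ?p"
  proof -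
    have "lookup r (xy u w) = 0" using rw[of "xy u w"] irr by (auto simp: in_keys_iff)
    then show ?thesis using u by (simp add: is_leading_monomial_def in_keys_iff lookup_add lookup_x_poly_mult)
  qed
  have "is_leading_monomial lt ?p (xy u w)"
    unfolding is_leading_monomial_def
  proof (intro conjI ballI impI pu)
    fix t assume t: "t \<in> keys ?p" "t \<noteq> xy u w"
    then consider "t \<in> keys (x_poly q * mon (xy 0 w))" | "t \<in> keys r"
      using keys_add[of "x_poly q * mon (xy 0 w)" r] by blast
    then show "lt t (xy u w)"
    proof cases
      case 1
      then obtain v where "v \<in> keys q" "t = xy v w" by (auto simp: keys_x_poly_mult)
      then show ?thesis using t u by (auto simp: block_order_def is_leading_monomial_def)
    next
      case 2
      then show ?thesis using rw by (simp add: block_order_def)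
    qed
  qed
  then have plm: "is_leading_monomial lt ?p (xy u w)" .
  have "?p \<noteq> 0" using pu by auto
  moreover have "J \<subseteq> polys V" using J_polys by blast
  moreover have "\<forall>t\<in>B. mdeg (x_part t) \<le> 1" if "minimal_monomial_generators V (initial_ideal V lt J) B" for B
    using x_cond that unfolding x_condition_def by simp
  ultimately have "\<exists>t p0 s. p0 \<in> J \<and> p0 \<noteq> 0 \<and> is_leading_monomial lt p0 t \<and> xy u w = t + s \<and> mdeg (x_part t) \<le> 1"
    using r(3) plm by (intro leading_monomial_minimal_divisor)
  then obtain t p0 s where t: "p0 \<in> J" "p0 \<noteq> 0" "is_leading_monomial lt p0 t" "xy u w = t + s" "mdeg (x_part t) \<le> 1"
    by (elim exE conjE)
  have "x_part t \<noteq> 0" using J_x_part[OF t(1)] t(3) by (simp add: is_leading_monomial_def)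
  then have "mdeg (x_part t) = 1" using t(5) mdeg_eq_0_iff[of "x_part t"] by linarith
  then obtain c where c: "x_part t = single c 1" using mdeg_eq_1D[of "x_part t"] by (auto simp: int_mdeg[symmetric])
  have tV: "keys t \<subseteq> V" using J_polys[OF t(1)] t(3) by (auto simp: polys_iff is_leading_monomial_def)
  have cn: "c < n"
  proof -
    have "c \<in> keys (x_part t)" by (simp add: c)
    then show ?thesis using tV by (auto simp: keys_x_part)
  qed
  have uv: "u = x_part s + single c 1"
    using arg_cong[OF t(4), of x_part] by (simp add: x_part_add c add.commute)
  have wy: "w = y_part t + y_part s"
    using arg_cong[OF t(4), of y_part] by (simp add: y_part_add)
  have "xy u w \<in> keys ?p" by (rule pu)
  then have "keys (y_part s) \<subseteq> {..<m}" using w unfolding wy by (simp add: keys_plus_monomial)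
  then have sV: "keys (xy 0 (y_part s)) \<subseteq> V" by (auto simp: keys_xy)
  define p1 where "p1 = mon (xy 0 (y_part s)) * p0"
  have p1J: "p1 \<in> J" unfolding p1_def using t(1) sV by (intro J_mult polys_mon)
  have e: "xy 0 (y_part s) + t = xy (single c 1) w"
    by (rule monomial_parts_eqI) (simp_all add: x_part_add y_part_add c wy add.commute)
  have p1lm: "is_leading_monomial lt p1 (xy (single c 1) w)"
    using leading_monomial_mult[OF order J_polys[OF t(1)] sV t(3)] unfolding p1_def e .
  let ?e = "wdeg gen_deg w + 1"
  define p2 where "p2 = restr weight {?e} (restr y_weight {int (mdeg w)} p1)"
  have p2J: "p2 \<in> J" unfolding p2_def by (intro J_restr_weight J_restr_y_weight p1J)
  have p2lm: "is_leading_monomial lt p2 (xy (single c 1) w)"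
    using p1lm by (auto simp: is_leading_monomial_def p2_def keys_restr wdeg_y_weight wdeg_weight_xy)
  obtain l r2 where l: "p2 = x_poly l * mon (xy 0 w) + r2" "l \<in> polys {..<n}"
    and kl: "keys l = {u. xy u w \<in> keys p2}"
    and kr: "keys r2 = {t \<in> keys p2. y_part t \<noteq> w}"
    using y_coefficient[OF J_polys[OF p2J], of w] by blast
  have k2: "wdeg weight t = ?e" "mdeg (y_part t) = mdeg w" if "t \<in> keys p2" for t
    using that by (auto simp: p2_def keys_restr wdeg_y_weight)
  have "mdeg v = 1" if "v \<in> keys l" for v
    using k2(1)[of "xy v w"] that unfolding kl wdeg_weight_xy by simp
  then have l1: "l \<in> S_homogeneous n 1" using l(2) by (auto simp: S_homogeneous_def)
  have llm: "is_leading_monomial less_x l (single c 1)"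
    unfolding is_leading_monomial_def
  proof (intro conjI ballI impI)
    show "single c 1 \<in> keys l" using p2lm by (simp add: kl is_leading_monomial_def)
    fix v assume v: "v \<in> keys l" "v \<noteq> single c 1"
    then have "xy v w \<noteq> xy (single c 1) w" by (metis x_part_xy)
    then have "lt (xy v w) (xy (single c 1) w)"
      using p2lm v(1) unfolding kl is_leading_monomial_def by blast
    then show "less_x v (single c 1)" using irr by (simp add: block_order_def)
  qed
  have "r2 \<in> lower w"
  proof -
    have "r2 \<in> polys V" using J_polys[OF p2J] by (auto simp: polys_iff kr)
    moreover have "less_y (y_part t) w" if t: "t \<in> keys r2" for t
    proof -
      have "t \<in> keys p2" "y_part t \<noteq> w" using t by (auto simp: kr)
      moreover from this have "t \<noteq> xy (single c 1) w" by auto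
      ultimately have "lt t (xy (single c 1) w)" using p2lm unfolding is_leading_monomial_def by blast
      then show ?thesis using \<open>y_part t \<noteq> w\<close> by (simp add: block_order_def)
    qed
    ultimately show ?thesis by (simp add: lower_def)
  qed
  moreover have "r2 \<in> homog y_weight (int (mdeg w))" "r2 \<in> homog weight ?e" "\<forall>t \<in> keys r2. x_part t \<noteq> 0"
    using k2 J_x_part[OF p2J] by (auto simp: homog_def kr wdeg_y_weight)
  ultimately have "linear_generator w c l"
    unfolding linear_generator_def using l1 llm l(1) p2J by blast
  then show ?thesis using uv cn by blast
qed

text \<open>Division by the linear forms with the possible leading variables. As \<open>colon w\<close> is homogeneous, it suffices to divide homogeneous \<open>q\<close>,
  and then termination follows by counting the monomials of the same degree that are bounded by a term of \<open>q\<close>.\<close>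
lemma colon_linear:
  assumes w: "keys w \<subseteq> {..<m}"
  shows "\<exists>L. finite L \<and> L \<subseteq> S_homogeneous n 1 \<and> colon w = S_ideal n L \<and> (\<forall>l\<in>L. \<exists>c. linear_generator w c l)"
proof -
  define C where "C = {c. c < n \<and> (\<exists>l. linear_generator w c l)}"
  define l where "l c = (SOME l. linear_generator w c l)" for c
  have lg: "linear_generator w c (l c)" if "c \<in> C" for c
    unfolding l_def using that by (auto simp: C_def intro: someI_ex)
  let ?L = "l ` C"
  have L1: "?L \<subseteq> S_homogeneous n 1" using lg by (auto simp: linear_generator_def)
  have lc: "l c \<in> colon w" if "c \<in> C" for c
    using lg[OF that] by (auto simp: linear_generator_def colon_def S_homogeneous_iff)
  have "S_ideal n ?L \<subseteq> colon w"
    by (rule ideals.Sp_least) (use lc colon_0 colon_add colon_mult in auto)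
  moreover have hom: "q \<in> S_ideal n ?L" if "q \<in> colon w" "q \<in> S_homogeneous n (int d)" for q d
  proof -
    let ?Mon = "{t. keys t \<subseteq> {..<n} \<and> mdeg t = d}"
    define down where "down q = {t \<in> ?Mon. \<exists>s \<in> keys q. t = s \<or> less_x t s}" for q :: "(nat, 'k) mpoly"
    have fin: "finite (down q)" for q by (rule finite_subset[OF _ finite_monomials[of n d]]) (auto simp: down_def)
    show ?thesis using that
    proof (induction "card (down q)" arbitrary: q rule: less_induct)
      case less
      have qA: "q \<in> polys {..<n}" using less.prems by (simp add: S_homogeneous_iff)
      show ?case
      proof (cases "q = 0")
        case True
        then show ?thesis by (simp add: S_span_0)
      next
        case False
        then obtain u where u: "is_leading_monomial less_x q u" using leading_monomial_exists[OF order_x qA] by blast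
        then obtain c v where cv: "u = v + single c 1" "c \<in> C"
          using linear_generator_exists[OF w less.prems(1) u] unfolding C_def by blast
        note lin = lg[OF cv(2), unfolded linear_generator_def]
        have lS: "l c \<in> S_homogeneous n 1" and llm: "is_leading_monomial less_x (l c) (single c 1)"
          using lin by auto
        have lA: "l c \<in> polys {..<n}" using lS by (simp add: S_homogeneous_iff)
        have uq: "u \<in> keys q" using u by (simp add: is_leading_monomial_def)
        have uA: "keys u \<subseteq> {..<n}" using uq qA by (simp add: polys_iff)
        have ud: "mdeg u = d" using uq less.prems by (simp add: S_homogeneous_def)
        have vA: "keys v \<subseteq> {..<n}" using uA by (simp add: cv keys_plus_monomial)
        let ?a = "lookup (l c) (single c 1)"
        have a: "?a \<noteq> 0" using llm by (simp add: is_leading_monomial_def in_keys_iff)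
        define b where "b = lookup q u / ?a"
        define h where "h = single 0 b * (mon v * l c)"
        have multA: "single 0 b * mon v \<in> polys {..<n}"
          using vA by (intro polys_mult polys_single polys_mon) auto
        have hassoc: "h = (single 0 b * mon v) * l c" by (simp add: h_def mult.assoc)
        have hc: "h \<in> colon w" unfolding hassoc by (rule colon_mult[OF multA lc[OF cv(2)]])
        have "mon v \<in> S_homogeneous n (int (mdeg v))"
          using vA polys_mon by (simp add: S_homogeneous_iff int_mdeg mon_def homog_single polys_single)
        moreover have "int (mdeg v) + 1 = int d" using ud cv(1) by (simp add: mdeg_add)
        ultimately have "mon v * l c \<in> S_homogeneous n (int d)"
          using S_homogeneous_mult[of "mon v" n "int (mdeg v)" "l c" 1] lS by simp
        then have hS: "h \<in> S_homogeneous n (int d)" unfolding h_def by (rule S_homogeneous_scale)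
        have lookup_h: "lookup h t = b * lookup (mon v * l c) t" for t
          using lookup_mon_mult[of 0 "single 0 b * (mon v * l c)"] 
          by (simp add: h_def mult_map_scale_conv_mult[symmetric] map.rep_eq when_def)
        have mlm: "is_leading_monomial less_x (mon v * l c) u"
          unfolding cv(1) by (rule leading_monomial_mult[OF order_x lA vA llm])
        let ?q = "q - h"
        have "lookup (mon v * l c) u = ?a" unfolding cv(1) by (rule lookup_mon_mult)
        then have qu: "lookup ?q u = 0" using a by (simp add: lookup_minus lookup_h b_def)
        have lower: "less_x s u" if s: "s \<in> keys ?q" for s
        proof -
          have "s \<noteq> u" using s qu by (auto simp: in_keys_iff)
          moreover have "s \<in> keys q \<or> s \<in> keys (mon v * l c)"
            using s by (auto simp: in_keys_iff lookup_minus lookup_h)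
          ultimately show ?thesis using u mlm by (auto simp: is_leading_monomial_def)
        qed
        have q'S: "?q \<in> S_homogeneous n (int d)" using less.prems hS by (intro S_homogeneous_diff)
        have keysq': "keys s \<subseteq> {..<n}" if "s \<in> keys ?q" for s
          using q'S that by (auto simp: S_homogeneous_iff polys_iff)
        have below: "less_x t u" if td: "t \<in> down ?q" for t
        proof -
          obtain s where s: "s \<in> keys ?q" "t = s \<or> less_x t s" using td by (auto simp: down_def)
          have "keys t \<subseteq> {..<n}" using that by (simp add: down_def)
          then show ?thesis using s lower[OF s(1)] monomial_orderD(2)[OF order_x _ keysq'[OF s(1)] uA] by blast
        qed
        have "down ?q \<subseteq> down q - {u}"
        proof
          fix t assume t: "t \<in> down ?q"
          have "t \<noteq> u" using below[OF t] monomial_orderD(1)[OF order_x uA] by auto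
          then show "t \<in> down q - {u}" using below[OF t] t uq by (auto simp: down_def)
        qed
        moreover have "u \<in> down q" using uq uA ud by (auto simp: down_def)
        ultimately have "down ?q \<subset> down q" by blast
        then have "card (down ?q) < card (down q)" by (rule psubset_card_mono[OF fin])
        then have "?q \<in> S_ideal n ?L"
          using less.hyps[of ?q] colon_diff[OF less.prems(1) hc] q'S by blast
        moreover have "h \<in> S_ideal n ?L"
          unfolding hassoc using multA cv(2) by (intro ideals.Sp_act ideals.Sp_base) auto
        ultimately have "?q + h \<in> S_ideal n ?L" by (rule ideals.Sp_add)
        then show ?thesis by simp
      qed
    qed
  qed
  moreover have "colon w \<subseteq> S_ideal n ?L"
  proof
    fix q assume q: "q \<in> colon w"
    let ?D = "mdeg ` keys q"
    have qA: "q \<in> polys {..<n}" using q by (simp add: colon_def)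
    have "restr (\<lambda>_. 1) {int d} q \<in> S_ideal n ?L" for d
      using colon_restr[OF q] polys_restr[OF qA] restr_homog by (intro hom) (auto simp: S_homogeneous_iff)
    then have "(\<Sum>d\<in>?D. restr (\<lambda>_. 1) {int d} q) \<in> S_ideal n ?L" by (rule ideals.Sp_sum)
    moreover have "(\<Sum>d\<in>?D. restr (\<lambda>_. 1) {int d} q) = (\<Sum>d\<in>int ` ?D. restr (\<lambda>_. 1) {d} q)"
      by (simp add: sum.reindex)
    moreover have "\<dots> = q" by (rule sum_restr) (auto simp: int_mdeg[symmetric])
    ultimately show "q \<in> S_ideal n ?L" by simp
  qed
  moreover have "finite ?L" by (simp add: C_def)
  ultimately show ?thesis using L1 lg by (intro exI[of _ ?L]) blast
qed

end

section \<open>Linear quotients for the truncated symmetric powers\<close>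

context linear_initial_ideal
begin

definition T_act :: "(nat, 'k) mpoly \<Rightarrow> (nat + nat, 'k) mpoly \<Rightarrow> (nat + nat, 'k) mpoly" where
  "T_act s p = x_poly s * p"

sublocale T: S_action T_act n
  by unfold_locales (simp_all add: T_act_def x_poly_add x_poly_mult x_poly_1 algebra_simps)

lemma J_submodule: "S_submodule n T_act J"
  unfolding S_submodule_def T_act_def using J_zero J_add J_mult polys_x_poly by blast

abbreviation y_mon :: "nat monomial \<Rightarrow> (nat + nat, 'k) mpoly" where "y_mon w \<equiv> mon (xy 0 w)"

definition supported :: "nat monomial set \<Rightarrow> (nat + nat, 'k) mpoly set" where
  "supported F = {p \<in> polys V. \<forall>t \<in> keys p. y_part t \<in> F}"

definition contains_degree :: "int \<Rightarrow> nat monomial set \<Rightarrow> (nat + nat, 'k) mpoly set \<Rightarrow> bool" where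
  "contains_degree d F U \<longleftrightarrow> (\<forall>u w. w \<in> F \<longrightarrow> keys u \<subseteq> {..<n} \<longrightarrow> wdeg weight (xy u w) = d \<longrightarrow> mon (xy u w) \<in> U)"

text \<open>A monomial \<open>u w\<close> of weight at least \<open>d\<close> with \<open>deg w \<le> d\<close> is a multiple of one of weight \<open>d\<close> with the same \<open>w\<close>.\<close>
lemma contains_degree_supported:
  assumes U: "contains_degree d F (T.Sp X)" and p: "p \<in> supported F"
    and deg: "\<And>t. t \<in> keys p \<Longrightarrow> wdeg gen_deg (y_part t) \<le> d \<and> d \<le> wdeg weight t"
  shows "p \<in> T.Sp X"
proof (rule mpoly_keys_induct[of _ p])
  fix t a assume t: "t \<in> keys p"
  let ?w = "y_part t"
  define e where "e = nat (d - wdeg gen_deg ?w)"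
  have wt: "wdeg weight t = int (mdeg (x_part t)) + wdeg gen_deg ?w"
    using wdeg_weight_xy[of "x_part t" ?w] by (simp add: xy_parts)
  have e: "int e = d - wdeg gen_deg ?w" using deg[OF t] by (simp add: e_def)
  then have "e \<le> mdeg (x_part t)" using deg[OF t] wt by linarith
  then obtain s r where sr: "x_part t = s + r" "mdeg r = e" using monomial_split by blast
  have tV: "keys t \<subseteq> V" using p t by (auto simp: supported_def polys_iff)
  then have "keys (x_part t) \<subseteq> {..<n}" by (auto simp: keys_x_part)
  then have keys: "keys s \<subseteq> {..<n}" "keys r \<subseteq> {..<n}" by (simp_all add: sr keys_plus_monomial)
  have "?w \<in> F" using p t by (simp add: supported_def)
  moreover have "wdeg weight (xy r ?w) = d" using e sr(2) by (simp add: wdeg_weight_xy)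
  ultimately have "mon (xy r ?w) \<in> T.Sp X" using U keys(2) unfolding contains_degree_def by blast
  then have "T_act (single s a) (mon (xy r ?w)) \<in> T.Sp X"
    by (intro T.Sp_act polys_single keys(1))
  moreover have "T_act (single s a) (mon (xy r ?w)) = single t a"
    using xy_parts[of t] by (simp add: T_act_def x_poly_single_mult sr(1)[symmetric])
  ultimately show "single t a \<in> T.Sp X" by simp
qed (auto intro: S_span_0 T.Sp_add)

lemma supported_span: "X \<subseteq> supported F \<Longrightarrow> T.Sp X \<subseteq> supported F"
proof (rule T.Sp_least)
  show "v + w \<in> supported F" if "v \<in> supported F" "w \<in> supported F" for v w
    using that keys_add[of v w] by (auto simp: supported_def polys_add)
  show "T_act c v \<in> supported F" if c: "c \<in> polys {..<n}" and v: "v \<in> supported F" for c v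
  proof -
    have "y_part t \<in> F" if t: "t \<in> keys (x_poly c * v)" for t
    proof -
      obtain a b where ab: "t = a + b" "a \<in> keys (x_poly c :: (nat + nat, 'k) mpoly)" "b \<in> keys v"
        using t keys_mult[of "x_poly c" v] by blast
      have "y_part a = 0" using ab(2) by (auto simp: keys_x_poly)
      then show ?thesis using v ab by (simp add: supported_def y_part_add)
    qed
    then show ?thesis using v c by (simp add: T_act_def supported_def polys_mult polys_x_poly)
  qed
qed (auto simp: supported_def)

abbreviation y_monomials :: "nat \<Rightarrow> nat monomial set" where
  "y_monomials k \<equiv> {w. keys w \<subseteq> {..<m} \<and> mdeg w = k}"

lemma span_times_y_mon:
  assumes "q \<in> S_ideal n X"
  shows "x_poly q * y_mon w \<in> T.Sp ((\<lambda>u. x_poly u * y_mon w) ` X)"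
  using assms
proof induction
  case (S_span_step v c x)
  then have "x_poly v * y_mon w + T_act c (x_poly x * y_mon w) \<in> T.Sp ((\<lambda>u. x_poly u * y_mon w) ` X)"
    by (intro S_span.S_span_step) auto
  moreover have "x_poly v * y_mon w + T_act c (x_poly x * y_mon w) = x_poly (v + c * x) * y_mon w"
    by (simp add: T_act_def x_poly_add x_poly_mult algebra_simps)
  ultimately show ?case by simp
qed (simp add: S_span_0)

lemma span_times_y_mon_conv:
  assumes "p \<in> T.Sp ((\<lambda>u. x_poly u * y_mon w) ` X)"
  shows "\<exists>q \<in> S_ideal n X. p = x_poly q * y_mon w"
  using assms
proof induction
  case S_span_0
  show ?case by (intro bexI[of _ 0]) (auto intro: S_span.S_span_0)
next
  case (S_span_step v c x)
  then obtain q u where q: "q \<in> S_ideal n X" "v = x_poly q * y_mon w" and u: "u \<in> X" "x = x_poly u * y_mon w" by blast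
  have "q + c * u \<in> S_ideal n X" using q(1) S_span_step(2) u(1) by (rule S_span.S_span_step)
  moreover have "v + T_act c x = x_poly (q + c * u) * y_mon w"
    by (simp add: q u T_act_def x_poly_add x_poly_mult algebra_simps)
  ultimately show ?case by blast
qed

text \<open>One step of the construction, for the next \<open>y\<close>-monomial \<open>w\<close>. If \<open>deg w > d\<close>, there is nothing to add. Otherwise the new generators are the
  \<open>u w\<close> with \<open>u\<close> in the list that generates \<open>S/colon w\<close> in degrees \<open>\<ge> e = d - deg w\<close>. They keep its colon ideals, because
  for \<open>q\<close> of degree at least \<open>e\<close> the product \<open>q w\<close> is in the span of \<open>J\<close> and the earlier generators if and only if
  \<open>q \<in> colon w\<close>.\<close>
lemma linear_quotients_extend:
  assumes F: "F \<subseteq> y_monomials k" "\<And>v. v \<in> F \<Longrightarrow> less_y v w" "\<And>v. v \<in> y_monomials k \<Longrightarrow> less_y v w \<Longrightarrow> v \<in> F"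
    and w: "w \<in> y_monomials k"
    and ts: "linear_quotients n T_act J ts" "set ts \<subseteq> supported F \<inter> homog weight d" "contains_degree d F (T.Sp (J \<union> set ts))"
  shows "\<exists>ts'. linear_quotients n T_act J ts' \<and> set ts' \<subseteq> supported (insert w F) \<inter> homog weight d \<and>
           contains_degree d (insert w F) (T.Sp (J \<union> set ts'))"
proof (cases "wdeg gen_deg w \<le> d")
  case False
  have "wdeg weight (xy u w) \<noteq> d" for u using False by (simp add: wdeg_weight_xy)
  then have "contains_degree d (insert w F) (T.Sp (J \<union> set ts))"
    using ts(3) unfolding contains_degree_def by blast
  moreover have "set ts \<subseteq> supported (insert w F) \<inter> homog weight d" using ts(2) by (auto simp: supported_def)
  ultimately show ?thesis using ts(1) by blast
next
  case True
  define e where "e = nat (d - wdeg gen_deg w)"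
  have e: "int e = d - wdeg gen_deg w" using True by (simp add: e_def)
  have wm: "keys w \<subseteq> {..<m}" and wk: "mdeg w = k" using w by auto
  obtain L where L: "finite L" "L \<subseteq> S_homogeneous n 1" and colon: "colon w = S_ideal n L"
    and gens: "\<And>l. l \<in> L \<Longrightarrow> \<exists>c. linear_generator w c l"
    using colon_linear[OF wm] by blast
  have "var ` {..<n} \<subseteq> S_ideal n (L \<union> var ` {..<n})" by (auto intro: ideals.Sp_base)
  then obtain us where us: "set us \<subseteq> S_homogeneous n (int e)" "S_homogeneous n (int e) \<subseteq> S_ideal n (L \<union> set us)"
    and us_lq: "linear_quotients n (*) L us"
    using truncation_generators[OF _ order_refl L, of e] by auto
  let ?g = "\<lambda>u. x_poly u * y_mon w"
  let ?new = "map ?g us"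
  let ?U = "J \<union> set ts"
  have colon_in: "x_poly (restr (\<lambda>_. 1) {int e..} q) * y_mon w \<in> T.Sp ?U" if "q \<in> S_ideal n L" for q
    using that
  proof induction
    case (S_span_step v c l)
    \<comment> \<open>for \<open>e = 0\<close> this is \<open>c\<close> itself: the bound is an integer, not a truncated difference\<close>
    let ?c = "restr (\<lambda>_. 1) {int e - 1..} c"
    have l1: "l \<in> homog (\<lambda>_. 1) 1" using L(2) S_span_step(3) by (auto simp: S_homogeneous_iff)
    have cA: "?c \<in> polys {..<n}" using S_span_step(2) by (rule polys_restr)
    have split: "restr (\<lambda>_. 1) {int e..} (c * l) = ?c * l"
      by (rule restr_mult_homog[OF l1]) auto
    obtain r where r: "r \<in> lower w" "?g l + r \<in> J" "r \<in> homog y_weight (int k)"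
       "r \<in> homog weight (wdeg gen_deg w + 1)" "\<forall>t \<in> keys r. x_part t \<noteq> 0"
      using gens[OF S_span_step(3)] wk unfolding linear_generator_def by blast
    have "x_poly ?c * r \<in> T.Sp ?U"
    proof (rule contains_degree_supported[OF ts(3)])
      have keyr: "y_part b \<in> F \<and> wdeg gen_deg (y_part b) \<le> d \<and> wdeg weight b = wdeg gen_deg w + 1" if b: "b \<in> keys r" for b
      proof -
        have "keys b \<subseteq> V" using r(1) b by (auto simp: lower_def polys_iff)
        then have "keys (y_part b) \<subseteq> {..<m}" by (auto simp: keys_y_part)
        moreover have "mdeg (y_part b) = k" using r(3) b by (simp add: homog_y_weight_iff)
        moreover have "less_y (y_part b) w" using r(1) b by (simp add: lower_def)
        ultimately have "y_part b \<in> F" using F(3) by simp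
        have wt: "wdeg weight b = wdeg gen_deg w + 1" using r(4) b by (simp add: homog_def)
        have "mdeg (x_part b) \<noteq> 0" using r(5) b by (simp add: mdeg_eq_0_iff)
        then have "wdeg gen_deg (y_part b) \<le> wdeg gen_deg w"
          using wt wdeg_weight_xy[of "x_part b" "y_part b"] by (simp add: xy_parts)
        then show ?thesis using \<open>y_part b \<in> F\<close> wt True by simp
      qed
      have key: "\<exists>b \<in> keys r. y_part t = y_part b \<and> wdeg weight t \<ge> int e - 1 + wdeg weight b"
        if t: "t \<in> keys (x_poly ?c * r)" for t
      proof -
        obtain a b where ab: "t = a + b" "a \<in> keys (x_poly ?c :: (nat + nat, 'k) mpoly)" "b \<in> keys r"
          using t keys_mult[of "x_poly ?c" r] by blast
        then obtain u where u: "u \<in> keys ?c" "a = xy u 0" by (auto simp only: keys_x_poly)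
        have "int (mdeg u) \<ge> int e - 1" using u(1) by (simp add: keys_restr int_mdeg)
        then have "wdeg weight a \<ge> int e - 1" by (simp add: u(2) wdeg_weight_xy)
        then show ?thesis using ab u(2) by (intro bexI[of _ b]) (simp_all add: y_part_add wdeg_add)
      qed
      have "r \<in> polys V" using r(1) by (simp add: lower_def)
      then have "x_poly ?c * r \<in> polys V" by (rule polys_mult[OF polys_x_poly[OF cA]])
      moreover have "y_part t \<in> F" if "t \<in> keys (x_poly ?c * r)" for t
        using key[OF that] keyr by auto
      ultimately show "x_poly ?c * r \<in> supported F" unfolding supported_def by blast
      fix t assume "t \<in> keys (x_poly ?c * r)"
      then obtain b where b: "b \<in> keys r" "y_part t = y_part b" "wdeg weight t \<ge> int e - 1 + wdeg weight b"
        using key by blast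
      then show "wdeg gen_deg (y_part t) \<le> d \<and> d \<le> wdeg weight t" using keyr[OF b(1)] e by simp
    qed
    moreover have "x_poly ?c * (?g l + r) \<in> T.Sp ?U"
      using J_mult[OF polys_x_poly[OF cA] r(2)] by (intro T.Sp_base) simp
    ultimately have "x_poly ?c * (?g l + r) - x_poly ?c * r \<in> T.Sp ?U" by (rule T.Sp_diff[rotated])
    then have "x_poly (?c * l) * y_mon w \<in> T.Sp ?U" by (simp add: x_poly_mult algebra_simps)
    then have "x_poly (restr (\<lambda>_. 1) {int e..} v) * y_mon w + x_poly (?c * l) * y_mon w \<in> T.Sp ?U"
      using S_span_step.IH by (intro T.Sp_add)
    then show ?case by (simp only: restr_add split x_poly_add distrib_right)
  qed (simp add: S_span_0)
  have in_span: "?g q \<in> T.Sp (?U \<union> ?g ` X)"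
    if q: "q \<in> S_ideal n (L \<union> X)" and qd: "restr (\<lambda>_. 1) {int e..} q = q" and X: "X \<subseteq> S_homogeneous n (int e)" for q X
  proof -
    obtain l x where lx: "l \<in> S_ideal n L" "x \<in> S_ideal n X" "q = l + x" using q unfolding ideals.Sp_Un by blast
    have "restr (\<lambda>_. 1) {int e..} l + x = l + x"
      using qd unfolding lx(3) restr_add S_ideal_high_degree[OF X lx(2)] .
    then have "restr (\<lambda>_. 1) {int e..} l = l" by simp
    then have "?g l \<in> T.Sp ?U" using colon_in[OF lx(1)] by simp
    then have "?g l + ?g x \<in> T.Sp (?U \<union> ?g ` X)"
      using T.Sp_Un[of "?g l + ?g x" ?U "?g ` X"] span_times_y_mon[OF lx(2), of w] by blast
    then show ?thesis by (simp add: lx(3) x_poly_add distrib_right)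
  qed
  have in_colon: "q \<in> S_ideal n (L \<union> X)" if q: "q \<in> polys {..<n}" "?g q \<in> T.Sp (?U \<union> ?g ` X)"
     and X: "X \<subseteq> S_homogeneous n (int e)" for q X
  proof -
    obtain p z where pz: "p \<in> T.Sp (J \<union> set ts)" "z \<in> T.Sp (?g ` X)" "?g q = p + z"
      using q(2) T.Sp_Un[of "?g q" ?U "?g ` X"] by blast
    obtain j y where jy: "j \<in> J" "y \<in> T.Sp (set ts)" "p = j + y"
      using pz(1) T.Sp_Un[of p J "set ts"] unfolding T.Sp_submodule[OF J_submodule] by blast
    obtain x where x: "x \<in> S_ideal n X" "z = ?g x" using span_times_y_mon_conv[OF pz(2)] by blast
    have "X \<subseteq> polys {..<n}" using X by (auto simp: S_homogeneous_iff)
    then have xA: "x \<in> polys {..<n}" using x(1) S_ideal_polys by blast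
    have "set ts \<subseteq> supported F" using ts(2) by blast
    then have "y \<in> supported F" using jy(2) supported_span by blast
    then have "- y \<in> lower w" using F(2) by (auto simp: supported_def lower_def polys_uminus)
    moreover have "?g (q - x) + (- y) = j"
      using pz(3) by (simp add: x_poly_diff left_diff_distrib x(2)[symmetric] jy(3))
    ultimately have "q - x \<in> colon w" using jy(1) polys_diff[OF q(1) xA] unfolding colon_def by blast
    then have "(q - x) + x \<in> S_ideal n (L \<union> X)"
      using x(1) ideals.Sp_Un[of "(q - x) + x" n L X] unfolding colon by blast
    then show ?thesis by simp
  qed
  have "linear_quotients n T_act ?U ?new"
  proof (rule linear_quotients_transfer[OF us_lq])
    fix i and c :: "(nat, 'k) mpoly" assume i: "i < length us" and c: "c \<in> polys {..<n}"
    let ?X = "set (take i us)"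
    have X: "?X \<subseteq> S_homogeneous n (int e)" using us(1) by (auto dest: in_set_takeD)
    have ui: "us ! i \<in> S_homogeneous n (int e)" using us(1) nth_mem[OF i] by blast
    have "c * us ! i \<in> S_ideal n {us ! i}" using c by (intro ideals.Sp_act ideals.Sp_base) auto
    then have cd: "restr (\<lambda>_. 1) {int e..} (c * us ! i) = c * us ! i"
      using ui by (intro S_ideal_high_degree[where X = "{us ! i}"]) auto
    have cA: "c * us ! i \<in> polys {..<n}" using c ui by (intro polys_mult) (auto simp: S_homogeneous_iff)
    have "?g (c * us ! i) \<in> T.Sp (?U \<union> ?g ` ?X) \<longleftrightarrow> c * us ! i \<in> S_ideal n (L \<union> ?X)"
      using in_span[OF _ cd X] in_colon[OF cA _ X] by blast
    moreover have "T_act c (?new ! i) = ?g (c * us ! i)" using i by (simp add: T_act_def x_poly_mult mult.assoc)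
    moreover have "set (take i ?new) = ?g ` ?X" by (simp add: take_map)
    ultimately show "T_act c (?new ! i) \<in> T.Sp (?U \<union> set (take i ?new)) \<longleftrightarrow> c * us ! i \<in> S_ideal n (L \<union> ?X)" by simp
  qed simp
  then have "linear_quotients n T_act J (ts @ ?new)"
    using ts(1) by (simp only: linear_quotients_append_list)
  moreover have "set (ts @ ?new) \<subseteq> supported (insert w F) \<inter> homog weight d"
  proof -
    have "?g u \<in> supported (insert w F) \<inter> homog weight d" if u: "u \<in> set us" for u
    proof -
      have uS: "u \<in> S_homogeneous n (int e)" using us(1) u by blast
      have "x_poly u \<in> homog weight (int e)" by (rule homog_x_poly[OF uS]) (simp add: weight_def)
      moreover have "y_mon w \<in> homog weight (wdeg gen_deg w)" by (simp add: mon_def homog_single wdeg_weight_xy)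
      ultimately have "?g u \<in> homog weight d" by (rule homog_mult') (simp add: e)
      moreover have "?g u \<in> polys V"
        using uS wm by (intro polys_mult polys_x_poly polys_mon) (auto simp: S_homogeneous_iff keys_xy)
      moreover have "\<forall>t \<in> keys (?g u). y_part t = w" by (auto simp: keys_x_poly_mult)
      ultimately show ?thesis by (simp add: supported_def)
    qed
    moreover have "supported F \<subseteq> supported (insert w F)" by (auto simp: supported_def)
    ultimately show ?thesis using ts(2) by auto
  qed
  moreover have "contains_degree d (insert w F) (T.Sp (J \<union> set (ts @ ?new)))"
  proof -
    have new: "set (ts @ ?new) = set ts \<union> ?g ` set us" by auto
    have sub: "T.Sp (J \<union> set ts) \<subseteq> T.Sp (J \<union> set (ts @ ?new))" by (rule S_span_mono) auto
    have "mon (xy u v) \<in> T.Sp (J \<union> set (ts @ ?new))"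
      if "v \<in> insert w F" "keys u \<subseteq> {..<n}" "wdeg weight (xy u v) = d" for u v
    proof (cases "v \<in> F")
      case True
      then show ?thesis using ts(3) that sub unfolding contains_degree_def by blast
    next
      case False
      then have vw: "v = w" using that(1) by simp
      then have "int (mdeg u) = int e" using that(3) e by (simp add: wdeg_weight_xy)
      then have "wdeg (\<lambda>_. 1) u = int e" by (simp only: int_mdeg)
      then have mu: "(mon u :: (nat, 'k) mpoly) \<in> S_homogeneous n (int e)"
        using that(2) by (simp add: S_homogeneous_iff polys_mon) (simp add: mon_def homog_single)
      then have "restr (\<lambda>_. 1) {int e..} (mon u) = (mon u :: (nat, 'k) mpoly)"
        using restr_of_homog[of "mon u :: (nat, 'k) mpoly" "\<lambda>_. 1" "int e" "{int e..}"] by (simp add: S_homogeneous_iff)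
      moreover have "mon u \<in> S_ideal n (L \<union> set us)" using mu us(2) by blast
      ultimately have "?g (mon u) \<in> T.Sp (?U \<union> ?g ` set us)" using in_span us(1) by blast
      moreover have "?g (mon u) = mon (xy u v)"
        using x_poly_single_mult[of u 1 0 w] by (simp add: mon_def vw)
      ultimately show ?thesis unfolding new by (simp add: Un_assoc)
    qed
    then show ?thesis unfolding contains_degree_def by blast
  qed
  ultimately show ?thesis by blast
qed

text \<open>Induction over the initial segments of the \<open>y\<close>-monomials of degree \<open>k\<close>; the largest monomial is added last.\<close>
lemma linear_quotients_initial_segment:
  assumes "F \<subseteq> y_monomials k" "\<And>v w. w \<in> F \<Longrightarrow> v \<in> y_monomials k \<Longrightarrow> less_y v w \<Longrightarrow> v \<in> F"
  shows "\<exists>ts. linear_quotients n T_act J ts \<and> set ts \<subseteq> supported F \<inter> homog weight d \<and>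
           contains_degree d F (T.Sp (J \<union> set ts))"
  using assms
proof (induction "card F" arbitrary: F)
  case 0
  then have "F = {}" using finite_subset[OF 0(2) finite_monomials] by simp
  then show ?case by (intro exI[of _ "[]"]) (simp add: linear_quotients_def contains_degree_def)
next
  case (Suc N)
  have fin: "finite F" using finite_subset[OF Suc.prems(1) finite_monomials] .
  have "F \<noteq> {}" using Suc.hyps(2) by auto
  have keys: "keys v \<subseteq> {..<m}" if "v \<in> F" for v using that Suc.prems(1) by blast
  obtain w where w: "w \<in> F" "\<forall>v\<in>F. v \<noteq> w \<longrightarrow> less_y v w"
    using finite_monomials_max[OF order_y fin \<open>F \<noteq> {}\<close> keys] by blast
  let ?F = "F - {w}"
  have F': "?F \<subseteq> y_monomials k" using Suc.prems(1) by blast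
  have closed: "v \<in> ?F" if v: "u \<in> ?F" "v \<in> y_monomials k" "less_y v u" for u v
  proof -
    have "v \<in> F" using Suc.prems(2) v by blast
    moreover have "v \<noteq> w"
    proof
      assume "v = w"
      then have "less_y w u" "less_y u w" using v w by auto
      then show False
        using monomial_orderD(1,2)[OF order_y] keys[OF w(1)] keys[of u] v(1) by blast
    qed
    ultimately show ?thesis by blast
  qed
  have "N = card ?F" using Suc.hyps(2) fin w(1) by simp
  then have "\<exists>ts. linear_quotients n T_act J ts \<and> set ts \<subseteq> supported ?F \<inter> homog weight d \<and>
      contains_degree d ?F (T.Sp (J \<union> set ts))"
    using F' by (rule Suc.hyps(1)) (rule closed)
  then obtain ts where ts: "linear_quotients n T_act J ts"
    "set ts \<subseteq> supported ?F \<inter> homog weight d" "contains_degree d ?F (T.Sp (J \<union> set ts))" by blast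
  have below: "v \<in> ?F" if v: "v \<in> y_monomials k" "less_y v w" for v
  proof -
    have "v \<in> F" using Suc.prems(2)[OF w(1) v] .
    moreover have "v \<noteq> w" using monomial_orderD(1)[OF order_y keys[OF w(1)]] v(2) by blast
    ultimately show ?thesis by blast
  qed
  have wk: "w \<in> y_monomials k" using w(1) Suc.prems(1) by blast
  have "\<exists>ts. linear_quotients n T_act J ts \<and> set ts \<subseteq> supported (insert w ?F) \<inter> homog weight d \<and>
      contains_degree d (insert w ?F) (T.Sp (J \<union> set ts))"
  proof (rule linear_quotients_extend[OF F'])
    show "less_y v w" if "v \<in> ?F" for v using w(2) that by blast
    show "v \<in> ?F" if "v \<in> y_monomials k" "less_y v w" for v using that by (rule below)
  qed (rule wk ts)+
  moreover have "insert w ?F = F" using w(1) by blast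
  ultimately show ?case by (simp only:)
qed

lemma syzygies_T_restr:
  assumes ts: "set ts \<subseteq> polys V \<inter> homog weight d" and u: "u \<in> syzygies n T_act J ts"
  shows "(\<lambda>i. restr (\<lambda>_. 1) {1} (u i)) \<in> syzygies n T_act J ts"
proof -
  have uv: "u \<in> vecs n (length ts)" and uJ: "lincomb T_act ts u \<in> J" using u by (auto simp: syzygies_def)
  have "lincomb T_act ts (\<lambda>i. restr (\<lambda>_. 1) {1} (u i)) = (\<Sum>i<length ts. restr weight {d + 1} (T_act (u i) (ts ! i)))"
    unfolding lincomb_def
  proof (rule sum.cong)
    fix i assume "i \<in> {..<length ts}"
    then have "ts ! i \<in> homog weight d" using ts nth_mem[of i ts] by auto
    then have "restr weight {d + 1} (x_poly (u i) * ts ! i) = restr weight {1} (x_poly (u i)) * ts ! i"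
      by (rule restr_mult_homog) auto
    also have "restr weight {1} (x_poly (u i)) = x_poly (restr (\<lambda>_. 1) {1} (u i))"
      by (rule restr_x_poly) (simp add: weight_def)
    finally show "T_act (restr (\<lambda>_. 1) {1} (u i)) (ts ! i) = restr weight {d + 1} (T_act (u i) (ts ! i))"
      by (simp add: T_act_def)
  qed simp
  also have "\<dots> = restr weight {d + 1} (lincomb T_act ts u)" by (simp add: lincomb_def restr_sum)
  also have "\<dots> \<in> J" by (rule J_restr_weight[OF uJ])
  finally have "lincomb T_act ts (\<lambda>i. restr (\<lambda>_. 1) {1} (u i)) \<in> J" .
  moreover have "(\<lambda>i. restr (\<lambda>_. 1) {1} (u i)) \<in> vecs n (length ts)" using uv by (simp add: vecs_iff polys_restr)
  ultimately show ?thesis by (simp add: syzygies_def)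
qed

section \<open>Symmetric powers\<close>

lemma sym_power_ops:
  "\<zero>\<^bsub>sym_power n M k\<^esub> = pres 0"
  "a \<oplus>\<^bsub>sym_power n M k\<^esub> b = a \<oplus>\<^bsub>sym_algebra n M\<^esub> b"
  "c \<odot>\<^bsub>sym_power n M k\<^esub> b = c \<odot>\<^bsub>sym_algebra n M\<^esub> b"
  by (simp_all add: sym_power_def sym_algebra_ops pres_eq rho_def cls_zero)

abbreviation forms where "forms k \<equiv> polys V \<inter> homog y_weight (int k)"

lemma forms_0: "0 \<in> forms k" and forms_add: "p \<in> forms k \<Longrightarrow> q \<in> forms k \<Longrightarrow> p + q \<in> forms k"
  and forms_uminus: "p \<in> forms k \<Longrightarrow> - p \<in> forms k"
  by (auto intro: polys_add homog_add polys_uminus homog_uminus)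

lemma forms_act:
  assumes "c \<in> polys {..<n}" "p \<in> forms k" shows "T_act c p \<in> forms k"
proof -
  have "x_poly c \<in> homog y_weight 0" using assms(1) by (rule homog_x_poly_0) simp
  then have "x_poly c * p \<in> homog y_weight (int k)" using assms(2) by (intro homog_mult'[where d = 0]) auto
  then show ?thesis using assms by (simp add: T_act_def polys_mult polys_x_poly)
qed

lemma pres_T_act: "c \<in> polys {..<n} \<Longrightarrow> p \<in> polys V \<Longrightarrow> pres (T_act c p) = c \<odot>\<^bsub>sym_algebra n M\<^esub> pres p"
  by (simp add: T_act_def pres_smult)

text \<open>The inverse is taken inside the symmetric power, as demanded by the notion of a submodule.\<close>
lemma sym_power_m_inv:
  assumes p: "p \<in> forms k"
  shows "inv\<^bsub>add_monoid (sym_power n M k)\<^esub> (pres p) = pres (- p)"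
proof -
  have add: "pres p \<oplus>\<^bsub>sym_power n M k\<^esub> pres q = pres (p + q)" if "q \<in> forms k" for q
    using p that by (simp add: sym_power_ops pres_add)
  have add': "pres q \<oplus>\<^bsub>sym_power n M k\<^esub> pres p = pres (p + q)" if "q \<in> forms k" for q
    using p that pres_add[of q p] by (simp add: sym_power_ops add.commute)
  have mp: "- p \<in> forms k" using p by (rule forms_uminus)
  have "(THE y. y \<in> carrier (sym_power n M k) \<and> pres p \<oplus>\<^bsub>sym_power n M k\<^esub> y = pres 0 \<and>
     y \<oplus>\<^bsub>sym_power n M k\<^esub> pres p = pres 0) = pres (- p)"
  proof (rule the_equality)
    show "pres (- p) \<in> carrier (sym_power n M k) \<and> pres p \<oplus>\<^bsub>sym_power n M k\<^esub> pres (- p) = pres 0 \<and>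
       pres (- p) \<oplus>\<^bsub>sym_power n M k\<^esub> pres p = pres 0"
      using mp unfolding add[OF mp] add'[OF mp] sym_power_carrier by simp
    fix y assume y: "y \<in> carrier (sym_power n M k) \<and> pres p \<oplus>\<^bsub>sym_power n M k\<^esub> y = pres 0 \<and>
       y \<oplus>\<^bsub>sym_power n M k\<^esub> pres p = pres 0"
    then obtain q where q: "q \<in> forms k" "y = pres q" unfolding sym_power_carrier by blast
    have "pres (p + q) = pres 0" using y add[OF q(1)] q(2) by simp
    then have "q - (- p) \<in> J" using p q(1) pres_eq_iff[of "p + q" 0] by (simp add: polys_add add.commute)
    then show "y = pres (- p)" using p q by (simp add: pres_eq_iff polys_uminus)
  qed
  then show ?thesis by (simp add: m_inv_def sym_power_ops)
qed

lemma sym_power_submodule: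
  assumes X: "X \<subseteq> forms k"
  shows "submodule (pres ` T.Sp X) (S_ring n) (sym_power n M k)"
proof -
  have XF: "T.Sp X \<subseteq> forms k"
    by (rule T.Sp_least) (use X forms_0 forms_add forms_act in \<open>blast+\<close>)
  have XV: "T.Sp X \<subseteq> polys V" using XF by blast
  show ?thesis
  proof (intro submodule.intro subgroup.intro submodule_axioms.intro)
    show "pres ` T.Sp X \<subseteq> carrier (add_monoid (sym_power n M k))"
      using XF by (auto simp: sym_power_carrier)
    show "\<one>\<^bsub>add_monoid (sym_power n M k)\<^esub> \<in> pres ` T.Sp X"
      using S_span_0 by (auto simp: sym_power_ops)
    fix a assume "a \<in> pres ` T.Sp X"
    then obtain p where p: "p \<in> T.Sp X" "a = pres p" by blast
    have "inv\<^bsub>add_monoid (sym_power n M k)\<^esub> a = pres (- p)"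
      using sym_power_m_inv[of p k] p XF by auto
    then show "inv\<^bsub>add_monoid (sym_power n M k)\<^esub> a \<in> pres ` T.Sp X" using T.Sp_uminus[OF p(1)] by simp
    fix b assume "b \<in> pres ` T.Sp X"
    then obtain q where q: "q \<in> T.Sp X" "b = pres q" by blast
    have "a \<otimes>\<^bsub>add_monoid (sym_power n M k)\<^esub> b = pres (p + q)"
      using p q XV by (simp add: sym_power_ops pres_add subset_iff)
    then show "a \<otimes>\<^bsub>add_monoid (sym_power n M k)\<^esub> b \<in> pres ` T.Sp X" using T.Sp_add[OF p(1) q(1)] by simp
  next
    fix c :: "(nat, 'k) mpoly" and a assume c: "c \<in> polys {..<n}" and "a \<in> pres ` T.Sp X"
    then obtain p where p: "p \<in> T.Sp X" "a = pres p" by blast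
    have "c \<odot>\<^bsub>sym_power n M k\<^esub> a = pres (T_act c p)"
      using p XV c pres_T_act[of c p] by (simp add: sym_power_ops subset_iff)
    then show "c \<odot>\<^bsub>sym_power n M k\<^esub> a \<in> pres ` T.Sp X" using T.Sp_act[OF c p(1)] by simp
  qed
qed

lemma sym_power_generated_submodule:
  assumes ts: "set ts \<subseteq> forms k \<inter> homog weight d"
    and all: "forms k \<inter> homog weight d \<subseteq> T.Sp (J \<union> set ts)"
  shows "generated_submodule n (sym_power n M k) (sym_power_grading n M G k d) = pres ` T.Sp (set ts)"
proof
  have tsF: "set ts \<subseteq> forms k" using ts by blast
  have spV: "T.Sp (set ts) \<subseteq> polys V"
    by (rule T.Sp_least) (use tsF in \<open>auto simp: T_act_def intro: polys_add polys_mult polys_x_poly\<close>)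
  have "sym_power_grading n M G k d \<subseteq> pres ` T.Sp (set ts)"
  proof
    fix c assume "c \<in> sym_power_grading n M G k d"
    then obtain p where p: "p \<in> forms k \<inter> homog weight d" "c = pres p" unfolding sym_power_grading_eq by blast
    then have "p \<in> T.Sp (J \<union> set ts)" using all by blast
    then obtain j q where jq: "j \<in> J" "q \<in> T.Sp (set ts)" "p = j + q"
      unfolding T.Sp_Un T.Sp_submodule[OF J_submodule] by blast
    then have "pres p = pres q" using p spV J_polys by (subst pres_eq_iff) auto
    then show "c \<in> pres ` T.Sp (set ts)" using p(2) jq(2) by blast
  qed
  then show "generated_submodule n (sym_power n M k) (sym_power_grading n M G k d) \<subseteq> pres ` T.Sp (set ts)"
    using sym_power_submodule[OF tsF] unfolding generated_submodule_def by blast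
  show "pres ` T.Sp (set ts) \<subseteq> generated_submodule n (sym_power n M k) (sym_power_grading n M G k d)"
    unfolding generated_submodule_def
  proof (rule Inter_greatest)
    fix H assume "H \<in> {H. submodule H (S_ring n) (sym_power n M k) \<and> sym_power_grading n M G k d \<subseteq> H}"
    then have sub: "submodule H (S_ring n) (sym_power n M k)" and GH: "sym_power_grading n M G k d \<subseteq> H" by auto
    have sg: "subgroup H (add_monoid (sym_power n M k))" by (rule submodule.axioms(1)[OF sub])
    let ?P = "{p \<in> polys V. pres p \<in> H}"
    have "T.Sp (set ts) \<subseteq> ?P"
    proof (rule T.Sp_least)
      show "set ts \<subseteq> ?P"
      proof
        fix t assume "t \<in> set ts"
        then have "t \<in> polys V" "pres t \<in> sym_power_grading n M G k d" using ts unfolding sym_power_grading_eq by blast+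
        then show "t \<in> ?P" using GH by blast
      qed
      show "0 \<in> ?P" using subgroup.one_closed[OF sg] by (simp add: sym_power_ops)
      show "v + w \<in> ?P" if "v \<in> ?P" "w \<in> ?P" for v w
        using that subgroup.m_closed[OF sg, of "pres v" "pres w"] by (simp add: sym_power_ops pres_add polys_add)
      show "T_act c v \<in> ?P" if "c \<in> polys {..<n}" "v \<in> ?P" for c v
        using that submodule.smult_closed[OF sub, of c "pres v"] pres_T_act[of c v]
        by (simp add: sym_power_ops) (simp add: T_act_def polys_mult polys_x_poly)
    qed
    then show "pres ` T.Sp (set ts) \<subseteq> H" by blast
  qed
qed

text \<open>The list of elements of degree \<open>d\<close> with linear quotients gives the start of the resolution: the augmentation \<open>\<epsilon>\<close> has as kernel
  the relations of the list modulo \<open>J\<close>.\<close>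
theorem sym_power_componentwise_linear:
  "componentwise_linear n (sym_power n M k) (sym_power_grading n M G k)"
  unfolding componentwise_linear_def Let_def
proof (rule allI)
  fix d :: int
  let ?N = "sym_power n M k" and ?G = "sym_power_grading n M G k"
  let ?H = "generated_submodule n ?N (?G d)"
  obtain ts where lq: "linear_quotients n T_act J ts"
    and ts: "set ts \<subseteq> supported (y_monomials k) \<inter> homog weight d"
    and deg: "contains_degree d (y_monomials k) (T.Sp (J \<union> set ts))"
    using linear_quotients_initial_segment[of "y_monomials k" k d] by blast
  have supp: "supported (y_monomials k) = (forms k :: (nat + nat, 'k) mpoly set)"
  proof
    show "supported (y_monomials k) \<subseteq> forms k" by (auto simp: supported_def homog_y_weight_iff)
    show "forms k \<subseteq> supported (y_monomials k)"
    proof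
      fix p :: "(nat + nat, 'k) mpoly" assume p: "p \<in> forms k"
      have "keys (y_part t) \<subseteq> {..<m}" if "t \<in> keys p" for t
      proof -
        have "keys t \<subseteq> V" using p that by (auto simp: polys_iff)
        then show ?thesis by (auto simp: keys_y_part)
      qed
      then show "p \<in> supported (y_monomials k)" using p by (auto simp: supported_def homog_y_weight_iff)
    qed
  qed
  have tsF: "set ts \<subseteq> forms k \<inter> homog weight d" using ts supp by blast
  have all: "forms k \<inter> homog weight d \<subseteq> T.Sp (J \<union> set ts)"
  proof
    fix p :: "(nat + nat, 'k) mpoly" assume p: "p \<in> forms k \<inter> homog weight d"
    show "p \<in> T.Sp (J \<union> set ts)"
    proof (rule contains_degree_supported[OF deg])
      show "p \<in> supported (y_monomials k)" using p supp by blast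
      fix t assume "t \<in> keys p"
      then have "wdeg weight t = d" using p by (simp add: homog_def)
      then show "wdeg gen_deg (y_part t) \<le> d \<and> d \<le> wdeg weight t"
        using wdeg_weight_xy[of "x_part t" "y_part t"] by (simp add: xy_parts)
    qed
  qed
  have H: "?H = pres ` T.Sp (set ts)" by (rule sym_power_generated_submodule[OF tsF all])
  define \<epsilon> where "\<epsilon> u = pres (lincomb T_act ts u)" for u
  let ?s = "length ts"
  have lcF: "lincomb T_act ts u \<in> forms k" if u: "u \<in> vecs n ?s" for u
  proof -
    have "T.Sp (set ts) \<subseteq> forms k"
      by (rule T.Sp_least) (use tsF forms_0 forms_add forms_act in \<open>blast+\<close>)
    then show ?thesis using T.lincomb_in_Sp[OF u, of ts] by blast
  qed
  then have lcV: "lincomb T_act ts u \<in> polys V" if "u \<in> vecs n ?s" for u using that by blast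
  have image: "\<epsilon> ` vecs n ?s = ?H"
    unfolding H T.Sp_set_eq \<epsilon>_def by (simp add: image_image)
  have kernel: "a_kernel (free_module n ?s) (?N\<lparr>carrier := ?H\<rparr>) \<epsilon> = syzygies n T_act J ts"
  proof -
    have "\<epsilon> u = pres 0 \<longleftrightarrow> lincomb T_act ts u \<in> J" if "u \<in> vecs n ?s" for u
      using pres_eq_iff[OF lcV[OF that] polys_0] by (simp add: \<epsilon>_def)
    then show ?thesis by (auto simp: a_kernel_def' syzygies_def sym_power_ops)
  qed
  have "linear_relation_module n ?s (syzygies n T_act J ts)"
  proof (rule T.linear_relation_moduleI[OF J_submodule lq])
    have "set ts \<subseteq> polys V \<inter> homog weight d" using tsF by blast
    then show "(\<lambda>i. restr (\<lambda>_. 1) {1} (u i)) \<in> syzygies n T_act J ts" if "u \<in> syzygies n T_act J ts" for u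
      using that by (rule syzygies_T_restr)
  qed
  then have rel: "linear_relation_module n ?s (a_kernel (free_module n ?s) (?N\<lparr>carrier := ?H\<rparr>) \<epsilon>)" by (simp only: kernel)
  have hom: "graded_hom n (free_module n ?s) (shifted_grading n ?s (\<lambda>_. d)) (?N\<lparr>carrier := ?H\<rparr>) (\<lambda>e. ?H \<inter> ?G e) \<epsilon>"
    unfolding graded_hom_def
  proof (intro conjI ballI allI)
    show "\<epsilon> \<in> vecs n ?s \<rightarrow> carrier (?N\<lparr>carrier := ?H\<rparr>)" using image by auto
    show "\<epsilon> (u \<oplus>\<^bsub>free_module n ?s\<^esub> v) = \<epsilon> u \<oplus>\<^bsub>?N\<lparr>carrier := ?H\<rparr>\<^esub> \<epsilon> v" if "u \<in> vecs n ?s" "v \<in> vecs n ?s" for u v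
    proof -
      have "u \<oplus>\<^bsub>free_module n ?s\<^esub> v = u + v" by (simp add: free_module_def plus_fun_def)
      then show ?thesis
        using pres_add[OF lcV[OF that(1)] lcV[OF that(2)]] T.lincomb_add[of ts u v] by (simp add: \<epsilon>_def sym_power_ops)
    qed
    show "\<epsilon> (c \<odot>\<^bsub>free_module n ?s\<^esub> u) = c \<odot>\<^bsub>?N\<lparr>carrier := ?H\<rparr>\<^esub> \<epsilon> u" if "c \<in> polys {..<n}" "u \<in> vecs n ?s" for c u
    proof -
      have "c \<odot>\<^bsub>free_module n ?s\<^esub> u = scale_vec c u" by (simp add: free_module_def scale_vec_def)
      then show ?thesis
        using pres_T_act[OF that(1) lcV[OF that(2)]] T.lincomb_scale[of ts c u] by (simp add: \<epsilon>_def sym_power_ops)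
    qed
    show "\<epsilon> ` shifted_grading n ?s (\<lambda>_. d) e \<subseteq> ?H \<inter> ?G e" for e
    proof
      fix c assume "c \<in> \<epsilon> ` shifted_grading n ?s (\<lambda>_. d) e"
      then obtain u where u: "u \<in> vecs n ?s" "\<forall>i<?s. u i \<in> S_homogeneous n (e - d)" "c = \<epsilon> u"
        by (auto simp: shifted_grading_def)
      have "lincomb T_act ts u \<in> homog weight e"
        unfolding lincomb_def
      proof (rule homog_sum)
        fix i assume "i \<in> {..<?s}"
        then have i: "i < ?s" by simp
        have "x_poly (u i) \<in> homog weight (e - d)"
          by (rule homog_x_poly[of _ n]) (use u(2) i in \<open>simp_all add: weight_def\<close>)
        moreover have "ts ! i \<in> homog weight d" using tsF nth_mem[OF i] by blast
        ultimately show "T_act (u i) (ts ! i) \<in> homog weight e" unfolding T_act_def by (rule homog_mult') simp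
      qed
      then have "c \<in> ?G e" using lcF[OF u(1)] unfolding sym_power_grading_eq u(3) \<epsilon>_def by blast
      moreover have "c \<in> ?H" using image u(1,3) by blast
      ultimately show "c \<in> ?H \<inter> ?G e" by blast
    qed
  qed
  show "has_linear_resolution n (?N\<lparr>carrier := ?H\<rparr>) (\<lambda>e. ?H \<inter> ?G e)"
    by (rule linear_resolution_of_relation_module[OF rel hom]) (simp add: image)
qed

end

theorem proposition3p4:
  fixes M :: "((nat, 'k::field) mpoly, 'b) module"
    and G :: "int \<Rightarrow> 'b set"
    and f :: "nat \<Rightarrow> 'b"
    and n m :: nat
    and less_x less_y :: "nat monomial \<Rightarrow> nat monomial \<Rightarrow> bool"
  assumes "graded_module n M G"
    and "minimal_homogeneous_generators n M G m f"
    and "monomial_order {..<m} less_y"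
    and "monomial_order {..<n} less_x"
    and "x_condition n m (block_order less_y less_x) (presentation_ideal n M m f)"
  shows "\<forall>k. componentwise_linear n (sym_power n M k) (sym_power_grading n M G k)"
proof
  fix k
  define deg_of where "deg_of z = (SOME d. z \<in> G d)" for z
  have "f j \<in> G (deg_of (f j))" if "j < m" for j
    using assms(2) that unfolding deg_of_def minimal_homogeneous_generators_def by (meson someI_ex)
  then interpret linear_initial_ideal n m M G f deg_of less_x less_y
    using assms by unfold_locales
  show "componentwise_linear n (sym_power n M k) (sym_power_grading n M G k)"
    by (rule sym_power_componentwise_linear)
qed

end
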